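(* Let $R$ be a local Artinian Gorenstein ring. If an $R$-module $M$ is rigid and appears as a positive or negative syzygy of an ideal of $R$ (that is, $M\cong\Omega^n I$ for some ideal $I\subseteq R$ and some $n\in\mathbb{Z}$), then $M$ is free. In particular, the Auslander-Reiten conjecture holds for all ideals $I\subseteq R$: if $\operatorname{Ext}^i_R(I,I\oplus R)=0$ for all $i>0$, then $I$ is projective.
   Context: $R$ is a commutative Noetherian ring. A commutative Noetherian ring is Artinian Gorenstein if and only if it is self-injective (injective as a module over itself). An $R$-module $M$ is rigid if $\operatorname{Ext}^1_R(M,M)=0$. Syzygies may be positive or negative. $\Omega^0N=N$. For $n>0$, $\Omega^nN$ is the $n$-th syzygy in the minimal free resolution of $N$: $\Omega N$ is the kernel of a projective cover of $N$, and this is iterated. For $n<0$, $\Omega^{n}N$ is the $|n|$-th cosyzygy in the minimal injective resolution of $N$: $\Omega^{-1}N$ is the cokernel of an injective hull of $N$ (which is free, since $R$ is self-injective), and this is iterated. *)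

theory Defs
  imports
    "Jordan_Normal_Form.Missing_VectorSpace"
    "HOL-Algebra.Ring_Divisibility"
    "HOL-Algebra.Elementary_Groups"
begin

text \<open>These type-class and multiset constants shadow the record-based ones used below.\<close>

hide_const (open) Modules.module Modules.module_hom Multiset.mult

text \<open>
  Modules are the modules of \<^theory>\<open>HOL-Algebra.Module\<close>; homomorphisms, kernels, linear
  (in)dependence, spans and binary direct sums are those of the AFP entry VectorSpace.

  HOL cannot quantify over types inside a formula, so every notion that ranges over all modules
  needs a carrier type for them. For a ring on \<open>'a\<close> and a module on \<open>'m\<close> this type is
  \<open>('a + 'm) list\<close>. Its cardinality is \<open>max(|'a|, |'m|, \<aleph>\<^sub>0)\<close>, so up to isomorphism it carries
  every free module on at most that many generators and all their subquotients; the list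
  structure plays no role.
\<close>

type_synonym ('a, 'm) univ = "('a + 'm) list"


subsection \<open>Rings\<close>

locale artinian_ring = ring R for R (structure) +
  assumes descending_chain:
    "\<And>J :: nat \<Rightarrow> 'a set. (\<And>n. ideal (J n) R) \<Longrightarrow> (\<And>n. J (Suc n) \<subseteq> J n)
       \<Longrightarrow> \<exists>m. \<forall>n\<ge>m. J n = J m"

locale local_ring = cring R for R (structure) +
  assumes unique_maximalideal: "\<exists>!m. maximalideal m R"

definition ideal_module :: "('a, 'r) ring_scheme \<Rightarrow> 'a set \<Rightarrow> ('a, 'a) module" where
  "ideal_module R I = \<lparr>carrier = I, mult = (\<otimes>\<^bsub>R\<^esub>), one = \<one>\<^bsub>R\<^esub>, zero = \<zero>\<^bsub>R\<^esub>,
     add = (\<oplus>\<^bsub>R\<^esub>), smult = (\<otimes>\<^bsub>R\<^esub>)\<rparr>"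

definition self_module :: "('a, 'r) ring_scheme \<Rightarrow> ('a, 'a) module" where
  "self_module R = ideal_module R (carrier R)"


subsection \<open>Isomorphic, free, projective and injective modules\<close>

definition modules_isomorphic ::
    "('a, 'r) ring_scheme \<Rightarrow> ('a, 'm) module \<Rightarrow> ('a, 'n) module \<Rightarrow> bool" where
  "modules_isomorphic R M N \<longleftrightarrow> module R M \<and> module R N \<and>
     (\<exists>f \<in> module_hom R M N. bij_betw f (carrier M) (carrier N))"

definition free_module :: "('a, 'r) ring_scheme \<Rightarrow> ('a, 'm) module \<Rightarrow> bool" where
  "free_module R M \<longleftrightarrow> module R M \<and>
     (\<exists>B \<subseteq> carrier M. module.gen_set R M B \<and> module.lin_indpt R M B)"

text \<open>
  Lifting along the surjections between modules carried by \<open>('a, 'm) univ\<close> is lifting along all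
  surjections: a free module that maps onto \<open>M\<close> and a copy of \<open>M\<close> itself live there, hence
  \<open>M\<close> is a direct summand of a free module.
\<close>
definition projective_module :: "('a, 'r) ring_scheme \<Rightarrow> ('a, 'm) module \<Rightarrow> bool" where
  "projective_module R M \<longleftrightarrow> module R M \<and>
     (\<forall>(B :: ('a, ('a, 'm) univ) module) (C :: ('a, ('a, 'm) univ) module).
        \<forall>g \<in> module_hom R B C. \<forall>h \<in> module_hom R M C.
          module R B \<and> module R C \<and> g ` carrier B = carrier C \<longrightarrow>
          (\<exists>k \<in> module_hom R M B. \<forall>x \<in> carrier M. g (k x) = h x))"

text \<open>
  Extension along the monomorphisms between modules carried by \<open>('a, 'm) univ\<close> is extension
  along all monomorphisms by Baer's criterion, because copies of the ring and of its ideals live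
  there.
\<close>
definition injective_module :: "('a, 'r) ring_scheme \<Rightarrow> ('a, 'm) module \<Rightarrow> bool" where
  "injective_module R M \<longleftrightarrow> module R M \<and>
     (\<forall>(A :: ('a, ('a, 'm) univ) module) (B :: ('a, ('a, 'm) univ) module).
        \<forall>g \<in> module_hom R A B. \<forall>h \<in> module_hom R A M.
          module R A \<and> module R B \<and> inj_on g (carrier A) \<longrightarrow>
          (\<exists>k \<in> module_hom R B M. \<forall>x \<in> carrier A. k (g x) = h x))"

text \<open>
  An Artinian ring is Gorenstein iff it is injective as a module over itself. For commutative
  Noetherian rings self-injectivity already implies the descending chain condition, so the latter
  is redundant here.
\<close>
locale artinian_gorenstein_ring = cring R + noetherian_ring R + artinian_ring R
  for R (structure) +
  assumes self_injective: "injective_module R (self_module R)"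


subsection \<open>Syzygies and cosyzygies\<close>

definition projective_cover ::
    "('a, 'r) ring_scheme \<Rightarrow> ('a, 'p) module \<Rightarrow> ('p \<Rightarrow> 'm) \<Rightarrow> ('a, 'm) module \<Rightarrow> bool" where
  "projective_cover R P f M \<longleftrightarrow> projective_module R P \<and> module R M \<and>
     f \<in> module_hom R P M \<and> f ` carrier P = carrier M \<and>
     (\<forall>L. LinearCombinations.submodule R L P \<longrightarrow>
        module.submodule_sum P (mod_hom.ker P M f) L = carrier P \<longrightarrow> L = carrier P)"

definition injective_hull ::
    "('a, 'r) ring_scheme \<Rightarrow> ('a, 'm) module \<Rightarrow> ('m \<Rightarrow> 'e) \<Rightarrow> ('a, 'e) module \<Rightarrow> bool" where
  "injective_hull R M f E \<longleftrightarrow> injective_module R E \<and> module R M \<and>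
     f \<in> module_hom R M E \<and> inj_on f (carrier M) \<and>
     (\<forall>L. LinearCombinations.submodule R L E \<longrightarrow>
        L \<inter> f ` carrier M = {\<zero>\<^bsub>E\<^esub>} \<longrightarrow> L = {\<zero>\<^bsub>E\<^esub>})"

text \<open>\<open>K \<cong> \<Omega> M\<close>: there is an exact sequence \<open>0 \<rightarrow> K \<rightarrow> P \<rightarrow> M \<rightarrow> 0\<close> with \<open>P \<rightarrow> M\<close> a projective cover.\<close>
definition first_syzygy ::
    "('a, 'r) ring_scheme \<Rightarrow> ('a, 'm) module \<Rightarrow> ('a, 'k) module \<Rightarrow> bool" where
  "first_syzygy R M K \<longleftrightarrow> module R K \<and>
     (\<exists>(P :: ('a, ('a, 'm) univ) module) f. projective_cover R P f M \<and>
        (\<exists>g \<in> module_hom R K P. inj_on g (carrier K) \<and> g ` carrier K = mod_hom.ker P M f))"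

text \<open>
  \<open>C \<cong> \<Omega>\<^sup>-\<^sup>1 M\<close>: there is an exact sequence \<open>0 \<rightarrow> M \<rightarrow> E \<rightarrow> C \<rightarrow> 0\<close> with \<open>M \<rightarrow> E\<close> an injective hull.
  The hull can be taken on \<open>('a, 'm) univ\<close> when the ring is Noetherian and self-injective, since
  \<open>M\<close> then embeds into a free module on that type, and free modules are injective.
\<close>
definition first_cosyzygy ::
    "('a, 'r) ring_scheme \<Rightarrow> ('a, 'm) module \<Rightarrow> ('a, 'c) module \<Rightarrow> bool" where
  "first_cosyzygy R M C \<longleftrightarrow> module R C \<and>
     (\<exists>(E :: ('a, ('a, 'm) univ) module) f. injective_hull R M f E \<and>
        (\<exists>g \<in> module_hom R E C. g ` carrier E = carrier C \<and> mod_hom.ker E C g = f ` carrier M))"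

fun nth_syzygy ::
    "('a, 'r) ring_scheme \<Rightarrow> nat \<Rightarrow> ('a, 'm) module \<Rightarrow> ('a, 'm) module \<Rightarrow> bool" where
  "nth_syzygy R 0 N K \<longleftrightarrow> modules_isomorphic R N K"
| "nth_syzygy R (Suc n) N K \<longleftrightarrow> (\<exists>L. nth_syzygy R n N L \<and> first_syzygy R L K)"

fun nth_cosyzygy ::
    "('a, 'r) ring_scheme \<Rightarrow> nat \<Rightarrow> ('a, 'm) module \<Rightarrow> ('a, 'm) module \<Rightarrow> bool" where
  "nth_cosyzygy R 0 N C \<longleftrightarrow> modules_isomorphic R N C"
| "nth_cosyzygy R (Suc n) N C \<longleftrightarrow> (\<exists>L. nth_cosyzygy R n N L \<and> first_cosyzygy R L C)"

text \<open>
  \<open>M \<cong> \<Omega>\<^sup>n N\<close> for an integer \<open>n\<close>. The modules of the iteration are copies carried by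
  \<open>('a, 'n) univ\<close>, so that \<open>M\<close> and \<open>N\<close> may have arbitrary carrier types.
\<close>
definition is_syzygy ::
    "('a, 'r) ring_scheme \<Rightarrow> int \<Rightarrow> ('a, 'n) module \<Rightarrow> ('a, 'm) module \<Rightarrow> bool" where
  "is_syzygy R n N M \<longleftrightarrow>
     (\<exists>(N' :: ('a, ('a, 'n) univ) module) (M' :: ('a, ('a, 'n) univ) module).
        modules_isomorphic R N N' \<and> modules_isomorphic R M M' \<and>
        (if n \<ge> 0 then nth_syzygy R (nat n) N' M' else nth_cosyzygy R (nat (- n)) N' M'))"


subsection \<open>Ext\<close>

definition projective_resolution ::
    "('a, 'r) ring_scheme \<Rightarrow> ('a, 'm) module \<Rightarrow>
     (nat \<Rightarrow> ('a, 'p) module) \<Rightarrow> (nat \<Rightarrow> 'p \<Rightarrow> 'p) \<Rightarrow> ('p \<Rightarrow> 'm) \<Rightarrow> bool" where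
  "projective_resolution R M P d \<epsilon> \<longleftrightarrow>
     (\<forall>i. projective_module R (P i)) \<and>
     (\<forall>i. d i \<in> module_hom R (P (Suc i)) (P i)) \<and>
     \<epsilon> \<in> module_hom R (P 0) M \<and>
     \<epsilon> ` carrier (P 0) = carrier M \<and>
     d 0 ` carrier (P 1) = mod_hom.ker (P 0) M \<epsilon> \<and>
     (\<forall>i. d (Suc i) ` carrier (P (Suc (Suc i))) = mod_hom.ker (P (Suc i)) (P i) (d i))"

definition Hom_group ::
    "('a, 'r) ring_scheme \<Rightarrow> ('a, 'm) module \<Rightarrow> ('a, 'n) module \<Rightarrow> ('m \<Rightarrow> 'n) monoid" where
  "Hom_group R M N = \<lparr>carrier = module_hom R M N \<inter> extensional (carrier M),
     mult = (\<lambda>f g. \<lambda>x\<in>carrier M. f x \<oplus>\<^bsub>N\<^esub> g x), one = (\<lambda>x\<in>carrier M. \<zero>\<^bsub>N\<^esub>)\<rparr>"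

definition cocycles ::
    "('a, 'r) ring_scheme \<Rightarrow> (nat \<Rightarrow> ('a, 'p) module) \<Rightarrow> (nat \<Rightarrow> 'p \<Rightarrow> 'p) \<Rightarrow> ('a, 'n) module \<Rightarrow>
     nat \<Rightarrow> ('p \<Rightarrow> 'n) set" where
  "cocycles R P d N i =
     {f \<in> carrier (Hom_group R (P i) N). \<forall>x \<in> carrier (P (Suc i)). f (d i x) = \<zero>\<^bsub>N\<^esub>}"

fun coboundaries ::
    "('a, 'r) ring_scheme \<Rightarrow> (nat \<Rightarrow> ('a, 'p) module) \<Rightarrow> (nat \<Rightarrow> 'p \<Rightarrow> 'p) \<Rightarrow> ('a, 'n) module \<Rightarrow>
     nat \<Rightarrow> ('p \<Rightarrow> 'n) set" where
  "coboundaries R P d N 0 = {\<one>\<^bsub>Hom_group R (P 0) N\<^esub>}"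
| "coboundaries R P d N (Suc i) =
     (\<lambda>f. compose (carrier (P (Suc i))) f (d i)) ` carrier (Hom_group R (P i) N)"

text \<open>
  \<open>Ext\<^sup>i(M, N)\<close> as an abelian group: the \<open>i\<close>-th cohomology of \<open>Hom(P, N)\<close> for a chosen projective
  resolution \<open>P\<close> of \<open>M\<close>. A resolution exists, see \<open>projective_resolution_exists\<close> below.
\<close>
definition Ext ::
    "('a, 'r) ring_scheme \<Rightarrow> nat \<Rightarrow> ('a, 'm) module \<Rightarrow> ('a, 'n) module \<Rightarrow>
     (('a, 'm) univ \<Rightarrow> 'n) set monoid" where
  "Ext R i M N =
     (let (P, d, \<epsilon>) = (SOME (P, d, \<epsilon>). projective_resolution R M P d \<epsilon>)
      in (Hom_group R (P i) N)\<lparr>carrier := cocycles R P d N i\<rparr> Mod coboundaries R P d N i)"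

definition rigid :: "('a, 'r) ring_scheme \<Rightarrow> ('a, 'm) module \<Rightarrow> bool" where
  "rigid R M \<longleftrightarrow> trivial_group (Ext R 1 M M)"

subsection \<open>Existence of projective resolutions\<close>

text \<open>
  This justifies the choice made in \<open>Ext\<close>. Free modules are modules of functions with finite
  support, transported to \<open>('a, 'm) univ\<close> along the injection of \<open>finite_support_inj\<close>.
\<close>

primrec enc1 :: "('a + 'm) list \<Rightarrow> ('a + 'm) list" where
  "enc1 [] = [Inl undefined]"
| "enc1 (c # u) = Inr undefined # c # enc1 u"

lemma enc1_append: "enc1 u @ r = enc1 u' @ r' \<Longrightarrow> u = u' \<and> r = r'"
proof (induction u arbitrary: u')
  case Nil then show ?case by (cases u') auto
next
  case (Cons c u) then show ?case by (cases u') auto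
qed

lemma inj_enc: "inj (\<lambda>us. concat (map enc1 us))"
proof (rule injI)
  fix us vs :: "('a + 'm) list list"
  show "concat (map enc1 us) = concat (map enc1 vs) \<Longrightarrow> us = vs"
  proof (induction us arbitrary: vs)
    case Nil
    have "enc1 u \<noteq> []" for u :: "('a + 'm) list" by (cases u) auto
    with Nil show ?case by (cases vs) auto
  next
    case (Cons u us)
    then show ?case
    proof (cases vs)
      case Nil then show ?thesis using Cons.prems by (cases u) auto
    next
      case (Cons v vs')
      with Cons.prems enc1_append[of u _ v] have "u = v" "concat (map enc1 us) = concat (map enc1 vs')" by auto
      with Cons.IH Cons show ?thesis by auto
    qed
  qed
qed

lemma finite_support_inj:
  fixes k :: "'x \<Rightarrow> ('a, 'm) univ" and z :: 'a
  assumes "inj k"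
  shows "\<exists>\<iota> :: ('x \<Rightarrow> 'a) \<Rightarrow> ('a, 'm) univ. inj_on \<iota> {f. finite {x. f x \<noteq> z}}"
proof -
  define l where "l f = (SOME xs. set xs = {(x, f x) | x. f x \<noteq> z})" for f :: "'x \<Rightarrow> 'a"
  define j where "j = (\<lambda>(x :: 'x, a :: 'a). Inl a # k x :: ('a, 'm) univ)"
  have l: "set (l f) = {(x, f x) | x. f x \<noteq> z}" if "finite {x. f x \<noteq> z}" for f
  proof -
    have "finite {(x, f x) | x. f x \<noteq> z}" using that by simp
    from finite_list[OF this] show ?thesis unfolding l_def by (rule someI_ex)
  qed
  have inj_l: "inj_on l {f. finite {x. f x \<noteq> z}}"
  proof (rule inj_onI, rule ext)
    fix f g x assume fg: "f \<in> {f. finite {x. f x \<noteq> z}}" "g \<in> {f. finite {x. f x \<noteq> z}}"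
      and lfg: "l f = l g"
    have "set (l f) = {(x, f x) | x. f x \<noteq> z}" "set (l g) = {(x, g x) | x. g x \<noteq> z}"
      using fg by (simp_all only: mem_Collect_eq l)
    then have "(x, y) \<in> {(x, f x) | x. f x \<noteq> z} \<longleftrightarrow> (x, y) \<in> {(x, g x) | x. g x \<noteq> z}" for y
      by (simp only: lfg)
    then have "f x = y \<and> f x \<noteq> z \<longleftrightarrow> g x = y \<and> g x \<noteq> z" for y
      by blast
    then show "f x = g x" by metis
  qed
  have j: "inj j" by (rule injI) (auto simp: j_def dest: injD[OF assms])
  have "inj_on (\<lambda>f. concat (map enc1 (map j (l f)))) {f. finite {x. f x \<noteq> z}}"
  proof (rule inj_onI)
    fix f g assume fg: "f \<in> {f. finite {x. f x \<noteq> z}}" "g \<in> {f. finite {x. f x \<noteq> z}}"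
      and "concat (map enc1 (map j (l f))) = concat (map enc1 (map j (l g)))"
    then have "map j (l f) = map j (l g)" by (metis inj_enc injD)
    then have "l f = l g" using j by (metis inj_map_eq_map)
    then show "f = g" using inj_l fg by (rule_tac inj_onD)
  qed
  then show ?thesis by blast
qed

definition finsupp_module :: "('a, 'r) ring_scheme \<Rightarrow> 'x set \<Rightarrow> ('a, 'x \<Rightarrow> 'a) module" where
  "finsupp_module R X = \<lparr>
    carrier = {f \<in> UNIV \<rightarrow> carrier R. finite {x. f x \<noteq> \<zero>\<^bsub>R\<^esub>} \<and> {x. f x \<noteq> \<zero>\<^bsub>R\<^esub>} \<subseteq> X},
    mult = undefined, one = undefined, zero = (\<lambda>_. \<zero>\<^bsub>R\<^esub>), add = (\<lambda>f g x. f x \<oplus>\<^bsub>R\<^esub> g x),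
    smult = (\<lambda>r f x. r \<otimes>\<^bsub>R\<^esub> f x)\<rparr>"

lemma (in cring) finsupp_module: "module R (finsupp_module R X)"
proof -
  have fin: "finite {x. (f x \<oplus> g x) \<noteq> \<zero>}" "{x. (f x \<oplus> g x) \<noteq> \<zero>} \<subseteq> X"
    if "finite {x. f x \<noteq> \<zero>}" "{x. f x \<noteq> \<zero>} \<subseteq> X" "finite {x. g x \<noteq> \<zero>}" "{x. g x \<noteq> \<zero>} \<subseteq> X"  for f g
  proof -
    have "{x. (f x \<oplus> g x) \<noteq> \<zero>} \<subseteq> {x. f x \<noteq> \<zero>} \<union> {x. g x \<noteq> \<zero>}" by auto
    then show "finite {x. (f x \<oplus> g x) \<noteq> \<zero>}" "{x. (f x \<oplus> g x) \<noteq> \<zero>} \<subseteq> X"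
      using that by (auto intro: finite_subset)
  qed
  have fin2: "finite {x. r \<otimes> f x \<noteq> \<zero>}" "{x. r \<otimes> f x \<noteq> \<zero>} \<subseteq> X"
    if "r \<in> carrier R" "finite {x. f x \<noteq> \<zero>}" "{x. f x \<noteq> \<zero>} \<subseteq> X" for r f
  proof -
    have "{x. r \<otimes> f x \<noteq> \<zero>} \<subseteq> {x. f x \<noteq> \<zero>}" using that(1) by auto
    then show "finite {x. r \<otimes> f x \<noteq> \<zero>}" "{x. r \<otimes> f x \<noteq> \<zero>} \<subseteq> X"
      using that by (auto intro: finite_subset)
  qed
  have neg: "\<forall>v\<in>carrier (finsupp_module R X).
       \<exists>neg_v\<in>carrier (finsupp_module R X).
          v \<oplus>\<^bsub>finsupp_module R X\<^esub> neg_v = \<zero>\<^bsub>finsupp_module R X\<^esub>"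
  proof
    fix v assume v: "v \<in> carrier (finsupp_module R X)"
    have "(\<lambda>x. \<ominus> \<one> \<otimes> v x) \<in> carrier (finsupp_module R X)"
      using v fin2[of "\<ominus> \<one>" v] by (auto simp: finsupp_module_def)
    moreover have "v \<oplus>\<^bsub>finsupp_module R X\<^esub> (\<lambda>x. \<ominus> \<one> \<otimes> v x) = \<zero>\<^bsub>finsupp_module R X\<^esub>"
      using v by (auto simp: finsupp_module_def fun_eq_iff Pi_iff l_minus r_neg)
    ultimately show "\<exists>neg_v\<in>carrier (finsupp_module R X).
          v \<oplus>\<^bsub>finsupp_module R X\<^esub> neg_v = \<zero>\<^bsub>finsupp_module R X\<^esub>" by blast
  qed
  show ?thesis
    by (rule module_criteria[OF is_cring]; (rule neg)?)
       (auto simp: finsupp_module_def fun_eq_iff Pi_iff fin fin2 a_ac m_assoc l_distr r_distr)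
qed

definition transport :: "('a, 'r) ring_scheme \<Rightarrow> ('m \<Rightarrow> 'u) \<Rightarrow> ('a, 'm, 's) module_scheme \<Rightarrow> ('a, 'u) module" where
  "transport R \<iota> M = (let \<rho> = inv_into (carrier M) \<iota> in \<lparr>carrier = \<iota> ` carrier M, mult = undefined, one = undefined,
    zero = \<iota> \<zero>\<^bsub>M\<^esub>, add = (\<lambda>u v. \<iota> (\<rho> u \<oplus>\<^bsub>M\<^esub> \<rho> v)), smult = (\<lambda>r u. \<iota> (r \<odot>\<^bsub>M\<^esub> \<rho> u))\<rparr>)"

lemma (in Module.module) transport:
  assumes "inj_on \<iota> (carrier M)"
  shows "module R (transport R \<iota> M)"
    and "\<iota> \<in> module_hom R M (transport R \<iota> M)"
    and "inv_into (carrier M) \<iota> \<in> module_hom R (transport R \<iota> M) M"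
proof -
  note [simp] = inv_into_f_f[OF assms]
  show "module R (transport R \<iota> M)"
  proof (rule module_criteria)
    show "cring R" by (rule R.is_cring)
    show "\<forall>v\<in>carrier (transport R \<iota> M). \<exists>w\<in>carrier (transport R \<iota> M).
      v \<oplus>\<^bsub>transport R \<iota> M\<^esub> w = \<zero>\<^bsub>transport R \<iota> M\<^esub>"
    proof
      fix v assume "v \<in> carrier (transport R \<iota> M)"
      then obtain x where "x \<in> carrier M" "v = \<iota> x" by (auto simp: transport_def Let_def)
      then show "\<exists>w\<in>carrier (transport R \<iota> M). v \<oplus>\<^bsub>transport R \<iota> M\<^esub> w = \<zero>\<^bsub>transport R \<iota> M\<^esub>"
        by (intro bexI[of _ "\<iota> (\<ominus>\<^bsub>M\<^esub> x)"]) (auto simp: transport_def Let_def M.r_neg)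
    qed
  qed (auto simp: transport_def Let_def M.a_ac smult_l_distr smult_r_distr smult_assoc1)
  show "\<iota> \<in> module_hom R M (transport R \<iota> M)"
    by (auto simp: LinearCombinations.module_hom_def transport_def Let_def)
  show "inv_into (carrier M) \<iota> \<in> module_hom R (transport R \<iota> M) M"
    by (auto simp: LinearCombinations.module_hom_def transport_def Let_def)
qed


lemma module_hom_finsum:
  assumes "module R M" "module R N" "f \<in> module_hom R M N" "finite A" "b \<in> A \<rightarrow> carrier M"
  shows "f (\<Oplus>\<^bsub>M\<^esub>x\<in>A. b x) = (\<Oplus>\<^bsub>N\<^esub>x\<in>A. f (b x))"
proof -
  interpret mod_hom R M N f using assms by (simp add: mod_hom_def mod_hom_axioms_def)
  show ?thesis using assms(4,5)
    by (induction A) (auto simp: Pi_iff)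
qed

definition ev :: "('a, 'r) ring_scheme \<Rightarrow> ('a, 'n, 's) module_scheme \<Rightarrow> ('x \<Rightarrow> 'n) \<Rightarrow> ('x \<Rightarrow> 'a) \<Rightarrow> 'n" where
  "ev R N b f = (\<Oplus>\<^bsub>N\<^esub>x\<in>{x. f x \<noteq> \<zero>\<^bsub>R\<^esub>}. f x \<odot>\<^bsub>N\<^esub> b x)"

definition unit_fun :: "('a, 'r) ring_scheme \<Rightarrow> 'x \<Rightarrow> 'x \<Rightarrow> 'a" where
  "unit_fun R x y = (if x = y then \<one>\<^bsub>R\<^esub> else \<zero>\<^bsub>R\<^esub>)"

lemma (in cring) unit_fun_closed: "x \<in> X \<Longrightarrow> unit_fun R x \<in> carrier (finsupp_module R X)"
  by (auto simp: finsupp_module_def unit_fun_def intro: finite_subset[of _ "{x}"])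

lemma (in Module.module) ev_superset:
  assumes "b \<in> X \<rightarrow> carrier M" "f \<in> carrier (finsupp_module R X)" "finite S" "S \<subseteq> X" "{x. f x \<noteq> \<zero>\<^bsub>R\<^esub>} \<subseteq> S"
  shows "ev R M b f = (\<Oplus>\<^bsub>M\<^esub>x\<in>S. f x \<odot>\<^bsub>M\<^esub> b x)"
  unfolding ev_def
  by (rule M.add.finprod_mono_neutral_cong_left)
     (use assms in \<open>auto simp: finsupp_module_def Pi_iff subset_iff\<close>)

lemma (in Module.module) ev_hom:
  assumes "b \<in> X \<rightarrow> carrier M"
  shows "ev R M b \<in> module_hom R (finsupp_module R X) M"
proof -
  have add: "ev R M b (f \<oplus>\<^bsub>finsupp_module R X\<^esub> g) = ev R M b f \<oplus>\<^bsub>M\<^esub> ev R M b g"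
    if f: "f \<in> carrier (finsupp_module R X)" and g: "g \<in> carrier (finsupp_module R X)" for f g
  proof -
    interpret F: Module.module R "finsupp_module R X" by (rule R.finsupp_module)
    have fg: "f \<oplus>\<^bsub>finsupp_module R X\<^esub> g \<in> carrier (finsupp_module R X)" using f g by simp
    define S where "S = {x. f x \<noteq> \<zero>\<^bsub>R\<^esub>} \<union> {x. g x \<noteq> \<zero>\<^bsub>R\<^esub>}"
    have S: "finite S" "S \<subseteq> X" "{x. f x \<noteq> \<zero>\<^bsub>R\<^esub>} \<subseteq> S" "{x. g x \<noteq> \<zero>\<^bsub>R\<^esub>} \<subseteq> S"
      "{x. (f \<oplus>\<^bsub>finsupp_module R X\<^esub> g) x \<noteq> \<zero>\<^bsub>R\<^esub>} \<subseteq> S"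
      using f g by (auto simp: finsupp_module_def S_def Pi_iff)
    have c: "f x \<in> carrier R" "g x \<in> carrier R" for x using f g by (auto simp: finsupp_module_def)
    have "(\<Oplus>\<^bsub>M\<^esub>x\<in>S. (f \<oplus>\<^bsub>finsupp_module R X\<^esub> g) x \<odot>\<^bsub>M\<^esub> b x)
        = (\<Oplus>\<^bsub>M\<^esub>x\<in>S. f x \<odot>\<^bsub>M\<^esub> b x \<oplus>\<^bsub>M\<^esub> g x \<odot>\<^bsub>M\<^esub> b x)"
      using S(2) assms c
      by (intro M.finsum_cong') (auto simp: finsupp_module_def Pi_iff subset_iff smult_l_distr)
    also have "\<dots> = (\<Oplus>\<^bsub>M\<^esub>x\<in>S. f x \<odot>\<^bsub>M\<^esub> b x) \<oplus>\<^bsub>M\<^esub> (\<Oplus>\<^bsub>M\<^esub>x\<in>S. g x \<odot>\<^bsub>M\<^esub> b x)"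
      using S(2) assms c by (intro M.finsum_addf) (auto simp: Pi_iff subset_iff)
    finally show ?thesis
      using ev_superset[OF assms fg S(1,2,5)] ev_superset[OF assms f S(1,2,3)]
        ev_superset[OF assms g S(1,2,4)] by simp
  qed
  have smult: "ev R M b (r \<odot>\<^bsub>finsupp_module R X\<^esub> f) = r \<odot>\<^bsub>M\<^esub> ev R M b f"
    if r: "r \<in> carrier R" and f: "f \<in> carrier (finsupp_module R X)" for r f
  proof -
    interpret F: Module.module R "finsupp_module R X" by (rule R.finsupp_module)
    have rf: "r \<odot>\<^bsub>finsupp_module R X\<^esub> f \<in> carrier (finsupp_module R X)" using r f by simp
    define S where "S = {x. f x \<noteq> \<zero>\<^bsub>R\<^esub>}"
    have S: "finite S" "S \<subseteq> X" "{x. f x \<noteq> \<zero>\<^bsub>R\<^esub>} \<subseteq> S" "{x. (r \<odot>\<^bsub>finsupp_module R X\<^esub> f) x \<noteq> \<zero>\<^bsub>R\<^esub>} \<subseteq> S"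
      using f r by (auto simp: finsupp_module_def S_def Pi_iff)
    have c: "f x \<in> carrier R" for x using f by (auto simp: finsupp_module_def)
    have "(\<Oplus>\<^bsub>M\<^esub>x\<in>S. (r \<odot>\<^bsub>finsupp_module R X\<^esub> f) x \<odot>\<^bsub>M\<^esub> b x)
        = (\<Oplus>\<^bsub>M\<^esub>x\<in>S. r \<odot>\<^bsub>M\<^esub> (f x \<odot>\<^bsub>M\<^esub> b x))"
      using S(2) assms c r
      by (intro M.finsum_cong') (auto simp: finsupp_module_def Pi_iff subset_iff smult_assoc1)
    also have "\<dots> = r \<odot>\<^bsub>M\<^esub> (\<Oplus>\<^bsub>M\<^esub>x\<in>S. f x \<odot>\<^bsub>M\<^esub> b x)"
      using S(1,2) assms c r by (intro finsum_smult_ldistr[symmetric]) (auto simp: Pi_iff subset_iff)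
    finally show ?thesis
      using ev_superset[OF assms rf S(1,2,4)] ev_superset[OF assms f S(1,2,3)] by simp
  qed
  have "ev R M b f \<in> carrier M" if "f \<in> carrier (finsupp_module R X)" for f
    unfolding ev_def using that assms
    by (intro M.finsum_closed) (auto simp: finsupp_module_def Pi_iff subset_iff)
  with add smult show ?thesis by (auto simp: LinearCombinations.module_hom_def)
qed

lemma (in Module.module) ev_unit_fun:
  assumes "x \<in> X" "b \<in> X \<rightarrow> carrier M"
  shows "ev R M b (unit_fun R x) = b x"
proof -
  have "ev R M b (unit_fun R x) = (\<Oplus>\<^bsub>M\<^esub>y\<in>{x}. unit_fun R x y \<odot>\<^bsub>M\<^esub> b y)"
    by (rule ev_superset[OF assms(2) R.unit_fun_closed]) (use assms in \<open>auto simp: unit_fun_def\<close>)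
  also have "\<dots> = b x" using assms by (simp add: unit_fun_def Pi_iff)
  finally show ?thesis .
qed

lemma (in cring) finsupp_module_expand:
  assumes f: "f \<in> carrier (finsupp_module R X)"
  shows "ev R (finsupp_module R X) (unit_fun R) f = f"
proof -
  interpret F: Module.module R "finsupp_module R X" by (rule finsupp_module)
  have u: "unit_fun R x \<in> carrier (finsupp_module R X)" if "x \<in> X" for x
    using that by (rule unit_fun_closed)
  have c: "f x \<in> carrier R" for x using f by (auto simp: finsupp_module_def)
  have cl: "f x \<odot>\<^bsub>finsupp_module R X\<^esub> unit_fun R x \<in> carrier (finsupp_module R X)" if "x \<in> X" for x
    by (rule F.smult_closed[OF c u[OF that]])
  have "(\<Oplus>\<^bsub>finsupp_module R X\<^esub>x\<in>S. f x \<odot>\<^bsub>finsupp_module R X\<^esub> unit_fun R x) = (\<lambda>y. if y \<in> S then f y else \<zero>)"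
    if "finite S" "S \<subseteq> X" for S
    using that
  proof (induction S)
    case empty
    show ?case by (simp only: F.M.finsum_empty) (simp add: finsupp_module_def)
  next
    case (insert x S)
    have "(\<Oplus>\<^bsub>finsupp_module R X\<^esub>x\<in>insert x S. f x \<odot>\<^bsub>finsupp_module R X\<^esub> unit_fun R x)
      = f x \<odot>\<^bsub>finsupp_module R X\<^esub> unit_fun R x \<oplus>\<^bsub>finsupp_module R X\<^esub>
        (\<Oplus>\<^bsub>finsupp_module R X\<^esub>x\<in>S. f x \<odot>\<^bsub>finsupp_module R X\<^esub> unit_fun R x)"
      by (rule F.M.finsum_insert) (use insert.hyps insert.prems cl in auto)
    also have "\<dots> = f x \<odot>\<^bsub>finsupp_module R X\<^esub> unit_fun R x \<oplus>\<^bsub>finsupp_module R X\<^esub>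
        (\<lambda>y. if y \<in> S then f y else \<zero>)"
      using insert.IH insert.prems by simp
    also have "\<dots> = (\<lambda>y. if y \<in> insert x S then f y else \<zero>)"
    proof
      fix y show "(f x \<odot>\<^bsub>finsupp_module R X\<^esub> unit_fun R x \<oplus>\<^bsub>finsupp_module R X\<^esub>
        (\<lambda>y. if y \<in> S then f y else \<zero>)) y = (if y \<in> insert x S then f y else \<zero>)"
        using insert.hyps(2) c[of x] c[of y] by (auto simp: finsupp_module_def unit_fun_def)
    qed
    finally show ?case .
  qed
  note * = this
  have "finite {x. f x \<noteq> \<zero>}" "{x. f x \<noteq> \<zero>} \<subseteq> X" using f by (simp_all add: finsupp_module_def)
  from *[OF this] have "ev R (finsupp_module R X) (unit_fun R) f = (\<lambda>y. if y \<in> {x. f x \<noteq> \<zero>} then f y else \<zero>)"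
    by (simp only: ev_def)
  also have "\<dots> = f" by (rule ext) simp
  finally show ?thesis .
qed

lemma (in cring) hom_finsupp_module:
  assumes "module R N" "h \<in> module_hom R (finsupp_module R X) N" "f \<in> carrier (finsupp_module R X)"
  shows "h f = ev R N (\<lambda>x. h (unit_fun R x)) f"
proof -
  interpret F: Module.module R "finsupp_module R X" by (rule finsupp_module)
  interpret h: mod_hom R "finsupp_module R X" N h
    using assms F.module_axioms by (simp add: mod_hom_def mod_hom_axioms_def)
  have c: "f x \<in> carrier R" for x using assms(3) by (auto simp: finsupp_module_def)
  have fin: "finite {x. f x \<noteq> \<zero>}" "{x. f x \<noteq> \<zero>} \<subseteq> X" using assms(3) by (auto simp: finsupp_module_def)
  have u: "unit_fun R x \<in> carrier (finsupp_module R X)" if "f x \<noteq> \<zero>" for x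
    by (rule unit_fun_closed) (use that fin(2) in blast)
  have hu: "h (unit_fun R x) \<in> carrier N" if "f x \<noteq> \<zero>" for x
    using u[OF that] assms(2) by (auto simp: LinearCombinations.module_hom_def)
  have "h f = h (ev R (finsupp_module R X) (unit_fun R) f)"
    by (simp only: finsupp_module_expand[OF assms(3)])
  also have "\<dots> = (\<Oplus>\<^bsub>N\<^esub>x\<in>{x. f x \<noteq> \<zero>}. h (f x \<odot>\<^bsub>finsupp_module R X\<^esub> unit_fun R x))"
    unfolding ev_def
    by (rule module_hom_finsum[OF F.module_axioms assms(1,2) fin(1)]) (simp add: c u)
  also have "\<dots> = ev R N (\<lambda>x. h (unit_fun R x)) f"
    unfolding ev_def by (rule h.N.M.finsum_cong') (simp_all add: c u hu)
  finally show ?thesis .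
qed

lemma module_hom_comp:
  "f \<in> module_hom R A B \<Longrightarrow> g \<in> module_hom R B C \<Longrightarrow> (\<lambda>x. g (f x)) \<in> module_hom R A C"
  by (simp add: LinearCombinations.module_hom_def Pi_iff)

lemma projective_cover_exists:
  fixes M :: "('a, 'x) module" and k :: "'x \<Rightarrow> ('a, 'm) univ"
  assumes "module R M" "inj k"
  shows "\<exists>(P :: ('a, ('a, 'm) univ) module) e. projective_module R P \<and> e \<in> module_hom R P M \<and> e ` carrier P = carrier M"
proof -
  interpret Module.module R M by fact
  define X where "X = carrier M"
  define F where "F = finsupp_module R X"
  interpret F: Module.module R F unfolding F_def by (rule R.finsupp_module)
  obtain \<iota> :: "('x \<Rightarrow> 'a) \<Rightarrow> ('a, 'm) univ" where "inj_on \<iota> {f. finite {x. f x \<noteq> \<zero>\<^bsub>R\<^esub>}}"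
    using finite_support_inj[OF assms(2)] by blast
  then have inj: "inj_on \<iota> (carrier F)"
    by (rule inj_on_subset) (auto simp: F_def finsupp_module_def)
  define P where "P = transport R \<iota> F"
  define \<rho> where "\<rho> = inv_into (carrier F) \<iota>"
  note tr = F.transport[OF inj, folded P_def \<rho>_def]
  have carP: "carrier P = \<iota> ` carrier F" by (simp add: P_def transport_def Let_def)
  have \<rho>\<iota>: "\<rho> (\<iota> f) = f" if "f \<in> carrier F" for f using that inj by (simp add: \<rho>_def)
  have u: "unit_fun R x \<in> carrier F" if "x \<in> X" for x
    using that R.unit_fun_closed by (auto simp: F_def)
  have "projective_module R P"
    unfolding projective_module_def
  proof (intro conjI allI ballI impI tr(1))
    fix B C :: "('a, ('a, ('a, 'm) univ) univ) module" and g h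
    assume g: "g \<in> module_hom R B C" and h: "h \<in> module_hom R P C"
      and BC: "module R B \<and> module R C \<and> g ` carrier B = carrier C"
    interpret B: Module.module R B using BC by simp
    have hC: "h (\<iota> (unit_fun R x)) \<in> carrier C" if "x \<in> X" for x
      using h u[OF that] by (auto simp: LinearCombinations.module_hom_def carP)
    then have "\<exists>b. b \<in> carrier B \<and> g b = h (\<iota> (unit_fun R x))" if "x \<in> X" for x
      using BC that by (metis imageE)
    then obtain b where b: "\<And>x. x \<in> X \<Longrightarrow> b x \<in> carrier B \<and> g (b x) = h (\<iota> (unit_fun R x))" by metis
    then have bX: "b \<in> X \<rightarrow> carrier B" by auto
    have ev: "ev R B b \<in> module_hom R F B" unfolding F_def by (rule B.ev_hom[OF bX])
    have "(\<lambda>x. ev R B b (\<rho> x)) \<in> module_hom R P B" by (rule module_hom_comp[OF tr(3) ev])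
    moreover have "g (ev R B b (\<rho> x)) = h x" if "x \<in> carrier P" for x
    proof -
      from that obtain f where f: "f \<in> carrier F" "x = \<iota> f" by (auto simp: carP)
      have h': "(\<lambda>f. h (\<iota> f)) \<in> module_hom R F C" by (rule module_hom_comp[OF tr(2) h])
      have g': "(\<lambda>f. g (ev R B b f)) \<in> module_hom R F C" by (rule module_hom_comp[OF ev g])
      have "g (ev R B b f) = ev R C (\<lambda>x. g (ev R B b (unit_fun R x))) f"
        using R.hom_finsupp_module[OF _ g'[unfolded F_def]] BC f by (simp add: F_def)
      also have "\<dots> = ev R C (\<lambda>x. h (\<iota> (unit_fun R x))) f"
      proof -
        interpret C: Module.module R C using BC by simp
        have fX: "f x \<noteq> \<zero>\<^bsub>R\<^esub> \<Longrightarrow> x \<in> X" "f x \<in> carrier R" for x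
          using f by (auto simp: F_def finsupp_module_def)
        show ?thesis unfolding ev_def[of R C]
          by (rule C.M.finsum_cong') (simp_all add: fX hC B.ev_unit_fun[OF _ bX] b)
      qed
      also have "\<dots> = h (\<iota> f)"
        using R.hom_finsupp_module[OF _ h'[unfolded F_def]] BC f by (simp add: F_def)
      finally show ?thesis using f \<rho>\<iota> by simp
    qed
    ultimately show "\<exists>k\<in>module_hom R P B. \<forall>x\<in>carrier P. g (k x) = h x"
      by (intro bexI ballI)
  qed
  moreover
  have id: "(\<lambda>x. x) \<in> X \<rightarrow> carrier M" by (simp add: X_def)
  have e: "(\<lambda>u. ev R M (\<lambda>x. x) (\<rho> u)) \<in> module_hom R P M"
    by (rule module_hom_comp[OF tr(3)]) (use ev_hom[OF id] in \<open>simp add: F_def\<close>)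
  moreover have "(\<lambda>u. ev R M (\<lambda>x. x) (\<rho> u)) ` carrier P = carrier M"
  proof
    show "(\<lambda>u. ev R M (\<lambda>x. x) (\<rho> u)) ` carrier P \<subseteq> carrier M" using e by (auto simp: LinearCombinations.module_hom_def)
    show "carrier M \<subseteq> (\<lambda>u. ev R M (\<lambda>x. x) (\<rho> u)) ` carrier P"
    proof
      fix x assume x: "x \<in> carrier M"
      then have "x = ev R M (\<lambda>x. x) (\<rho> (\<iota> (unit_fun R x)))"
        using ev_unit_fun[OF _ id, of x] u \<rho>\<iota> by (simp add: X_def)
      then show "x \<in> (\<lambda>u. ev R M (\<lambda>x. x) (\<rho> u)) ` carrier P"
        using u x by (auto simp: carP X_def)
    qed
  qed
  ultimately show ?thesis by (intro exI conjI)
qed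

lemma projective_resolution_exists:
  fixes M :: "('a, 'm) module"
  assumes "module R M"
  shows "\<exists>(P :: nat \<Rightarrow> ('a, ('a, 'm) univ) module) d \<epsilon>. projective_resolution R M P d \<epsilon>"
proof -
  define ok where "ok = (\<lambda>(P :: ('a, ('a, 'm) univ) module, K). projective_module R P \<and> LinearCombinations.submodule R K P)"
  define step where "step = (\<lambda>(P :: ('a, ('a, 'm) univ) module, K :: ('a, 'm) univ set) (P' :: ('a, ('a, 'm) univ) module, K').
    \<exists>d \<in> module_hom R P' P. d ` carrier P' = K \<and> K' = mod_hom.ker P' P d)"
  have "inj (\<lambda>m. [Inr m] :: ('a, 'm) univ)" by (auto simp: inj_def)
  from projective_cover_exists[OF assms this]
  obtain P0 :: "('a, ('a, 'm) univ) module" and \<epsilon>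
    where P0: "projective_module R P0" "\<epsilon> \<in> module_hom R P0 M" "\<epsilon> ` carrier P0 = carrier M" by blast
  interpret \<epsilon>: mod_hom R P0 M \<epsilon>
    using P0 assms by (simp add: mod_hom_def mod_hom_axioms_def projective_module_def)
  have start: "ok (P0, mod_hom.ker P0 M \<epsilon>)" using P0 \<epsilon>.ker_is_submodule by (simp add: ok_def)
  have nxt: "\<exists>t. ok t \<and> step s t" if "ok s" for s
  proof -
    obtain P K where s: "s = (P, K)" by force
    have P: "module R P" and K: "LinearCombinations.submodule R K P"
      using that by (auto simp: ok_def s projective_module_def)
    have mK: "module R (P\<lparr>carrier := K\<rparr>)" by (rule module.submodule_is_module[OF P K])
    obtain P' :: "('a, ('a, 'm) univ) module" and e where P': "projective_module R P'"
      "e \<in> module_hom R P' (P\<lparr>carrier := K\<rparr>)" "e ` carrier P' = K"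
      using projective_cover_exists[OF mK, of "\<lambda>x. x"] by auto
    have "K \<subseteq> carrier P" using K by (simp add: LinearCombinations.submodule_def)
    then have e: "e \<in> module_hom R P' P" using P'(2) by (auto simp: LinearCombinations.module_hom_def Pi_iff)
    then interpret e: mod_hom R P' P e
      using P' P by (simp add: mod_hom_def mod_hom_axioms_def projective_module_def)
    have "ok (P', mod_hom.ker P' P e)" using P' e.ker_is_submodule by (simp add: ok_def)
    moreover have "step s (P', mod_hom.ker P' P e)" using e P' by (auto simp: step_def s)
    ultimately show ?thesis by blast
  qed
  obtain s where s: "s 0 = (P0, mod_hom.ker P0 M \<epsilon>)" "\<And>n. ok (s n)" "\<And>n. step (s n) (s (Suc n))"
    using dependent_nat_choice[of "\<lambda>n t. ok t \<and> (n = 0 \<longrightarrow> t = (P0, mod_hom.ker P0 M \<epsilon>))" "\<lambda>_. step"] start nxt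
    by (metis nat.distinct(1))
  define P where "P n = fst (s n)" for n
  have "\<exists>d. \<forall>n. d n \<in> module_hom R (P (Suc n)) (P n) \<and> d n ` carrier (P (Suc n)) = snd (s n)
      \<and> snd (s (Suc n)) = mod_hom.ker (P (Suc n)) (P n) (d n)"
    using s(3) by (intro choice) (fastforce simp: step_def P_def case_prod_beta)
  then obtain d where d: "\<And>n. d n \<in> module_hom R (P (Suc n)) (P n)"
    "\<And>n. d n ` carrier (P (Suc n)) = snd (s n)"
    "\<And>n. snd (s (Suc n)) = mod_hom.ker (P (Suc n)) (P n) (d n)" by blast
  have "projective_resolution R M P d \<epsilon>"
    using d s(1) s(2) P0 by (auto simp: projective_resolution_def P_def ok_def case_prod_beta)
  then show ?thesis by blast
qed

end

theory Submission
  imports Defs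
begin

text \<open>
  Over a self-injective ring, finitely generated projective modules are injective with respect to
  finitely generated modules. Hence, along \<open>0 \<rightarrow> K \<rightarrow> P \<rightarrow> L \<rightarrow> 0\<close> with \<open>P\<close> finitely generated
  projective, the vanishing of \<open>Ext\<^sup>1(K, K)\<close> and that of \<open>Ext\<^sup>1(L, L)\<close> can be traded for each other:
  a test homomorphism for one module is turned into a test homomorphism for the other by lifting
  through \<open>P \<rightarrow> L\<close> and by extending along \<open>K \<rightarrow> P\<close>. Both directions are needed, one for syzygies
  (\<open>ext1_zero_of_syzygy\<close>) and one for cosyzygies (\<open>ext1_zero_of_cosyzygy\<close>). So if \<open>M\<close> is rigid and
  \<open>M \<cong> \<Omega>\<^sup>n I\<close>, then the ideal \<open>I\<close> is rigid.

  A rigid ideal \<open>I\<close> is \<open>0\<close> or \<open>R\<close> (\<open>rigid_ideal_trivial\<close>). Indeed, by self-injectivity every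
  homomorphism \<open>I \<rightarrow> R\<close> is multiplication by an element of \<open>R\<close>, so its image lies in \<open>I\<close>. If
  \<open>Ext\<^sup>1(I, I) = 0\<close>, every homomorphism \<open>I \<rightarrow> R/I\<close> lifts to \<open>I \<rightarrow> R\<close> and is therefore zero. But if
  \<open>0 \<noteq> I \<noteq> R\<close>, there is a nonzero one, namely \<open>I \<rightarrow> R/m \<rightarrow> R/I\<close>, because \<open>I\<close> has a maximal proper
  submodule, \<open>R/I\<close> has a simple submodule, and \<open>R/m\<close> is the only simple module.

  Thus \<open>I\<close> is free, its proper syzygies and cosyzygies vanish, and \<open>M\<close> is zero or isomorphic to
  \<open>I\<close>. The Auslander-Reiten statement follows as well, because \<open>I\<close> is a direct summand of \<open>I \<oplus> R\<close>.

  In the cosyzygy case the middle term \<open>E\<close> is an injective hull, and one has to know that it is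
  finitely generated and projective. A finitely generated module \<open>L\<close> embeds into a free module \<open>G\<close>
  of finite rank (\<open>fg_embeds_in_free\<close>); by essentiality, extensions of this embedding to larger
  submodules of \<open>E\<close> stay injective, and the ascending chain condition in \<open>G\<close> yields an embedding of
  the whole of \<open>E\<close>, which splits (\<open>injective_hull_fg_projective\<close>).
\<close>

section \<open>Homomorphisms and short exact sequences\<close>

lemma hom_closed: "f \<in> module_hom R M N \<Longrightarrow> x \<in> carrier M \<Longrightarrow> f x \<in> carrier N"
  by (auto simp: LinearCombinations.module_hom_def)

lemma hom_mod_hom: "module R M \<Longrightarrow> module R N \<Longrightarrow> f \<in> module_hom R M N \<Longrightarrow> mod_hom R M N f"
  by (simp add: mod_hom_def mod_hom_axioms_def)

lemma hom_zero: "module R M \<Longrightarrow> module R N \<Longrightarrow> f \<in> module_hom R M N \<Longrightarrow> f \<zero>\<^bsub>M\<^esub> = \<zero>\<^bsub>N\<^esub>"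
  using mod_hom.f0_is_0 hom_mod_hom by metis

lemma hom_minus:
  "module R M \<Longrightarrow> module R N \<Longrightarrow> f \<in> module_hom R M N \<Longrightarrow> x \<in> carrier M \<Longrightarrow> y \<in> carrier M \<Longrightarrow>
   f (x \<ominus>\<^bsub>M\<^esub> y) = f x \<ominus>\<^bsub>N\<^esub> f y"
  using mod_hom.f_minus hom_mod_hom by metis

lemma hom_kernel:
  "module R M \<Longrightarrow> module R N \<Longrightarrow> f \<in> module_hom R M N \<Longrightarrow>
   mod_hom.ker M N f = {x \<in> carrier M. f x = \<zero>\<^bsub>N\<^esub>}"
  using mod_hom.ker_def hom_mod_hom by fastforce

lemma (in Module.module) minus_zero_iff:
  "x \<in> carrier M \<Longrightarrow> y \<in> carrier M \<Longrightarrow> x \<ominus>\<^bsub>M\<^esub> y = \<zero>\<^bsub>M\<^esub> \<longleftrightarrow> x = y"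
  by (metis M.add.inv_closed M.minus_equality M.minus_minus M.r_neg M.minus_eq)

lemma (in Module.module) sub_add_cancel:
  "x \<in> carrier M \<Longrightarrow> y \<in> carrier M \<Longrightarrow> (x \<ominus>\<^bsub>M\<^esub> y) \<oplus>\<^bsub>M\<^esub> y = x"
  by (simp add: M.minus_eq M.a_assoc M.l_neg)

lemma (in Module.module) smult_minus:
  "r \<in> carrier R \<Longrightarrow> x \<in> carrier M \<Longrightarrow> y \<in> carrier M \<Longrightarrow>
   r \<odot>\<^bsub>M\<^esub> (x \<ominus>\<^bsub>M\<^esub> y) = r \<odot>\<^bsub>M\<^esub> x \<ominus>\<^bsub>M\<^esub> r \<odot>\<^bsub>M\<^esub> y"
  by (simp add: M.minus_eq smult_r_distr smult_r_minus)

lemma hom_id: "(\<lambda>x. x) \<in> module_hom R M M"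
  by (simp add: LinearCombinations.module_hom_def)

lemma hom_const_zero: "module R N \<Longrightarrow> (\<lambda>x. \<zero>\<^bsub>N\<^esub>) \<in> module_hom R M N"
proof -
  assume "module R N"
  then interpret Module.module R N .
  show ?thesis by (simp add: LinearCombinations.module_hom_def)
qed

lemma hom_plus_hom:
  assumes "module R N" "f \<in> module_hom R M N" "g \<in> module_hom R M N"
  shows "(\<lambda>x. f x \<oplus>\<^bsub>N\<^esub> g x) \<in> module_hom R M N"
proof -
  interpret Module.module R N by fact
  show ?thesis using assms(2,3)
    by (auto simp: LinearCombinations.module_hom_def Pi_iff smult_r_distr M.a_ac)
qed

lemma hom_minus_hom:
  assumes "module R N" "f \<in> module_hom R M N" "g \<in> module_hom R M N"
  shows "(\<lambda>x. f x \<ominus>\<^bsub>N\<^esub> g x) \<in> module_hom R M N"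
proof -
  interpret Module.module R N by fact
  show ?thesis using assms(2,3)
    by (auto simp: LinearCombinations.module_hom_def Pi_iff smult_minus M.minus_eq M.minus_add M.a_ac
        smult_r_distr smult_r_minus)
qed

lemma hom_through_injective:
  assumes K: "module R K" and X: "module R X" and i: "i \<in> module_hom R K P" "inj_on i (carrier K)"
    and u: "u \<in> module_hom R X P" "\<And>x. x \<in> carrier X \<Longrightarrow> u x \<in> i ` carrier K"
  shows "\<exists>v\<in>module_hom R X K. \<forall>x\<in>carrier X. i (v x) = u x"
proof -
  interpret K: Module.module R K by fact
  interpret X: Module.module R X by fact
  define v where "v x = inv_into (carrier K) i (u x)" for x
  have v: "v x \<in> carrier K" "i (v x) = u x" if "x \<in> carrier X" for x
    using u(2)[OF that] unfolding v_def by (simp_all add: inv_into_into f_inv_into_f)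
  have "v (x \<oplus>\<^bsub>X\<^esub> y) = v x \<oplus>\<^bsub>K\<^esub> v y" if "x \<in> carrier X" "y \<in> carrier X" for x y
    by (rule inj_onD[OF i(2)]) (use that v in \<open>simp_all add: LinearCombinations.module_hom_add[OF i(1)] LinearCombinations.module_hom_add[OF u(1)]\<close>)
  moreover have "v (r \<odot>\<^bsub>X\<^esub> x) = r \<odot>\<^bsub>K\<^esub> v x" if "r \<in> carrier R" "x \<in> carrier X" for r x
    by (rule inj_onD[OF i(2)]) (use that v in \<open>simp_all add: LinearCombinations.module_hom_smult[OF i(1)] LinearCombinations.module_hom_smult[OF u(1)]\<close>)
  ultimately have "v \<in> module_hom R X K" using v by (simp add: LinearCombinations.module_hom_def)
  with v show ?thesis by blast
qed

lemma hom_through_surjective: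
  assumes P: "module R P" and M: "module R M" and Y: "module R Y"
    and p: "p \<in> module_hom R P M" "p ` carrier P = carrier M"
    and u: "u \<in> module_hom R P Y" "\<And>x. x \<in> carrier P \<Longrightarrow> p x = \<zero>\<^bsub>M\<^esub> \<Longrightarrow> u x = \<zero>\<^bsub>Y\<^esub>"
  shows "\<exists>v\<in>module_hom R M Y. \<forall>x\<in>carrier P. v (p x) = u x"
proof -
  interpret P: Module.module R P by fact
  interpret M: Module.module R M by fact
  interpret Y: Module.module R Y by fact
  define v where "v x = u (inv_into (carrier P) p x)" for x
  have eq: "u x = u y" if "x \<in> carrier P" "y \<in> carrier P" "p x = p y" for x y
  proof -
    have "p (x \<ominus>\<^bsub>P\<^esub> y) = \<zero>\<^bsub>M\<^esub>"
      using that hom_closed[OF p(1)] by (simp add: hom_minus[OF P M p(1)] M.minus_zero_iff)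
    then have "u (x \<ominus>\<^bsub>P\<^esub> y) = \<zero>\<^bsub>Y\<^esub>" using that by (intro u(2)) simp_all
    then show ?thesis
      using that hom_closed[OF u(1)] by (simp add: hom_minus[OF P Y u(1)] Y.minus_zero_iff)
  qed
  have v: "v (p x) = u x" if "x \<in> carrier P" for x
  proof -
    have "p x \<in> p ` carrier P" using that by blast
    then show ?thesis unfolding v_def by (intro eq that) (simp_all add: inv_into_into f_inv_into_f)
  qed
  have "v \<in> module_hom R M Y"
    unfolding LinearCombinations.module_hom_def
  proof (intro CollectI conjI allI impI Pi_I)
    fix y assume "y \<in> carrier M"
    then obtain x where "x \<in> carrier P" "y = p x" using p(2) by blast
    then show "v y \<in> carrier Y" using v hom_closed[OF u(1)] by simp
  next
    fix y z assume "y \<in> carrier M \<and> z \<in> carrier M"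
    then obtain a b where ab: "a \<in> carrier P" "y = p a" "b \<in> carrier P" "z = p b" using p(2) by blast
    then have "v (y \<oplus>\<^bsub>M\<^esub> z) = v (p (a \<oplus>\<^bsub>P\<^esub> b))" by (simp add: LinearCombinations.module_hom_add[OF p(1)])
    then show "v (y \<oplus>\<^bsub>M\<^esub> z) = v y \<oplus>\<^bsub>Y\<^esub> v z" using ab v by (simp add: LinearCombinations.module_hom_add[OF u(1)])
  next
    fix r y assume ry: "r \<in> carrier R \<and> y \<in> carrier M"
    then obtain a where a: "a \<in> carrier P" "y = p a" using p(2) by blast
    then have "v (r \<odot>\<^bsub>M\<^esub> y) = v (p (r \<odot>\<^bsub>P\<^esub> a))" using ry by (simp add: LinearCombinations.module_hom_smult[OF p(1)])
    then show "v (r \<odot>\<^bsub>M\<^esub> y) = r \<odot>\<^bsub>Y\<^esub> v y" using a ry v by (simp add: LinearCombinations.module_hom_smult[OF u(1)])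
  qed
  with v show ?thesis by blast
qed

text \<open>
  The maps are part of the data and the three modules may have different carrier types: syzygies,
  hulls and resolutions live on different types than the modules that they belong to.
\<close>
definition short_exact where
  "short_exact R K i P p M \<longleftrightarrow> module R K \<and> module R P \<and> module R M \<and>
     i \<in> module_hom R K P \<and> inj_on i (carrier K) \<and>
     p \<in> module_hom R P M \<and> p ` carrier P = carrier M \<and>
     i ` carrier K = {x \<in> carrier P. p x = \<zero>\<^bsub>M\<^esub>}"

text \<open>
  If \<open>i\<close> is the kernel of a projective presentation \<open>P \<rightarrow> M\<close>, this condition means \<open>Ext\<^sup>1(M, N) = 0\<close>;
  if \<open>i\<close> is any monomorphism, it means that \<open>N\<close> is injective with respect to \<open>i\<close>. The proof plays the
  two readings off against each other.
\<close>
definition extends_along where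
  "extends_along R K i P N \<longleftrightarrow>
     (\<forall>h \<in> module_hom R K N. \<exists>k \<in> module_hom R P N. \<forall>x \<in> carrier K. k (i x) = h x)"

lemma extends_alongD:
  "extends_along R K i P N \<Longrightarrow> h \<in> module_hom R K N \<Longrightarrow>
   \<exists>k \<in> module_hom R P N. \<forall>x \<in> carrier K. k (i x) = h x"
  by (simp add: extends_along_def)

lemma short_exactD:
  assumes "short_exact R K i P p M"
  shows "module R K" "module R P" "module R M" "i \<in> module_hom R K P" "inj_on i (carrier K)"
    "p \<in> module_hom R P M" "p ` carrier P = carrier M"
    "i ` carrier K = {x \<in> carrier P. p x = \<zero>\<^bsub>M\<^esub>}"
    "\<And>x. x \<in> carrier K \<Longrightarrow> p (i x) = \<zero>\<^bsub>M\<^esub>"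
  using assms by (auto simp: short_exact_def)

lemma short_exact_lift:
  assumes "short_exact R K i P p M" "module R X" "u \<in> module_hom R X P"
    "\<And>x. x \<in> carrier X \<Longrightarrow> p (u x) = \<zero>\<^bsub>M\<^esub>"
  shows "\<exists>v\<in>module_hom R X K. \<forall>x\<in>carrier X. i (v x) = u x"
  using assms short_exactD[OF assms(1)] hom_closed[OF assms(3)]
  by (intro hom_through_injective[where P = P]) auto

lemma short_exact_descend:
  assumes s: "short_exact R K i P p M" and "module R Y" "u \<in> module_hom R P Y"
    "\<And>x. x \<in> carrier K \<Longrightarrow> u (i x) = \<zero>\<^bsub>Y\<^esub>"
  shows "\<exists>v\<in>module_hom R M Y. \<forall>x\<in>carrier P. v (p x) = u x"
proof (rule hom_through_surjective[OF _ _ assms(2) _ _ assms(3)])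
  fix x assume "x \<in> carrier P" "p x = \<zero>\<^bsub>M\<^esub>"
  then have "x \<in> i ` carrier K" using short_exactD(8)[OF s] by blast
  then show "u x = \<zero>\<^bsub>Y\<^esub>" using assms(4) by blast
qed (use short_exactD[OF s] in auto)

lemma short_exact_kernel:
  assumes P: "module R P" and M: "module R M" and p: "p \<in> module_hom R P M" "p ` carrier P = carrier M"
  shows "short_exact R (P\<lparr>carrier := {x \<in> carrier P. p x = \<zero>\<^bsub>M\<^esub>}\<rparr>) (\<lambda>x. x) P p M"
proof -
  interpret mod_hom R P M p using hom_mod_hom[OF P M p(1)] .
  have "module R (P\<lparr>carrier := {x \<in> carrier P. p x = \<zero>\<^bsub>M\<^esub>}\<rparr>)"
    using module.submodule_is_module[OF P ker_is_submodule] by (simp add: ker_def)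
  then show ?thesis using assms by (auto simp: short_exact_def LinearCombinations.module_hom_def)
qed

section \<open>Free and projective modules\<close>

lemma (in cring) finsupp_hom_eqI:
  assumes "module R N" "f \<in> module_hom R (finsupp_module R X) N" "g \<in> module_hom R (finsupp_module R X) N"
    and eq: "\<And>x. x \<in> X \<Longrightarrow> f (unit_fun R x) = g (unit_fun R x)" and a: "a \<in> carrier (finsupp_module R X)"
  shows "f a = g a"
proof -
  interpret N: Module.module R N by fact
  have c: "a x \<in> carrier R" and s: "a x \<noteq> \<zero> \<Longrightarrow> x \<in> X" for x
    using a by (auto simp: finsupp_module_def)
  show ?thesis
    unfolding hom_finsupp_module[OF assms(1,2) a] hom_finsupp_module[OF assms(1,3) a] ev_def
    using c s hom_closed[OF assms(3) unit_fun_closed] by (intro N.M.finsum_cong') (auto simp: eq)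
qed

lemma (in cring) finsupp_lift:
  assumes B: "module R B" and C: "module R C" and g: "g \<in> module_hom R B C" "g ` carrier B = carrier C"
    and h: "h \<in> module_hom R (finsupp_module R X) C"
  shows "\<exists>k\<in>module_hom R (finsupp_module R X) B. \<forall>x\<in>carrier (finsupp_module R X). g (k x) = h x"
proof -
  interpret B: Module.module R B by fact
  have "\<exists>b. b \<in> carrier B \<and> g b = h (unit_fun R x)" if "x \<in> X" for x
    using g(2) hom_closed[OF h unit_fun_closed[OF that]] by (metis imageE)
  then obtain b where b: "\<And>x. x \<in> X \<Longrightarrow> b x \<in> carrier B \<and> g (b x) = h (unit_fun R x)" by metis
  then have bX: "b \<in> X \<rightarrow> carrier B" by auto
  have ev: "ev R B b \<in> module_hom R (finsupp_module R X) B" by (rule B.ev_hom[OF bX])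
  have "g (ev R B b x) = h x" if "x \<in> carrier (finsupp_module R X)" for x
    by (rule finsupp_hom_eqI[OF C module_hom_comp[OF ev g(1)] h _ that]) (simp add: B.ev_unit_fun[OF _ bX] b)
  with ev show ?thesis by blast
qed

lemma projectiveD_module: "projective_module R P \<Longrightarrow> module R P"
  by (simp add: projective_module_def)

text \<open>
  Free modules lift against epimorphisms between modules on arbitrary types, so the type on which
  projectivity is tested does not matter for their retracts.
\<close>
lemma (in cring) retract_of_finsupp_projective:
  assumes P: "module R P" and i: "i \<in> module_hom R P (finsupp_module R X)"
    and r: "r \<in> module_hom R (finsupp_module R X) P" and ri: "\<And>x. x \<in> carrier P \<Longrightarrow> r (i x) = x"
  shows "projective_module R P"
  unfolding projective_module_def
proof (intro conjI allI ballI impI P)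
  fix B C :: "('a, ('a, 'c) univ) module" and g h
  assume g: "g \<in> module_hom R B C" and h: "h \<in> module_hom R P C"
    and BC: "module R B \<and> module R C \<and> g ` carrier B = carrier C"
  obtain k where k: "k \<in> module_hom R (finsupp_module R X) B"
    "\<And>x. x \<in> carrier (finsupp_module R X) \<Longrightarrow> g (k x) = h (r x)"
    using finsupp_lift[OF _ _ g _ module_hom_comp[OF r h]] BC by blast
  then show "\<exists>k\<in>module_hom R P B. \<forall>x\<in>carrier P. g (k x) = h x"
    using hom_closed[OF i] ri by (intro bexI[OF _ module_hom_comp[OF i k(1)]]) auto
qed

lemma (in cring) finsupp_projective: "projective_module R (finsupp_module R X)"
  by (rule retract_of_finsupp_projective[OF finsupp_module hom_id hom_id]) simp

lemma (in Module.module) finsupp_cover: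
  shows "ev R M (\<lambda>x. x) \<in> module_hom R (finsupp_module R (carrier M)) M"
    and "ev R M (\<lambda>x. x) ` carrier (finsupp_module R (carrier M)) = carrier M"
proof -
  have id: "(\<lambda>x. x) \<in> carrier M \<rightarrow> carrier M" by simp
  show ev: "ev R M (\<lambda>x. x) \<in> module_hom R (finsupp_module R (carrier M)) M" by (rule ev_hom[OF id])
  show "ev R M (\<lambda>x. x) ` carrier (finsupp_module R (carrier M)) = carrier M"
  proof
    show "ev R M (\<lambda>x. x) ` carrier (finsupp_module R (carrier M)) \<subseteq> carrier M"
      using hom_closed[OF ev] by blast
    show "carrier M \<subseteq> ev R M (\<lambda>x. x) ` carrier (finsupp_module R (carrier M))"
      using ev_unit_fun[OF _ id] R.unit_fun_closed by (metis image_eqI subsetI)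
  qed
qed

text \<open>
  Conversely, a copy of the free module on the elements of \<open>P\<close> lives on the type on which
  projectivity of \<open>P\<close> is tested, so the canonical epimorphism from it onto \<open>P\<close> splits.
\<close>
lemma projective_summand_of_finsupp:
  fixes P :: "('a, 'p) module"
  assumes "projective_module R P"
  shows "\<exists>s\<in>module_hom R P (finsupp_module R (carrier P)).
    \<forall>x\<in>carrier P. ev R P (\<lambda>x. x) (s x) = x"
proof -
  interpret P: Module.module R P using assms by (rule projectiveD_module)
  define F where "F = finsupp_module R (carrier P)"
  interpret F: Module.module R F unfolding F_def by (rule P.R.finsupp_module)
  note e = P.finsupp_cover[folded F_def]
  define k :: "'p \<Rightarrow> ('a, 'p) univ" where "k m = [Inr m]" for m
  have k: "inj k" by (auto simp: k_def inj_def)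
  then have k': "inj_on k (carrier P)" by (rule inj_on_subset) simp
  obtain \<iota> :: "('p \<Rightarrow> 'a) \<Rightarrow> ('a, 'p) univ" where "inj_on \<iota> {f. finite {x. f x \<noteq> \<zero>\<^bsub>R\<^esub>}}"
    using finite_support_inj[OF k] by blast
  then have \<iota>: "inj_on \<iota> (carrier F)"
    by (rule inj_on_subset) (auto simp: F_def finsupp_module_def)
  define B where "B = transport R \<iota> F"
  define C where "C = transport R k P"
  define \<rho> where "\<rho> = inv_into (carrier F) \<iota>"
  note tB = F.transport[OF \<iota>, folded B_def \<rho>_def]
  note tC = P.transport[OF k', folded C_def]
  have carB: "carrier B = \<iota> ` carrier F" by (simp add: B_def transport_def Let_def)
  have carC: "carrier C = k ` carrier P" by (simp add: C_def transport_def Let_def)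
  have \<rho>\<iota>: "\<rho> (\<iota> f) = f" if "f \<in> carrier F" for f using that \<iota> by (simp add: \<rho>_def)
  have g: "(\<lambda>u. k (ev R P (\<lambda>x. x) (\<rho> u))) \<in> module_hom R B C"
    using module_hom_comp[OF module_hom_comp[OF tB(3) e(1)] tC(2)] .
  have "(\<lambda>u. k (ev R P (\<lambda>x. x) (\<rho> u))) ` carrier B = k ` (ev R P (\<lambda>x. x) ` carrier F)"
    by (simp add: carB image_image \<rho>\<iota>)
  then have surj: "(\<lambda>u. k (ev R P (\<lambda>x. x) (\<rho> u))) ` carrier B = carrier C" by (simp add: carC e(2))
  note lift = assms[unfolded projective_module_def, THEN conjunct2, rule_format, OF g tC(2)]
  obtain u where u: "u \<in> module_hom R P B" "\<And>x. x \<in> carrier P \<Longrightarrow> k (ev R P (\<lambda>x. x) (\<rho> (u x))) = k x"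
    using lift[OF conjI[OF tB(1) conjI[OF tC(1) surj]]] by blast
  then have "ev R P (\<lambda>x. x) (\<rho> (u x)) = x" if "x \<in> carrier P" for x
    using that injD[OF k] by blast
  then show ?thesis using module_hom_comp[OF u(1) tB(3)] unfolding F_def by (intro bexI[of _ "\<lambda>x. \<rho> (u x)"] ballI)
qed

lemma projective_lift:
  assumes P: "projective_module R P" and B: "module R B" and C: "module R C"
    and g: "g \<in> module_hom R B C" "g ` carrier B = carrier C" and h: "h \<in> module_hom R P C"
  shows "\<exists>k\<in>module_hom R P B. \<forall>x\<in>carrier P. g (k x) = h x"
proof -
  interpret P: Module.module R P using P by (rule projectiveD_module)
  obtain s where s: "s \<in> module_hom R P (finsupp_module R (carrier P))"
    "\<And>x. x \<in> carrier P \<Longrightarrow> ev R P (\<lambda>x. x) (s x) = x"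
    using projective_summand_of_finsupp[OF P] by blast
  obtain k where k: "k \<in> module_hom R (finsupp_module R (carrier P)) B"
    "\<And>x. x \<in> carrier (finsupp_module R (carrier P)) \<Longrightarrow> g (k x) = h (ev R P (\<lambda>x. x) x)"
    using P.R.finsupp_lift[OF B C g module_hom_comp[OF P.finsupp_cover(1) h]] by blast
  show ?thesis
    using k(2) hom_closed[OF s(1)] s(2) by (intro bexI[OF _ module_hom_comp[OF s(1) k(1)]]) auto
qed

section \<open>Vanishing of the first extension module\<close>

text \<open>
  Compare the two presentations by lifts \<open>\<phi> : P \<rightarrow> P'\<close> and \<open>\<psi> : P' \<rightarrow> P\<close> of the identity of \<open>M\<close>. If \<open>u\<close>
  extends \<open>h \<circ> \<phi>\<close> to \<open>P\<close>, then \<open>u \<circ> \<psi>\<close> extends \<open>h\<close> up to \<open>h \<circ> (id - \<phi> \<circ> \<psi>)\<close>, and this error term is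
  defined on all of \<open>P'\<close> because \<open>id - \<phi> \<circ> \<psi>\<close> maps \<open>P'\<close> into \<open>K'\<close>.
\<close>
lemma extends_along_independent:
  assumes s: "short_exact R K i P p M" and s': "short_exact R K' i' P' p' M"
    and P: "projective_module R P" and P': "projective_module R P'" and N: "module R N"
    and ext: "extends_along R K i P N"
  shows "extends_along R K' i' P' N"
  unfolding extends_along_def
proof
  fix h assume h: "h \<in> module_hom R K' N"
  note S = short_exactD[OF s] and S' = short_exactD[OF s']
  interpret N: Module.module R N by fact
  interpret M: Module.module R M by (rule S(3))
  interpret P': Module.module R P' by (rule S'(2))
  interpret P: Module.module R P by (rule S(2))
  interpret K: Module.module R K by (rule S(1))
  interpret K': Module.module R K' by (rule S'(1))
  obtain \<phi> where \<phi>: "\<phi> \<in> module_hom R P P'" "\<And>x. x \<in> carrier P \<Longrightarrow> p' (\<phi> x) = p x"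
    using projective_lift[OF P S'(2,3,6,7) S(6)] by blast
  obtain \<psi> where \<psi>: "\<psi> \<in> module_hom R P' P" "\<And>x. x \<in> carrier P' \<Longrightarrow> p (\<psi> x) = p' x"
    using projective_lift[OF P' S(2,3,6,7) S'(6)] by blast
  obtain \<phi>K where \<phi>K: "\<phi>K \<in> module_hom R K K'" "\<And>x. x \<in> carrier K \<Longrightarrow> i' (\<phi>K x) = \<phi> (i x)"
    using short_exact_lift[OF s' S(1) module_hom_comp[OF S(4) \<phi>(1)]] \<phi>(2) S(9) hom_closed[OF S(4)]
    by auto
  obtain \<psi>K where \<psi>K: "\<psi>K \<in> module_hom R K' K" "\<And>x. x \<in> carrier K' \<Longrightarrow> i (\<psi>K x) = \<psi> (i' x)"
    using short_exact_lift[OF s S'(1) module_hom_comp[OF S'(4) \<psi>(1)]] \<psi>(2) S'(9) hom_closed[OF S'(4)]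
    by auto
  note cl[simp] = hom_closed[OF \<phi>(1)] hom_closed[OF \<psi>(1)] hom_closed[OF \<phi>K(1)] hom_closed[OF \<psi>K(1)]
    hom_closed[OF S(4)] hom_closed[OF S'(4)] hom_closed[OF S(6)] hom_closed[OF S'(6)]
  have d: "(\<lambda>x. x \<ominus>\<^bsub>P'\<^esub> \<phi> (\<psi> x)) \<in> module_hom R P' P'"
    by (rule hom_minus_hom[OF S'(2) hom_id module_hom_comp[OF \<psi>(1) \<phi>(1)]])
  have "p' (x \<ominus>\<^bsub>P'\<^esub> \<phi> (\<psi> x)) = \<zero>\<^bsub>M\<^esub>" if "x \<in> carrier P'" for x
    using that by (simp add: hom_minus[OF S'(2,3,6)] \<phi>(2) \<psi>(2) M.minus_zero_iff)
  then obtain \<delta> where \<delta>: "\<delta> \<in> module_hom R P' K'" "\<And>x. x \<in> carrier P' \<Longrightarrow> i' (\<delta> x) = x \<ominus>\<^bsub>P'\<^esub> \<phi> (\<psi> x)"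
    using short_exact_lift[OF s' S'(2) d] by blast
  obtain u where u: "u \<in> module_hom R P N" "\<And>x. x \<in> carrier K \<Longrightarrow> u (i x) = h (\<phi>K x)"
    using extends_alongD[OF ext module_hom_comp[OF \<phi>K(1) h]] by blast
  have k: "(\<lambda>x. h (\<delta> x) \<oplus>\<^bsub>N\<^esub> u (\<psi> x)) \<in> module_hom R P' N"
    by (rule hom_plus_hom[OF N module_hom_comp[OF \<delta>(1) h] module_hom_comp[OF \<psi>(1) u(1)]])
  have "h (\<delta> (i' x)) \<oplus>\<^bsub>N\<^esub> u (\<psi> (i' x)) = h x" if x: "x \<in> carrier K'" for x
  proof -
    have "\<delta> (i' x) \<oplus>\<^bsub>K'\<^esub> \<phi>K (\<psi>K x) = x"
    proof (rule inj_onD[OF S'(5)])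
      show "i' (\<delta> (i' x) \<oplus>\<^bsub>K'\<^esub> \<phi>K (\<psi>K x)) = i' x"
        using x hom_closed[OF \<delta>(1)]
        by (simp add: LinearCombinations.module_hom_add[OF S'(4)] \<delta>(2) \<phi>K(2) \<psi>K(2) P'.sub_add_cancel)
    qed (use x hom_closed[OF \<delta>(1)] in auto)
    moreover have "u (\<psi> (i' x)) = h (\<phi>K (\<psi>K x))" using x u(2)[of "\<psi>K x"] by (simp add: \<psi>K(2))
    ultimately show ?thesis
      using x hom_closed[OF \<delta>(1)] LinearCombinations.module_hom_add[OF h, of "\<delta> (i' x)" "\<phi>K (\<psi>K x)"] by simp
  qed
  then show "\<exists>k\<in>module_hom R P' N. \<forall>x\<in>carrier K'. k (i' x) = h x" by (intro bexI[OF _ k] ballI)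
qed

text \<open>
  The presentation by the free module on all elements of \<open>M\<close> is a canonical choice; by
  \<open>ext1_zero_iff\<close> below any other projective presentation gives the same condition.
\<close>
definition ext1_zero where
  "ext1_zero R M N \<longleftrightarrow> extends_along R
     (finsupp_module R (carrier M)\<lparr>carrier :=
        {x \<in> carrier (finsupp_module R (carrier M)). ev R M (\<lambda>x. x) x = \<zero>\<^bsub>M\<^esub>}\<rparr>)
     (\<lambda>x. x) (finsupp_module R (carrier M)) N"

lemma ext1_zero_iff:
  assumes s: "short_exact R K i P p M" and P: "projective_module R P" and N: "module R N"
  shows "ext1_zero R M N \<longleftrightarrow> extends_along R K i P N"
proof -
  interpret M: Module.module R M using s by (rule short_exactD)
  note c = short_exact_kernel[OF M.R.finsupp_module M.module_axioms M.finsupp_cover]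
  show ?thesis
    unfolding ext1_zero_def
    using extends_along_independent[OF c s M.R.finsupp_projective P N]
      extends_along_independent[OF s c P M.R.finsupp_projective N] by blast
qed

text \<open>
  A homomorphism \<open>h\<close> on the kernel of \<open>\<epsilon>\<close> yields the cocycle \<open>h \<circ> d\<^sub>0\<close>. If it is a coboundary
  \<open>k \<circ> d\<^sub>0\<close>, then \<open>k\<close> extends \<open>h\<close>, because \<open>d\<^sub>0\<close> maps onto the kernel of \<open>\<epsilon>\<close>.
\<close>
lemma Ext_trivial_imp_ext1_zero:
  fixes R :: "('a, 'r) ring_scheme" and M :: "('a, 'm) module" and N :: "('a, 'n) module"
  assumes M: "module R M" and N: "module R N" and triv: "trivial_group (Ext R 1 M N)"
  shows "ext1_zero R M N"
proof -
  interpret N: Module.module R N by fact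
  interpret M: Module.module R M by fact
  define res where "res = (SOME (P :: nat \<Rightarrow> ('a, ('a, 'm) univ) module, d, \<epsilon>). projective_resolution R M P d \<epsilon>)"
  obtain P d \<epsilon> where res_eq: "res = (P, d, \<epsilon>)" by (cases res) auto
  have "case res of (P, d, \<epsilon>) \<Rightarrow> projective_resolution R M P d \<epsilon>"
    unfolding res_def by (rule someI_ex) (use projective_resolution_exists[OF M] in auto)
  then have pr: "projective_resolution R M P d \<epsilon>" by (simp add: res_eq)
  note pr' = pr[unfolded projective_resolution_def]
  have proj: "projective_module R (P j)" for j using pr' by simp
  have mod: "module R (P j)" for j by (rule projectiveD_module[OF proj])
  interpret P0: Module.module R "P 0" by (rule mod)
  have d: "d j \<in> module_hom R (P (Suc j)) (P j)" for j using pr' by simp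
  have \<epsilon>: "\<epsilon> \<in> module_hom R (P 0) M" "\<epsilon> ` carrier (P 0) = carrier M" using pr' by simp_all
  have d0: "d 0 ` carrier (P (Suc 0)) = {x \<in> carrier (P 0). \<epsilon> x = \<zero>\<^bsub>M\<^esub>}"
    using pr' hom_kernel[OF mod M \<epsilon>(1)] by simp
  have d1: "d 0 (d (Suc 0) x) = \<zero>\<^bsub>P 0\<^esub>" if "x \<in> carrier (P (Suc (Suc 0)))" for x
  proof -
    have "d (Suc 0) x \<in> mod_hom.ker (P (Suc 0)) (P 0) (d 0)" using that pr' imageI[OF that, of "d (Suc 0)"] by simp
    then show ?thesis using hom_kernel[OF mod mod d] by blast
  qed
  define H where "H = (Hom_group R (P (Suc 0)) N)\<lparr>carrier := cocycles R P d N (Suc 0)\<rparr>"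
  define B where "B = coboundaries R P d N (Suc 0)"
  have ext: "trivial_group (H Mod B)"
    using triv by (simp add: Ext_def res_def[symmetric] res_eq H_def B_def)
  have zero: "(\<lambda>x\<in>carrier (P (Suc 0)). \<zero>\<^bsub>N\<^esub>) \<in> B"
  proof -
    have "(\<lambda>x\<in>carrier (P 0). \<zero>\<^bsub>N\<^esub>) \<in> carrier (Hom_group R (P 0) N)"
      by (simp add: Hom_group_def LinearCombinations.module_hom_def)
    moreover have "(\<lambda>x\<in>carrier (P (Suc 0)). \<zero>\<^bsub>N\<^esub>) =
      compose (carrier (P (Suc 0))) (\<lambda>x\<in>carrier (P 0). \<zero>\<^bsub>N\<^esub>) (d 0)"
      using hom_closed[OF d[of 0]] by (auto simp: compose_def fun_eq_iff restrict_def)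
    ultimately show ?thesis unfolding B_def by (simp del: One_nat_def)
  qed
  have cob: "f \<in> B" if f: "f \<in> cocycles R P d N (Suc 0)" for f
  proof -
    have "B #>\<^bsub>H\<^esub> f \<in> carrier (H Mod B)"
      using f by (auto simp: FactGroup_def RCOSETS_def H_def)
    then have "B #>\<^bsub>H\<^esub> f = B" using ext by (simp add: trivial_group_def FactGroup_def)
    moreover have "(\<lambda>x\<in>carrier (P (Suc 0)). \<zero>\<^bsub>N\<^esub>) \<otimes>\<^bsub>H\<^esub> f \<in> B #>\<^bsub>H\<^esub> f"
      using zero by (auto simp: r_coset_def)
    moreover have "(\<lambda>x\<in>carrier (P (Suc 0)). \<zero>\<^bsub>N\<^esub>) \<otimes>\<^bsub>H\<^esub> f = f"
      using f by (auto simp: H_def Hom_group_def cocycles_def fun_eq_iff extensional_def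
          LinearCombinations.module_hom_def Pi_iff)
    ultimately show ?thesis by simp
  qed
  let ?K = "(P 0)\<lparr>carrier := {x \<in> carrier (P 0). \<epsilon> x = \<zero>\<^bsub>M\<^esub>}\<rparr>"
  have s: "short_exact R ?K (\<lambda>x. x) (P 0) \<epsilon> M" by (rule short_exact_kernel[OF mod M \<epsilon>])
  have "extends_along R ?K (\<lambda>x. x) (P 0) N"
    unfolding extends_along_def
  proof
    fix h assume h: "h \<in> module_hom R ?K N"
    have dK: "d 0 \<in> module_hom R (P (Suc 0)) ?K"
      using d[of 0] d0 by (auto simp: LinearCombinations.module_hom_def)
    define f where "f = (\<lambda>x\<in>carrier (P (Suc 0)). h (d 0 x))"
    interpret P1: Module.module R "P (Suc 0)" by (rule mod)
    have "f \<in> module_hom R (P (Suc 0)) N"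
      using module_hom_comp[OF dK h] by (auto simp: f_def LinearCombinations.module_hom_def Pi_iff)
    moreover have "f (d (Suc 0) x) = \<zero>\<^bsub>N\<^esub>" if "x \<in> carrier (P (Suc (Suc 0)))" for x
      using that hom_closed[OF d] d1[OF that] hom_zero[OF short_exactD(1)[OF s] N h]
      by (simp add: f_def)
    ultimately have "f \<in> B"
      by (intro cob) (simp add: cocycles_def Hom_group_def f_def)
    then obtain k where k: "k \<in> module_hom R (P 0) N" "f = compose (carrier (P (Suc 0))) k (d 0)"
      by (auto simp: B_def Hom_group_def)
    have "k x = h x" if "x \<in> carrier ?K" for x
    proof -
      have "x \<in> d 0 ` carrier (P (Suc 0))" using that d0 by simp
      then obtain y where y: "y \<in> carrier (P (Suc 0))" "x = d 0 y" by blast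
      have "f y = compose (carrier (P (Suc 0))) k (d 0) y" using k(2) by simp
      then show ?thesis using y by (simp add: f_def compose_def)
    qed
    with k(1) show "\<exists>k\<in>module_hom R (P 0) N. \<forall>x\<in>carrier ?K. k x = h x" by blast
  qed
  then show ?thesis using ext1_zero_iff[OF s proj N] by blast
qed

section \<open>Finitely generated modules\<close>

abbreviation submod where "submod \<equiv> LinearCombinations.submodule"

lemma submodI:
  assumes "module R M" "N \<subseteq> carrier M" "\<zero>\<^bsub>M\<^esub> \<in> N"
    "\<And>v w. v \<in> N \<Longrightarrow> w \<in> N \<Longrightarrow> v \<oplus>\<^bsub>M\<^esub> w \<in> N"
    "\<And>c v. c \<in> carrier R \<Longrightarrow> v \<in> N \<Longrightarrow> c \<odot>\<^bsub>M\<^esub> v \<in> N"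
  shows "submod R N M"
  using assms by (simp add: LinearCombinations.submodule_def)

lemma submodD:
  assumes "submod R N M"
  shows "module R M" "N \<subseteq> carrier M" "\<zero>\<^bsub>M\<^esub> \<in> N"
    "\<And>v w. v \<in> N \<Longrightarrow> w \<in> N \<Longrightarrow> v \<oplus>\<^bsub>M\<^esub> w \<in> N"
    "\<And>c v. c \<in> carrier R \<Longrightarrow> v \<in> N \<Longrightarrow> c \<odot>\<^bsub>M\<^esub> v \<in> N"
  using assms by (simp_all add: LinearCombinations.submodule_def)

lemma submod_module: "submod R N M \<Longrightarrow> module R (M\<lparr>carrier := N\<rparr>)"
  using module.submodule_is_module submodD(1) by blast

lemma submod_minus:
  assumes N: "submod R N M" and x: "x \<in> N" and y: "y \<in> N"
  shows "x \<ominus>\<^bsub>M\<^esub> y \<in> N"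
proof -
  interpret Module.module R M using N by (rule submodD)
  have yM: "y \<in> carrier M" using y submodD(2)[OF N] by blast
  have "\<ominus>\<^bsub>M\<^esub> y = (\<ominus>\<^bsub>R\<^esub> \<one>\<^bsub>R\<^esub>) \<odot>\<^bsub>M\<^esub> y" using yM by (simp add: smult_l_minus)
  then show ?thesis using submodD(4,5)[OF N] x y by (simp add: M.minus_eq)
qed

lemma (in Module.module) carrier_submod: "submod R (carrier M) M"
  by (rule submodI) (simp_all add: module_axioms)

lemma submod_Int: "submod R A M \<Longrightarrow> submod R B M \<Longrightarrow> submod R (A \<inter> B) M"
  by (auto simp: LinearCombinations.submodule_def)

lemma hom_image_submod:
  assumes "module R N" "f \<in> module_hom R M N" "submod R A M"
  shows "submod R (f ` A) N"
proof -
  note A = submodD[OF assms(3)]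
  show ?thesis
  proof (rule submodI[OF assms(1)])
    show "f ` A \<subseteq> carrier N" using A(2) hom_closed[OF assms(2)] by blast
    show "\<zero>\<^bsub>N\<^esub> \<in> f ` A" using hom_zero[OF A(1) assms(1,2)] A(3) by (metis image_eqI)
  next
    fix v w assume "v \<in> f ` A" "w \<in> f ` A"
    then obtain a b where ab: "a \<in> A" "b \<in> A" "v = f a" "w = f b" by blast
    then have "f (a \<oplus>\<^bsub>M\<^esub> b) = v \<oplus>\<^bsub>N\<^esub> w"
      using LinearCombinations.module_hom_add[OF assms(2)] A(2) by blast
    then show "v \<oplus>\<^bsub>N\<^esub> w \<in> f ` A" using A(4) ab by (metis image_eqI)
  next
    fix c v assume c: "c \<in> carrier R" "v \<in> f ` A"
    then obtain a where a: "a \<in> A" "v = f a" by blast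
    then have "f (c \<odot>\<^bsub>M\<^esub> a) = c \<odot>\<^bsub>N\<^esub> v"
      using LinearCombinations.module_hom_smult[OF assms(2)] A(2) c by blast
    then show "c \<odot>\<^bsub>N\<^esub> v \<in> f ` A" using A(5) a c by (metis image_eqI)
  qed
qed

lemma hom_vimage_submod:
  assumes "module R M" "f \<in> module_hom R M N" "submod R A N"
  shows "submod R {x \<in> carrier M. f x \<in> A} M"
proof -
  interpret Module.module R M by fact
  note A = submodD[OF assms(3)]
  show ?thesis
    by (rule submodI[OF assms(1)])
      (auto simp: A hom_zero[OF assms(1) A(1) assms(2)] LinearCombinations.module_hom_add[OF assms(2)]
        LinearCombinations.module_hom_smult[OF assms(2)])
qed

lemma hom_kernel_submod:
  assumes "module R M" "module R N" "f \<in> module_hom R M N"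
  shows "submod R {x \<in> carrier M. f x = \<zero>\<^bsub>N\<^esub>} M"
  using mod_hom.ker_is_submodule[OF hom_mod_hom[OF assms]] hom_kernel[OF assms] by simp

lemma (in Module.module) submod_finsum:
  assumes N: "submod R N M" and S: "finite S" "g \<in> S \<rightarrow> N"
  shows "(\<Oplus>\<^bsub>M\<^esub>x\<in>S. g x) \<in> N"
  using S
proof (induction S)
  case empty
  then show ?case using submodD(3)[OF N] by simp
next
  case (insert x S)
  have "g y \<in> carrier M" if "y \<in> insert x S" for y using insert.prems that submodD(2)[OF N] by blast
  then have "(\<Oplus>\<^bsub>M\<^esub>y\<in>insert x S. g y) = g x \<oplus>\<^bsub>M\<^esub> (\<Oplus>\<^bsub>M\<^esub>y\<in>S. g y)"
    using insert.hyps by (intro M.finsum_insert) auto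
  then show ?case using insert by (simp add: submodD(4)[OF N])
qed

lemma (in Module.module) ev_image_span:
  assumes "B \<subseteq> carrier M"
  shows "ev R M (\<lambda>x. x) ` carrier (finsupp_module R B) = span B"
proof
  have id: "(\<lambda>x. x) \<in> B \<rightarrow> carrier M" using assms by auto
  note e = ev_hom[OF id]
  show "ev R M (\<lambda>x. x) ` carrier (finsupp_module R B) \<subseteq> span B"
  proof
    fix y assume "y \<in> ev R M (\<lambda>x. x) ` carrier (finsupp_module R B)"
    then obtain f where f: "f \<in> carrier (finsupp_module R B)" "y = ev R M (\<lambda>x. x) f" by blast
    then have "y = lincomb f {x. f x \<noteq> \<zero>}" by (simp add: ev_def lincomb_def)
    moreover have "finite {x. f x \<noteq> \<zero>}" "{x. f x \<noteq> \<zero>} \<subseteq> B" "f \<in> {x. f x \<noteq> \<zero>} \<rightarrow> carrier R"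
      using f(1) by (auto simp: finsupp_module_def)
    ultimately show "y \<in> span B" unfolding span_def by blast
  qed
  have "B \<subseteq> ev R M (\<lambda>x. x) ` carrier (finsupp_module R B)"
    using ev_unit_fun[OF _ id] R.unit_fun_closed by (metis image_eqI subsetI)
  moreover have "submod R (ev R M (\<lambda>x. x) ` carrier (finsupp_module R B)) M"
    using hom_image_submod[OF module_axioms e module.carrier_submod[OF R.finsupp_module]] .
  ultimately show "span B \<subseteq> ev R M (\<lambda>x. x) ` carrier (finsupp_module R B)" by (rule span_is_subset)
qed

definition fg_module where
  "fg_module R M \<longleftrightarrow> module R M \<and> (\<exists>B \<subseteq> carrier M. finite B \<and> module.gen_set R M B)"

lemma fg_moduleD: "fg_module R M \<Longrightarrow> module R M"
  by (simp add: fg_module_def)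

lemma (in Module.module) fg_moduleI:
  assumes B: "finite B" "B \<subseteq> carrier M"
    and gen: "\<And>N. submod R N M \<Longrightarrow> B \<subseteq> N \<Longrightarrow> carrier M \<subseteq> N"
  shows "fg_module R M"
proof -
  have "carrier M \<subseteq> span B" by (rule gen[OF span_is_submodule[OF B(2)] in_own_span[OF B(2)]])
  then have "span B = carrier M" using span_is_subset2[OF B(2)] by blast
  then show ?thesis using B module_axioms by (auto simp: fg_module_def)
qed

lemma fg_module_generators:
  assumes "fg_module R M"
  shows "\<exists>B\<subseteq>carrier M. finite B \<and> (\<forall>N. submod R N M \<longrightarrow> B \<subseteq> N \<longrightarrow> N = carrier M)"
proof -
  interpret Module.module R M using assms by (rule fg_moduleD)
  obtain B where B: "B \<subseteq> carrier M" "finite B" "span B = carrier M"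
    using assms by (auto simp: fg_module_def)
  have "N = carrier M" if "submod R N M" "B \<subseteq> N" for N
    using span_is_subset[OF that(2,1)] B(3) submodD(2)[OF that(1)] by auto
  with B show ?thesis by blast
qed

lemma fg_module_image:
  assumes "fg_module R P" "module R M" "p \<in> module_hom R P M" "p ` carrier P = carrier M"
  shows "fg_module R M"
proof -
  interpret Module.module R M by fact
  obtain B where B: "B \<subseteq> carrier P" "finite B"
    "\<And>N. submod R N P \<Longrightarrow> B \<subseteq> N \<Longrightarrow> N = carrier P"
    using fg_module_generators[OF assms(1)] by blast
  show ?thesis
  proof (rule fg_moduleI)
    fix N assume N: "submod R N M" "p ` B \<subseteq> N"
    have "{x \<in> carrier P. p x \<in> N} = carrier P"
      by (rule B(3)[OF hom_vimage_submod[OF fg_moduleD[OF assms(1)] assms(3) N(1)]]) (use B N in auto)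
    then have "p ` carrier P \<subseteq> N" by blast
    then show "carrier M \<subseteq> N" by (simp add: assms(4))
  qed (use B assms(4) in auto)
qed

lemma (in cring) finsupp_generated:
  assumes N: "submod R N (finsupp_module R X)" "unit_fun R ` X \<subseteq> N"
  shows "N = carrier (finsupp_module R X)"
proof
  interpret F: Module.module R "finsupp_module R X" by (rule finsupp_module)
  show "N \<subseteq> carrier (finsupp_module R X)" by (rule submodD(2)[OF N(1)])
  show "carrier (finsupp_module R X) \<subseteq> N"
  proof
    fix f assume f: "f \<in> carrier (finsupp_module R X)"
    have fin: "finite {x. f x \<noteq> \<zero>}" and "f x \<in> carrier R" "f x \<noteq> \<zero> \<Longrightarrow> x \<in> X" for x
      using f by (auto simp: finsupp_module_def)
    then have "ev R (finsupp_module R X) (unit_fun R) f \<in> N"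
      unfolding ev_def using N by (intro F.submod_finsum[OF N(1) fin]) (auto intro!: submodD(5)[OF N(1)])
    then show "f \<in> N" by (simp only: finsupp_module_expand[OF f])
  qed
qed

lemma (in cring) fg_finsupp_module:
  assumes "finite X"
  shows "fg_module R (finsupp_module R X)"
proof -
  interpret F: Module.module R "finsupp_module R X" by (rule finsupp_module)
  show ?thesis
  proof (rule F.fg_moduleI)
    show "finite (unit_fun R ` X)" "unit_fun R ` X \<subseteq> carrier (finsupp_module R X)"
      using assms unit_fun_closed by auto
    fix N assume "submod R N (finsupp_module R X)" "unit_fun R ` X \<subseteq> N"
    then show "carrier (finsupp_module R X) \<subseteq> N" using finsupp_generated by blast
  qed
qed

lemma fg_module_cover:
  assumes "fg_module R M"
  shows "\<exists>B\<subseteq>carrier M. finite B \<and> ev R M (\<lambda>x. x) \<in> module_hom R (finsupp_module R B) M \<and>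
    ev R M (\<lambda>x. x) ` carrier (finsupp_module R B) = carrier M"
proof -
  interpret Module.module R M using assms by (rule fg_moduleD)
  obtain B where B: "B \<subseteq> carrier M" "finite B" "span B = carrier M"
    using assms by (auto simp: fg_module_def)
  have "(\<lambda>x. x) \<in> B \<rightarrow> carrier M" using B by auto
  from ev_hom[OF this] show ?thesis using B ev_image_span[OF B(1)] by auto
qed

lemma fg_module_presentation:
  fixes M :: "('a, 'm) module"
  assumes "fg_module R M"
  obtains K P :: "('a, 'm \<Rightarrow> 'a) module" and i p
  where "short_exact R K i P p M" "projective_module R P" "fg_module R P"
proof -
  interpret Module.module R M using assms by (rule fg_moduleD)
  obtain B where B: "finite B" "ev R M (\<lambda>x. x) \<in> module_hom R (finsupp_module R B) M"
    "ev R M (\<lambda>x. x) ` carrier (finsupp_module R B) = carrier M"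
    using fg_module_cover[OF assms] by blast
  show ?thesis
    by (rule that[OF short_exact_kernel[OF R.finsupp_module module_axioms B(2,3)] R.finsupp_projective
      R.fg_finsupp_module[OF B(1)]])
qed

text \<open>
  An element is recorded by the list of its coefficients with respect to a finite generating set.
  Hence a finitely generated module on any type has a copy on the types over which projectivity and
  injectivity are tested.
\<close>
lemma fg_module_inj_univ:
  fixes M :: "('a, 'm, 's) module_scheme"
  assumes "fg_module R M"
  shows "\<exists>\<iota> :: 'm \<Rightarrow> ('a, 'b) univ. inj_on \<iota> (carrier M)"
proof -
  obtain B where B: "finite B" "ev R M (\<lambda>x. x) ` carrier (finsupp_module R B) = carrier M"
    using fg_module_cover[OF assms] by blast
  obtain bs where bs: "set bs = B" using finite_list[OF B(1)] by blast
  define c where "c = inv_into (carrier (finsupp_module R B)) (ev R M (\<lambda>x. x))"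
  have c: "c x \<in> carrier (finsupp_module R B)" "ev R M (\<lambda>x. x) (c x) = x" if "x \<in> carrier M" for x
    using that B(2) unfolding c_def by (auto simp: inv_into_into f_inv_into_f)
  have "inj_on (\<lambda>x. map (\<lambda>b. Inl (c x b) :: 'a + 'b) bs) (carrier M)"
  proof (rule inj_onI)
    fix x y assume xy: "x \<in> carrier M" "y \<in> carrier M"
      and "map (\<lambda>b. Inl (c x b) :: 'a + 'b) bs = map (\<lambda>b. Inl (c y b)) bs"
    then have "c x b = c y b" if "b \<in> B" for b using that bs by auto
    moreover have "c x b = c y b" if "b \<notin> B" for b
    proof -
      have "c x b = \<zero>\<^bsub>R\<^esub>" "c y b = \<zero>\<^bsub>R\<^esub>"
        using c(1)[OF xy(1)] c(1)[OF xy(2)] that unfolding finsupp_module_def by auto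
      then show ?thesis by simp
    qed
    ultimately have "c x = c y" by blast
    then show "x = y" using c(2) xy by metis
  qed
  then show ?thesis by blast
qed

text \<open>
  Transporting \<open>A\<close> and \<open>Q\<close> to the type on which injectivity of \<open>X\<close> is tested frees the definition
  from its type restriction, for finitely generated \<open>Q\<close>. This takes the place of Baer's criterion.
\<close>
lemma injective_extends_along:
  fixes X :: "('a, 'x) module" and A :: "('a, 'k, 's) module_scheme" and Q :: "('a, 'q, 't) module_scheme"
  assumes X: "injective_module R X" and Q: "fg_module R Q" and A: "module R A"
    and g: "g \<in> module_hom R A Q" "inj_on g (carrier A)"
  shows "extends_along R A g Q X"
  unfolding extends_along_def
proof
  fix h assume h: "h \<in> module_hom R A X"
  interpret Q: Module.module R Q using Q by (rule fg_moduleD)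
  interpret A: Module.module R A by fact
  obtain \<iota> :: "'q \<Rightarrow> ('a, 'x) univ" where \<iota>: "inj_on \<iota> (carrier Q)"
    using fg_module_inj_univ[OF Q] by blast
  have \<kappa>: "inj_on (\<lambda>a. \<iota> (g a)) (carrier A)"
    using inj_onD[OF \<iota>] inj_onD[OF g(2)] hom_closed[OF g(1)] by (auto intro!: inj_onI)
  define B where "B = transport R \<iota> Q"
  define A' where "A' = transport R (\<lambda>a. \<iota> (g a)) A"
  define \<rho> where "\<rho> = inv_into (carrier A) (\<lambda>a. \<iota> (g a))"
  note tB = Q.transport[OF \<iota>, folded B_def]
  note tA = A.transport[OF \<kappa>, folded A'_def \<rho>_def]
  have carA': "carrier A' = (\<lambda>a. \<iota> (g a)) ` carrier A" by (simp add: A'_def transport_def Let_def)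
  have \<rho>: "\<rho> (\<iota> (g a)) = a" if "a \<in> carrier A" for a
    using inv_into_f_f[OF \<kappa> that] by (simp add: \<rho>_def)
  have incl: "(\<lambda>u. \<iota> (g (\<rho> u))) \<in> module_hom R A' B"
    by (rule module_hom_comp[OF module_hom_comp[OF tA(3) g(1)] tB(2)])
  have inj: "inj_on (\<lambda>u. \<iota> (g (\<rho> u))) (carrier A')"
    by (rule inj_onI) (auto simp: carA' \<rho>)
  note ext = X[unfolded injective_module_def, THEN conjunct2, rule_format, OF incl module_hom_comp[OF tA(3) h]]
  obtain k where k: "k \<in> module_hom R B X" "\<And>u. u \<in> carrier A' \<Longrightarrow> k (\<iota> (g (\<rho> u))) = h (\<rho> u)"
    using ext[OF conjI[OF tA(1) conjI[OF tB(1) inj]]] by blast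
  have "k (\<iota> (g a)) = h a" if "a \<in> carrier A" for a
    using k(2)[of "\<iota> (g a)"] that by (simp add: carA' \<rho>)
  then show "\<exists>k\<in>module_hom R Q X. \<forall>x\<in>carrier A. k (g x) = h x"
    by (intro bexI[OF _ module_hom_comp[OF tB(2) k(1)]] ballI)
qed

section \<open>Submodules of finitely generated modules over a Noetherian ring\<close>

text \<open>
  For \<open>U\<close> the span of the remaining generators, this is the ideal of leading coefficients, with
  respect to the generator \<open>b\<close>, of the elements of \<open>V\<close>.
\<close>
lemma (in Module.module) colon_ideal:
  assumes U: "submod R U M" and V: "submod R V M" and b: "b \<in> carrier M"
  shows "ideal {r \<in> carrier R. \<exists>m\<in>U. r \<odot>\<^bsub>M\<^esub> b \<oplus>\<^bsub>M\<^esub> m \<in> V} R" (is "ideal ?I R")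
proof (rule idealI)
  have UM: "u \<in> U \<Longrightarrow> u \<in> carrier M" for u using submodD(2)[OF U] by blast
  show "ring R" ..
  have mult: "x \<otimes> a \<in> ?I" if "a \<in> ?I" "x \<in> carrier R" for a x
  proof -
    obtain m where m: "m \<in> U" "a \<odot>\<^bsub>M\<^esub> b \<oplus>\<^bsub>M\<^esub> m \<in> V" "a \<in> carrier R" using \<open>a \<in> ?I\<close> by blast
    have "(x \<otimes> a) \<odot>\<^bsub>M\<^esub> b \<oplus>\<^bsub>M\<^esub> x \<odot>\<^bsub>M\<^esub> m = x \<odot>\<^bsub>M\<^esub> (a \<odot>\<^bsub>M\<^esub> b \<oplus>\<^bsub>M\<^esub> m)"
      using m b that UM by (simp add: smult_assoc1 smult_r_distr)
    then have "(x \<otimes> a) \<odot>\<^bsub>M\<^esub> b \<oplus>\<^bsub>M\<^esub> x \<odot>\<^bsub>M\<^esub> m \<in> V" using m that submodD(5)[OF V] by simp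
    then show ?thesis using m that submodD(5)[OF U] by blast
  qed
  then show "x \<otimes> a \<in> ?I" if "a \<in> ?I" "x \<in> carrier R" for a x using that by blast
  show "a \<otimes> x \<in> ?I" if "a \<in> ?I" "x \<in> carrier R" for a x
    using mult[OF that] R.m_comm[of x a] that by simp
  show "subgroup ?I (add_monoid R)"
  proof (rule R.add.subgroupI)
    show "?I \<subseteq> carrier R" by blast
    have "\<zero> \<odot>\<^bsub>M\<^esub> b \<oplus>\<^bsub>M\<^esub> \<zero>\<^bsub>M\<^esub> \<in> V" using b submodD(3)[OF V] by simp
    then show "?I \<noteq> {}" using submodD(3)[OF U] by blast
  next
    fix a assume "a \<in> ?I"
    then have "(\<ominus> \<one>) \<otimes> a \<in> ?I" using mult by simp
    moreover have "(\<ominus> \<one>) \<otimes> a = \<ominus> a" using \<open>a \<in> ?I\<close> by (simp add: R.l_minus)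
    ultimately show "\<ominus> a \<in> ?I" by simp
  next
    fix a c assume "a \<in> ?I" "c \<in> ?I"
    then obtain m n where mn: "a \<in> carrier R" "m \<in> U" "a \<odot>\<^bsub>M\<^esub> b \<oplus>\<^bsub>M\<^esub> m \<in> V"
      "c \<in> carrier R" "n \<in> U" "c \<odot>\<^bsub>M\<^esub> b \<oplus>\<^bsub>M\<^esub> n \<in> V" by blast
    have "(a \<oplus> c) \<odot>\<^bsub>M\<^esub> b \<oplus>\<^bsub>M\<^esub> (m \<oplus>\<^bsub>M\<^esub> n) = (a \<odot>\<^bsub>M\<^esub> b \<oplus>\<^bsub>M\<^esub> m) \<oplus>\<^bsub>M\<^esub> (c \<odot>\<^bsub>M\<^esub> b \<oplus>\<^bsub>M\<^esub> n)"
      using mn b UM by (simp add: smult_l_distr M.a_ac)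
    then have "(a \<oplus> c) \<odot>\<^bsub>M\<^esub> b \<oplus>\<^bsub>M\<^esub> (m \<oplus>\<^bsub>M\<^esub> n) \<in> V" using mn submodD(4)[OF V] by simp
    then show "a \<oplus> c \<in> ?I" using mn submodD(4)[OF U] by blast
  qed
qed

lemma (in Module.module) span_insert_decompose:
  assumes B: "insert b B \<subseteq> carrier M" and x: "x \<in> span (insert b B)"
  shows "\<exists>r\<in>carrier R. \<exists>m\<in>span B. x = r \<odot>\<^bsub>M\<^esub> b \<oplus>\<^bsub>M\<^esub> m"
proof -
  have bM: "b \<in> carrier M" and BM: "B \<subseteq> carrier M" using B by auto
  note sp = span_is_submodule[OF BM]
  have sM: "m \<in> span B \<Longrightarrow> m \<in> carrier M" for m using submodD(2)[OF sp] by blast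
  let ?N = "{r \<odot>\<^bsub>M\<^esub> b \<oplus>\<^bsub>M\<^esub> m |r m. r \<in> carrier R \<and> m \<in> span B}"
  have "submod R ?N M"
  proof (rule submodI[OF module_axioms])
    show "?N \<subseteq> carrier M" using bM sM by auto
    show "\<zero>\<^bsub>M\<^esub> \<in> ?N"
      using submodD(3)[OF sp] bM by (intro CollectI exI[of _ \<zero>] exI[of _ "\<zero>\<^bsub>M\<^esub>"]) simp
  next
    fix v w assume "v \<in> ?N" "w \<in> ?N"
    then obtain r m s n where *: "r \<in> carrier R" "m \<in> span B" "v = r \<odot>\<^bsub>M\<^esub> b \<oplus>\<^bsub>M\<^esub> m"
      "s \<in> carrier R" "n \<in> span B" "w = s \<odot>\<^bsub>M\<^esub> b \<oplus>\<^bsub>M\<^esub> n" by blast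
    then have "v \<oplus>\<^bsub>M\<^esub> w = (r \<oplus> s) \<odot>\<^bsub>M\<^esub> b \<oplus>\<^bsub>M\<^esub> (m \<oplus>\<^bsub>M\<^esub> n)"
      using bM sM by (simp add: smult_l_distr M.a_ac)
    then show "v \<oplus>\<^bsub>M\<^esub> w \<in> ?N" using * submodD(4)[OF sp] by blast
  next
    fix c v assume c: "c \<in> carrier R" "v \<in> ?N"
    then obtain r m where *: "r \<in> carrier R" "m \<in> span B" "v = r \<odot>\<^bsub>M\<^esub> b \<oplus>\<^bsub>M\<^esub> m" by blast
    then have "c \<odot>\<^bsub>M\<^esub> v = (c \<otimes> r) \<odot>\<^bsub>M\<^esub> b \<oplus>\<^bsub>M\<^esub> c \<odot>\<^bsub>M\<^esub> m"
      using bM sM c by (simp add: smult_assoc1 smult_r_distr)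
    then show "c \<odot>\<^bsub>M\<^esub> v \<in> ?N" using * c submodD(5)[OF sp] by blast
  qed
  moreover have "insert b B \<subseteq> ?N"
  proof
    fix y assume "y \<in> insert b B"
    moreover have "b = \<one> \<odot>\<^bsub>M\<^esub> b \<oplus>\<^bsub>M\<^esub> \<zero>\<^bsub>M\<^esub>" using bM by simp
    moreover have "y = \<zero> \<odot>\<^bsub>M\<^esub> b \<oplus>\<^bsub>M\<^esub> y" if "y \<in> B" using bM BM that by auto
    moreover have "\<zero>\<^bsub>M\<^esub> \<in> span B" "B \<subseteq> span B" using submodD(3)[OF sp] in_own_span[OF BM] by auto
    ultimately show "y \<in> ?N" by blast
  qed
  ultimately have "span (insert b B) \<subseteq> ?N" using span_is_subset by blast
  with x show ?thesis by blast
qed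

text \<open>
  Induction on the number of generators: elements of \<open>A\<close> that realise generators of the ideal of
  leading coefficients at \<open>b\<close>, together with generators of \<open>A \<inter> span B\<close>, generate \<open>A\<close>.
\<close>
lemma (in Module.module) submod_of_span_fg:
  assumes noeth: "noetherian_ring R" and "finite B" "B \<subseteq> carrier M" "submod R A M" "A \<subseteq> span B"
  shows "\<exists>D\<subseteq>A. finite D \<and> A \<subseteq> span D"
  using assms(2-)
proof (induction B arbitrary: A)
  case empty
  have "submod R {\<zero>\<^bsub>M\<^esub>} M" by (rule submodI[OF module_axioms]) auto
  then have "span {} \<subseteq> {\<zero>\<^bsub>M\<^esub>}" by (intro span_is_subset) auto
  then have "A \<subseteq> {\<zero>\<^bsub>M\<^esub>}" using empty.prems by blast
  then have "A \<subseteq> span {}" using submodD(3)[OF span_is_submodule[of "{}"]] by auto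
  then show ?case by blast
next
  case (insert b B)
  have bM: "b \<in> carrier M" and BM: "B \<subseteq> carrier M" using insert.prems by auto
  note A = submodD[OF insert.prems(2)]
  note sp = span_is_submodule[OF BM]
  have sM: "m \<in> span B \<Longrightarrow> m \<in> carrier M" for m using submodD(2)[OF sp] by blast
  define \<aa> where "\<aa> = {r \<in> carrier R. \<exists>m\<in>span B. r \<odot>\<^bsub>M\<^esub> b \<oplus>\<^bsub>M\<^esub> m \<in> A}"
  have "ideal \<aa> R" unfolding \<aa>_def by (rule colon_ideal[OF sp insert.prems(2) bM])
  then obtain S where S: "S \<subseteq> carrier R" "finite S" "\<aa> = Idl S"
    using noetherian_ring.finetely_gen[OF noeth] by blast
  have "S \<subseteq> \<aa>" using R.genideal_self[OF S(1)] S(3) by blast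
  then have "\<forall>s\<in>S. \<exists>m\<in>span B. s \<odot>\<^bsub>M\<^esub> b \<oplus>\<^bsub>M\<^esub> m \<in> A" by (auto simp: \<aa>_def)
  then obtain \<mu> where \<mu>: "\<And>s. s \<in> S \<Longrightarrow> \<mu> s \<in> span B \<and> s \<odot>\<^bsub>M\<^esub> b \<oplus>\<^bsub>M\<^esub> \<mu> s \<in> A" by metis
  have "submod R (A \<inter> span B) M" by (rule submod_Int[OF insert.prems(2) sp])
  then obtain D' where D': "D' \<subseteq> A \<inter> span B" "finite D'" "A \<inter> span B \<subseteq> span D'"
    using insert.IH[OF BM] by blast
  define D where "D = (\<lambda>s. s \<odot>\<^bsub>M\<^esub> b \<oplus>\<^bsub>M\<^esub> \<mu> s) ` S \<union> D'"
  have DA: "D \<subseteq> A" using \<mu> D' by (auto simp: D_def)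
  then have DM: "D \<subseteq> carrier M" using A(2) by blast
  note spD = span_is_submodule[OF DM]
  have DspD: "D \<subseteq> span D" by (rule in_own_span[OF DM])
  have spDA: "span D \<subseteq> A" by (rule span_is_subset[OF DA insert.prems(2)])
  have "\<aa> \<subseteq> {r \<in> carrier R. \<exists>m\<in>span B. r \<odot>\<^bsub>M\<^esub> b \<oplus>\<^bsub>M\<^esub> m \<in> span D}"
    unfolding S(3)
  proof (rule R.genideal_minimal[OF colon_ideal[OF sp spD bM]])
    show "S \<subseteq> {r \<in> carrier R. \<exists>m\<in>span B. r \<odot>\<^bsub>M\<^esub> b \<oplus>\<^bsub>M\<^esub> m \<in> span D}"
    proof
      fix s assume s: "s \<in> S"
      then have "s \<odot>\<^bsub>M\<^esub> b \<oplus>\<^bsub>M\<^esub> \<mu> s \<in> span D" using DspD by (auto simp: D_def)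
      then show "s \<in> {r \<in> carrier R. \<exists>m\<in>span B. r \<odot>\<^bsub>M\<^esub> b \<oplus>\<^bsub>M\<^esub> m \<in> span D}" using s S(1) \<mu> by blast
    qed
  qed
  note \<aa> = this
  have "A \<subseteq> span D"
  proof
    fix a assume a: "a \<in> A"
    then obtain r m where rm: "r \<in> carrier R" "m \<in> span B" "a = r \<odot>\<^bsub>M\<^esub> b \<oplus>\<^bsub>M\<^esub> m"
      using span_insert_decompose[OF insert.prems(1)] insert.prems(3) by blast
    then have "r \<in> \<aa>" using a by (auto simp: \<aa>_def)
    then obtain n where n: "n \<in> span B" "r \<odot>\<^bsub>M\<^esub> b \<oplus>\<^bsub>M\<^esub> n \<in> span D" using \<aa> by blast
    have "a \<ominus>\<^bsub>M\<^esub> (r \<odot>\<^bsub>M\<^esub> b \<oplus>\<^bsub>M\<^esub> n) = m \<ominus>\<^bsub>M\<^esub> n"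
    proof -
      have "m = (m \<ominus>\<^bsub>M\<^esub> n) \<oplus>\<^bsub>M\<^esub> n" using rm n sM by (simp add: sub_add_cancel)
      then have "a = (m \<ominus>\<^bsub>M\<^esub> n) \<oplus>\<^bsub>M\<^esub> (r \<odot>\<^bsub>M\<^esub> b \<oplus>\<^bsub>M\<^esub> n)"
        using rm n sM bM by (metis M.add.m_lcomm M.minus_closed smult_closed)
      then show ?thesis using rm n sM bM by (simp add: M.minus_eq M.a_assoc M.r_neg)
    qed
    moreover have "a \<ominus>\<^bsub>M\<^esub> (r \<odot>\<^bsub>M\<^esub> b \<oplus>\<^bsub>M\<^esub> n) \<in> A" using submod_minus[OF insert.prems(2)] a n spDA by blast
    moreover have "m \<ominus>\<^bsub>M\<^esub> n \<in> span B" using submod_minus[OF sp] rm n by blast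
    ultimately have "m \<ominus>\<^bsub>M\<^esub> n \<in> span D'" using D' by auto
    then have "m \<ominus>\<^bsub>M\<^esub> n \<in> span D" using span_is_monotone[of D' D] by (auto simp: D_def)
    then have "(m \<ominus>\<^bsub>M\<^esub> n) \<oplus>\<^bsub>M\<^esub> (r \<odot>\<^bsub>M\<^esub> b \<oplus>\<^bsub>M\<^esub> n) \<in> span D" using submodD(4)[OF spD] n by blast
    moreover have "(m \<ominus>\<^bsub>M\<^esub> n) \<oplus>\<^bsub>M\<^esub> (r \<odot>\<^bsub>M\<^esub> b \<oplus>\<^bsub>M\<^esub> n) = a"
    proof -
      have "m = (m \<ominus>\<^bsub>M\<^esub> n) \<oplus>\<^bsub>M\<^esub> n" using rm n sM by (simp add: sub_add_cancel)
      then show ?thesis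
        using rm n sM bM by (metis M.add.m_lcomm M.minus_closed smult_closed)
    qed
    ultimately show "a \<in> span D" by simp
  qed
  moreover have "finite D" using S(2) D'(2) by (simp add: D_def)
  ultimately show ?case using DA by blast
qed

lemma submod_fg:
  assumes noeth: "noetherian_ring R" and M: "fg_module R M" and A: "submod R A M"
  shows "fg_module R (M\<lparr>carrier := A\<rparr>)"
proof -
  interpret Module.module R M using M by (rule fg_moduleD)
  obtain B where B: "B \<subseteq> carrier M" "finite B" "span B = carrier M"
    using M by (auto simp: fg_module_def)
  obtain D where D: "D \<subseteq> A" "finite D" "A \<subseteq> span D"
    using submod_of_span_fg[OF noeth B(2,1) A] submodD(2)[OF A] B(3) by auto
  interpret A: Module.module R "M\<lparr>carrier := A\<rparr>" using A by (rule submod_module)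
  show ?thesis
  proof (rule A.fg_moduleI[OF D(2)])
    fix N assume N: "submod R N (M\<lparr>carrier := A\<rparr>)" "D \<subseteq> N"
    then have "submod R N M"
      using submodD(2)[OF A] by (auto simp: LinearCombinations.submodule_def module_axioms)
    then show "carrier (M\<lparr>carrier := A\<rparr>) \<subseteq> N" using span_is_subset[OF N(2)] D(3) by auto
  qed (use D in auto)
qed

lemma short_exact_fg_left:
  assumes noeth: "noetherian_ring R" and s: "short_exact R K i P p M" and P: "fg_module R P"
  shows "fg_module R K"
proof -
  note S = short_exactD[OF s]
  have sub: "submod R (i ` carrier K) P" 
    using hom_image_submod[OF S(2,4) module.carrier_submod[OF S(1)]] .
  have "(\<lambda>x. x) \<in> module_hom R (P\<lparr>carrier := i ` carrier K\<rparr>) P"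
    using submodD(2)[OF sub] by (auto simp: LinearCombinations.module_hom_def)
  from hom_through_injective[OF S(1) submod_module[OF sub] S(4,5) this]
  obtain v where v: "v \<in> module_hom R (P\<lparr>carrier := i ` carrier K\<rparr>) K"
    "\<And>x. x \<in> i ` carrier K \<Longrightarrow> i (v x) = x" by auto
  have "v (i x) = x" if "x \<in> carrier K" for x
    by (rule inj_onD[OF S(5)]) (use that v(2) hom_closed[OF v(1)] in auto)
  then have "v ` (i ` carrier K) = carrier K" by (force simp: image_iff)
  then show ?thesis using fg_module_image[OF submod_fg[OF noeth P sub] S(1) v(1)] by simp
qed

text \<open>
  The union of a chain in \<open>S\<close> is finitely generated, hence equal to a member of the chain, so Zorn's
  lemma applies to any nonempty family of submodules.
\<close>
lemma fg_maximal_submodule: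
  assumes noeth: "noetherian_ring R" and M: "fg_module R M"
    and S: "S \<noteq> {}" "\<And>A. A \<in> S \<Longrightarrow> submod R A M"
  shows "\<exists>A\<in>S. \<forall>B\<in>S. A \<subseteq> B \<longrightarrow> B = A"
proof (rule subset_Zorn_nonempty[OF S(1)])
  fix C assume C: "C \<noteq> {}" "subset.chain S C"
  interpret Module.module R M using M by (rule fg_moduleD)
  have CS: "A \<in> S" if "A \<in> C" for A using C(2) that by (auto simp: subset_chain_def)
  have dir: "\<exists>E\<in>C. A \<subseteq> E \<and> B \<subseteq> E" if "A \<in> C" "B \<in> C" for A B
    using C(2) that unfolding subset_chain_def by (metis order_refl)
  have U: "submod R (\<Union>C) M"
  proof (rule submodI[OF module_axioms])
    show "\<Union>C \<subseteq> carrier M" using submodD(2)[OF S(2)[OF CS]] by blast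
    show "\<zero>\<^bsub>M\<^esub> \<in> \<Union>C" using submodD(3)[OF S(2)[OF CS]] C(1) by blast
  next
    fix v w assume "v \<in> \<Union>C" "w \<in> \<Union>C"
    then obtain E where "E \<in> C" "v \<in> E" "w \<in> E" using dir by blast
    then show "v \<oplus>\<^bsub>M\<^esub> w \<in> \<Union>C" using submodD(4)[OF S(2)[OF CS]] by blast
  next
    fix c v assume "c \<in> carrier R" "v \<in> \<Union>C"
    then show "c \<odot>\<^bsub>M\<^esub> v \<in> \<Union>C" using submodD(5)[OF S(2)[OF CS]] by blast
  qed
  obtain B where B: "B \<subseteq> \<Union>C" "finite B" and gen: "\<And>N. submod R N (M\<lparr>carrier := \<Union>C\<rparr>) \<Longrightarrow> B \<subseteq> N \<Longrightarrow> N = \<Union>C"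
    using fg_module_generators[OF submod_fg[OF noeth M U]] by auto
  obtain E where E: "E \<in> C" "B \<subseteq> E" using finite_subset_Union_chain[OF B(2,1) C] by blast
  have "submod R E (M\<lparr>carrier := \<Union>C\<rparr>)"
    using S(2)[OF CS[OF E(1)]] submod_module[OF U] E(1) by (auto simp: LinearCombinations.submodule_def)
  from gen[OF this E(2)] show "\<Union>C \<in> S" using CS[OF E(1)] by simp
qed

section \<open>Ideals of a local Artinian ring\<close>

lemma self_module_simps [simp]:
  "carrier (self_module R) = carrier R" "\<zero>\<^bsub>self_module R\<^esub> = \<zero>\<^bsub>R\<^esub>"
  "add (self_module R) = add R" "smult (self_module R) = mult R"
  by (simp_all add: self_module_def ideal_module_def)

lemma ideal_module_simps [simp]:
  "carrier (ideal_module R I) = I" "\<zero>\<^bsub>ideal_module R I\<^esub> = \<zero>\<^bsub>R\<^esub>"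
  "add (ideal_module R I) = add R" "smult (ideal_module R I) = mult R"
  by (simp_all add: ideal_module_def)

lemma ideal_module_eq: "ideal_module R I = self_module R\<lparr>carrier := I\<rparr>"
  by (simp add: self_module_def ideal_module_def)

context cring
begin

lemma self_module: "module R (self_module R)"
proof (rule module_criteria[OF is_cring])
  show "\<forall>v\<in>carrier (self_module R). \<exists>w\<in>carrier (self_module R). v \<oplus>\<^bsub>self_module R\<^esub> w = \<zero>\<^bsub>self_module R\<^esub>"
    by (auto intro: r_neg)
qed (auto simp: a_ac m_assoc l_distr r_distr)

lemma self_module_minus: "x \<in> carrier R \<Longrightarrow> y \<in> carrier R \<Longrightarrow> x \<ominus>\<^bsub>self_module R\<^esub> y = x \<ominus> y"
proof -
  interpret S: Module.module R "self_module R" by (rule self_module)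
  assume xy: "x \<in> carrier R" "y \<in> carrier R"
  have "\<ominus>\<^bsub>self_module R\<^esub> y = \<ominus> y"
    using xy S.M.minus_equality[of "\<ominus> y" y] by (simp add: l_neg)
  then show ?thesis using xy by (simp add: S.M.minus_eq minus_eq)
qed

lemma ideal_iff_submod: "ideal I R \<longleftrightarrow> submod R I (self_module R)"
proof
  assume "ideal I R"
  then interpret ideal I R .
  show "submod R I (self_module R)"
    by (rule submodI[OF self_module]) (auto simp: I_l_closed)
next
  assume I: "submod R I (self_module R)"
  note I' = submodD[OF I, simplified]
  interpret S: Module.module R "self_module R" by (rule self_module)
  show "ideal I R"
  proof (rule idealI)
    show "ring R" ..
    show "subgroup I (add_monoid R)"
    proof (rule add.subgroupI)
      fix a assume "a \<in> I"
      then show "\<ominus> a \<in> I" using I'(2) I'(5)[of "\<ominus> \<one>" a] by (auto simp: l_minus subset_iff)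
    qed (use I' in auto)
    show "x \<otimes> a \<in> I" "a \<otimes> x \<in> I" if "a \<in> I" "x \<in> carrier R" for a x
      using that I'(2,5) m_comm[of a x] by auto
  qed
qed

lemma ideal_module: "ideal I R \<Longrightarrow> module R (ideal_module R I)"
  using submod_module ideal_iff_submod ideal_module_eq by metis

lemma self_module_fg: "fg_module R (self_module R)"
proof -
  interpret S: Module.module R "self_module R" by (rule self_module)
  show ?thesis
  proof (rule S.fg_moduleI[of "{\<one>}"])
    fix N assume N: "submod R N (self_module R)" "{\<one>} \<subseteq> N"
    then have "r \<otimes> \<one> \<in> N" if "r \<in> carrier R" for r using submodD(5)[OF N(1), of r \<one>] that by auto
    then show "carrier (self_module R) \<subseteq> N" by auto
  qed auto
qed

lemma mult_hom:
  assumes "module R M" "x \<in> carrier M"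
  shows "(\<lambda>r. r \<odot>\<^bsub>M\<^esub> x) \<in> module_hom R (self_module R) M"
proof -
  interpret M: Module.module R M by fact
  show ?thesis using assms(2)
    by (auto simp: LinearCombinations.module_hom_def M.smult_l_distr M.smult_assoc1)
qed

lemma hom_self_eq:
  assumes "f \<in> module_hom R (self_module R) M" "r \<in> carrier R"
  shows "f r = r \<odot>\<^bsub>M\<^esub> f \<one>"
  using LinearCombinations.module_hom_smult[OF assms(1), of r \<one>] assms(2) by simp

lemma self_module_projective: "projective_module R (self_module R)"
proof (rule retract_of_finsupp_projective[OF self_module])
  let ?F = "finsupp_module R {()}"
  interpret F: Module.module R ?F by (rule finsupp_module)
  have u: "unit_fun R () \<in> carrier ?F" by (rule unit_fun_closed) simp
  show "(\<lambda>r. r \<odot>\<^bsub>?F\<^esub> unit_fun R ()) \<in> module_hom R (self_module R) ?F"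
    by (rule mult_hom[OF finsupp_module u])
  show "(\<lambda>f. f ()) \<in> module_hom R ?F (self_module R)"
    by (auto simp: LinearCombinations.module_hom_def finsupp_module_def)
  show "(r \<odot>\<^bsub>?F\<^esub> unit_fun R ()) () = r" if "r \<in> carrier (self_module R)" for r
    using that by (simp add: finsupp_module_def unit_fun_def)
qed

end

lemma (in artinian_ring) minimal_ideal:
  assumes "S \<noteq> {}" "\<And>A. A \<in> S \<Longrightarrow> ideal A R"
  shows "\<exists>A\<in>S. \<forall>B\<in>S. B \<subseteq> A \<longrightarrow> B = A"
proof (rule ccontr)
  assume "\<not> ?thesis"
  then have "\<forall>A\<in>S. \<exists>B\<in>S. B \<subset> A" by blast
  then have "\<exists>J. \<forall>n :: nat. J n \<in> S \<and> J (Suc n) \<subset> J n"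
    using assms(1) by (intro dependent_nat_choice) auto
  then obtain J :: "nat \<Rightarrow> 'a set" where J: "\<And>n. J n \<in> S" "\<And>n. J (Suc n) \<subset> J n" by blast
  obtain m where "\<forall>n\<ge>m. J n = J m"
    using descending_chain[of J] assms(2) J by blast
  then have "J (Suc m) = J m" using le_SucI by blast
  with J(2)[of m] show False by blast
qed

lemma (in noetherian_ring) maximal_ideal_in_family:
  assumes "cring R" "S \<noteq> {}" "\<And>A. A \<in> S \<Longrightarrow> ideal A R"
  shows "\<exists>A\<in>S. \<forall>B\<in>S. A \<subseteq> B \<longrightarrow> B = A"
proof -
  interpret cring R by fact
  show ?thesis
    using fg_maximal_submodule[OF noetherian_ring_axioms self_module_fg assms(2)] assms(3) ideal_iff_submod
    by blast
qed

locale local_artinian_gorenstein_ring = local_ring R + artinian_gorenstein_ring R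
  for R :: "('a, 'r) ring_scheme" (structure)
begin

text \<open>
  This is the maximal ideal, described by units because it is mostly used to decide whether an
  element can be cancelled.
\<close>
definition nonunits where "nonunits = carrier R - Units R"

lemma nonunits_ideal: "ideal nonunits R" and one_notin_nonunits: "\<one> \<notin> nonunits"
proof -
  obtain m where m: "maximalideal m R" and unique: "\<And>m'. maximalideal m' R \<Longrightarrow> m' = m"
    using unique_maximalideal by blast
  interpret m: maximalideal m R by fact
  have "nonunits = m"
  proof
    show "m \<subseteq> nonunits"
    proof
      fix r assume r: "r \<in> m"
      have "r \<notin> Units R"
      proof
        assume u: "r \<in> Units R"
        then have "inv r \<otimes> r \<in> m" using r m.I_l_closed by blast
        then have "\<one> \<in> m" using u by simp
        then show False using m.one_imp_carrier m.I_notcarr by simp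
      qed
      then show "r \<in> nonunits" using r m.Icarr by (simp add: nonunits_def)
    qed
    show "nonunits \<subseteq> m"
    proof
      fix r assume r: "r \<in> nonunits"
      then have rR: "r \<in> carrier R" by (simp add: nonunits_def)
      let ?S = "{A. ideal A R \<and> r \<in> A \<and> A \<noteq> carrier R}"
      have "\<one> \<notin> PIdl r"
      proof
        assume "\<one> \<in> PIdl r"
        then obtain x where "x \<in> carrier R" "\<one> = x \<otimes> r" by (auto simp: cgenideal_def)
        then have "r \<in> Units R" using rR m_comm[of r x] unfolding Units_def by force
        then show False using r by (simp add: nonunits_def)
      qed
      then have "PIdl r \<in> ?S" using cgenideal_ideal[OF rR] cgenideal_self[OF rR] by auto
      then have "\<exists>A\<in>?S. \<forall>B\<in>?S. A \<subseteq> B \<longrightarrow> B = A"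
        by (intro maximal_ideal_in_family[OF is_cring]) auto
      then obtain A where A: "ideal A R" "r \<in> A" "A \<noteq> carrier R" 
        "\<And>B. ideal B R \<Longrightarrow> B \<noteq> carrier R \<Longrightarrow> A \<subseteq> B \<Longrightarrow> B = A" by blast
      have "maximalideal A R" by (rule maximalidealI) (use A in blast)+
      then show "r \<in> m" using unique A(2) by blast
    qed
  qed
  then show "ideal nonunits R" using m.is_ideal by simp
  show "\<one> \<notin> nonunits" by (simp add: nonunits_def)
qed

lemma one_minus_nonunit:
  assumes "r \<in> nonunits"
  shows "\<one> \<ominus> r \<in> Units R"
proof (rule ccontr)
  interpret N: ideal nonunits R by (rule nonunits_ideal)
  have r: "r \<in> carrier R" using assms by (simp add: nonunits_def)
  assume "\<one> \<ominus> r \<notin> Units R"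
  then have "\<one> \<ominus> r \<in> nonunits" using r by (simp add: nonunits_def)
  then have "(\<one> \<ominus> r) \<oplus> r \<in> nonunits" using assms by (rule N.a_closed)
  moreover have "(\<one> \<ominus> r) \<oplus> r = \<one>" using r by (simp add: minus_eq a_assoc l_neg)
  ultimately show False using one_notin_nonunits by simp
qed

lemma unit_cancel_mem:
  assumes I: "submod R I M" and u: "u \<in> Units R" and x: "x \<in> carrier M" "u \<odot>\<^bsub>M\<^esub> x \<in> I"
  shows "x \<in> I"
proof -
  interpret M: Module.module R M using I by (rule submodD)
  have "inv u \<odot>\<^bsub>M\<^esub> (u \<odot>\<^bsub>M\<^esub> x) \<in> I" using submodD(5)[OF I] x(2) u by simp
  moreover have "inv u \<odot>\<^bsub>M\<^esub> (u \<odot>\<^bsub>M\<^esub> x) = x"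
    using u x(1) M.smult_assoc1[of "inv u" u x] by (simp add: Units_closed)
  ultimately show ?thesis by simp
qed

text \<open>
  The unit \<open>1 - r\<close> can be cancelled.
\<close>
lemma nakayama_element:
  assumes I: "submod R I M" and r: "r \<in> nonunits" and x: "x \<in> carrier M" "x \<ominus>\<^bsub>M\<^esub> r \<odot>\<^bsub>M\<^esub> x \<in> I"
  shows "x \<in> I"
proof -
  interpret M: Module.module R M using I by (rule submodD)
  have rR: "r \<in> carrier R" using r by (simp add: nonunits_def)
  have "(\<one> \<ominus> r) \<odot>\<^bsub>M\<^esub> x = x \<ominus>\<^bsub>M\<^esub> r \<odot>\<^bsub>M\<^esub> x"
    using rR x(1) by (simp add: minus_eq M.M.minus_eq M.smult_l_distr M.smult_l_minus)
  then show ?thesis using unit_cancel_mem[OF I one_minus_nonunit[OF r] x(1)] x(2) by simp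
qed

lemma nonunits_mult: "r \<in> carrier R \<Longrightarrow> s \<in> nonunits \<Longrightarrow> r \<otimes> s \<in> nonunits"
  using ideal.I_l_closed[OF nonunits_ideal] by blast

text \<open>
  The class of \<open>x\<close> spans a simple submodule of \<open>R/I\<close>: take an ideal \<open>A\<close> that is minimal among those
  not contained in \<open>I\<close>, and \<open>x\<close> in \<open>A\<close> but not in \<open>I\<close>. If \<open>r x\<close> is not in \<open>I\<close>, then it generates \<open>A\<close>
  by minimality, so \<open>x = s r x\<close>, which is impossible for a nonunit \<open>r\<close>.
\<close>
lemma socle_element:
  assumes I: "ideal I R" "I \<noteq> carrier R"
  shows "\<exists>x\<in>carrier R. x \<notin> I \<and> (\<forall>r\<in>nonunits. r \<otimes> x \<in> I)"
proof -
  have Is: "submod R I (self_module R)" using I(1) ideal_iff_submod by blast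
  let ?S = "{A. ideal A R \<and> \<not> A \<subseteq> I}"
  have "carrier R \<in> ?S" using oneideal I ideal.Icarr[OF I(1)] by blast
  then have "\<exists>A\<in>?S. \<forall>B\<in>?S. B \<subseteq> A \<longrightarrow> B = A" by (intro minimal_ideal) auto
  then obtain A where A: "ideal A R" "\<not> A \<subseteq> I" "\<And>B. ideal B R \<Longrightarrow> \<not> B \<subseteq> I \<Longrightarrow> B \<subseteq> A \<Longrightarrow> B = A" by blast
  then obtain x where x: "x \<in> A" "x \<notin> I" by blast
  have xR: "x \<in> carrier R" using x A(1) ideal.Icarr by metis
  have "r \<otimes> x \<in> I" if r: "r \<in> nonunits" for r
  proof (rule ccontr)
    assume rx: "r \<otimes> x \<notin> I"
    have rR: "r \<in> carrier R" using r by (simp add: nonunits_def)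
    have rxA: "r \<otimes> x \<in> A" using ideal.I_l_closed[OF A(1) x(1) rR] .
    have "PIdl (r \<otimes> x) \<subseteq> A" using cgenideal_minimal[OF A(1) rxA] .
    moreover have "\<not> PIdl (r \<otimes> x) \<subseteq> I" using cgenideal_self[of "r \<otimes> x"] rR xR rx by auto
    ultimately have "PIdl (r \<otimes> x) = A" using A(3) cgenideal_ideal rR xR by simp
    then obtain s where s: "s \<in> carrier R" "x = s \<otimes> (r \<otimes> x)" using x(1) by (auto simp: cgenideal_def)
    have "(s \<otimes> r) \<otimes> x = x" using s rR xR by (simp add: m_assoc)
    then have "x \<ominus>\<^bsub>self_module R\<^esub> (s \<otimes> r) \<odot>\<^bsub>self_module R\<^esub> x \<in> I"
      using xR submodD(3)[OF Is] by (simp add: self_module_minus minus_eq r_neg)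
    then have "x \<in> I" using nakayama_element[OF Is nonunits_mult[OF s(1) r]] xR by simp
    with x show False by simp
  qed
  then show ?thesis using x xR by blast
qed

text \<open>
  The quotient \<open>I/J\<close> is simple and spanned by the class of \<open>y\<close>: choose \<open>J\<close> maximal among the ideals
  properly contained in \<open>I\<close>.
\<close>
lemma maximal_subideal:
  assumes I: "ideal I R" "I \<noteq> {\<zero>}"
  shows "\<exists>J y. ideal J R \<and> y \<in> I \<and> y \<notin> J \<and> (\<forall>z\<in>I. \<exists>r\<in>carrier R. z \<ominus> r \<otimes> y \<in> J) \<and>
    (\<forall>r\<in>nonunits. r \<otimes> y \<in> J)"
proof -
  interpret I: ideal I R by fact
  let ?S = "{A. ideal A R \<and> A \<subseteq> I \<and> A \<noteq> I}"
  have "{\<zero>} \<in> ?S" using I.zero_closed by (simp add: zeroideal I(2)[symmetric])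
  then have "?S \<noteq> {}" by blast
  then have "\<exists>A\<in>?S. \<forall>B\<in>?S. A \<subseteq> B \<longrightarrow> B = A" by (rule maximal_ideal_in_family[OF is_cring]) blast
  then obtain J where "J \<in> ?S" and max: "\<forall>B\<in>?S. J \<subseteq> B \<longrightarrow> B = J" by (elim bexE)
  then have J: "ideal J R" "J \<subseteq> I" "J \<noteq> I" by simp_all
  interpret J: ideal J R by (rule J(1))
  have Js: "submod R J (self_module R)" using J(1) ideal_iff_submod by blast
  have gen: "\<exists>r\<in>carrier R. z \<ominus> r \<otimes> y \<in> J" if y: "y \<in> I" "y \<notin> J" and z: "z \<in> I" for y z
  proof -
    have yR: "y \<in> carrier R" and zR: "z \<in> carrier R" using y z I.Icarr by auto
    have id: "ideal (J <+>\<^bsub>R\<^esub> PIdl y) R" by (rule add_ideals[OF J(1) cgenideal_ideal[OF yR]])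
    have sumI: "j \<oplus> h \<in> J <+>\<^bsub>R\<^esub> PIdl y" if "j \<in> J" "h \<in> PIdl y" for j h
      using that by (auto simp: set_add_defs)
    have "J <+>\<^bsub>R\<^esub> PIdl y \<subseteq> I"
      using J(2) y I.I_l_closed by (auto simp: set_add_defs cgenideal_def)
    moreover have "J \<subseteq> J <+>\<^bsub>R\<^esub> PIdl y"
    proof
      fix j assume j: "j \<in> J"
      have "\<zero> \<in> PIdl y"
        by (rule additive_subgroup.zero_closed[OF ideal.axioms(1)[OF cgenideal_ideal[OF yR]]])
      then show "j \<in> J <+>\<^bsub>R\<^esub> PIdl y" using sumI[OF j, of \<zero>] j by simp
    qed
    moreover have "y \<in> J <+>\<^bsub>R\<^esub> PIdl y"
      using sumI[OF J.zero_closed cgenideal_self[OF yR]] yR by simp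
    ultimately have "J <+>\<^bsub>R\<^esub> PIdl y = I"
      using bspec[OF max, of "J <+>\<^bsub>R\<^esub> PIdl y"] id y(2) by auto
    then obtain j r where jr: "j \<in> J" "r \<in> carrier R" "z = j \<oplus> r \<otimes> y"
      using z by (auto simp: set_add_defs cgenideal_def)
    have "j \<in> carrier R" using jr(1) by simp
    then have "z \<ominus> r \<otimes> y = j" using jr yR by (simp add: minus_eq a_assoc r_neg)
    then have "z \<ominus> r \<otimes> y \<in> J" using jr(1) by simp
    then show ?thesis using jr(2) by (rule bexI)
  qed
  obtain y where y: "y \<in> I" "y \<notin> J" using J(2,3) by blast
  have yR: "y \<in> carrier R" using y I.Icarr by auto
  have "r \<otimes> y \<in> J" if r: "r \<in> nonunits" for r
  proof (rule ccontr)
    assume ry: "r \<otimes> y \<notin> J"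
    have rR: "r \<in> carrier R" using r by (simp add: nonunits_def)
    obtain s where s: "s \<in> carrier R" "y \<ominus> s \<otimes> (r \<otimes> y) \<in> J"
      using gen[OF I.I_l_closed[OF y(1) rR] ry y(1)] by (elim bexE)
    have "y \<ominus>\<^bsub>self_module R\<^esub> (s \<otimes> r) \<odot>\<^bsub>self_module R\<^esub> y \<in> J"
      using s rR yR by (simp add: self_module_minus m_assoc)
    then have "y \<in> J" using nakayama_element[OF Js nonunits_mult[OF s(1) r]] yR by simp
    with y show False by simp
  qed
  then show ?thesis using J(1) y gen[OF y] by blast
qed

section \<open>Rigid ideals\<close>

text \<open>
  Otherwise take \<open>x\<close> spanning a simple submodule of \<open>R/I\<close> and \<open>y\<close> spanning a simple quotient \<open>I/J\<close>.
  The nonzero homomorphism \<open>I \<rightarrow> I/J \<rightarrow> R/I\<close> with \<open>y \<mapsto> x\<close> is handled without quotients through the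
  free cover \<open>p : F \<rightarrow> I\<close>: it is given by \<open>f \<mapsto> \<kappa> f x\<close> on \<open>F\<close>, which maps the kernel of \<open>p\<close> into \<open>I\<close>.
  Rigidity corrects it by some \<open>\<mu> : F \<rightarrow> I\<close> to a map that descends to \<open>\<psi> : I \<rightarrow> R\<close>. Since \<open>\<psi>\<close> is a
  multiplication, \<open>\<psi> y\<close> is in \<open>I\<close>, and so is \<open>x\<close>.
\<close>
lemma rigid_ideal_trivial:
  assumes I: "ideal I R" and ext: "ext1_zero R (ideal_module R I) (ideal_module R I)"
  shows "I = {\<zero>} \<or> I = carrier R"
proof (rule ccontr)
  assume "\<not> ?thesis"
  then have I0: "I \<noteq> {\<zero>}" and I1: "I \<noteq> carrier R" by auto
  interpret I: ideal I R by fact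
  obtain x where x: "x \<in> carrier R" "x \<notin> I" "\<And>r. r \<in> nonunits \<Longrightarrow> r \<otimes> x \<in> I"
    using socle_element[OF I I1] by blast
  obtain J y where J: "ideal J R" "y \<in> I" "y \<notin> J" "\<forall>z\<in>I. \<exists>r\<in>carrier R. z \<ominus> r \<otimes> y \<in> J"
    "\<And>r. r \<in> nonunits \<Longrightarrow> r \<otimes> y \<in> J" using maximal_subideal[OF I I0] by blast
  from J(4) obtain \<rho> where \<rho>: "\<And>z. z \<in> I \<Longrightarrow> \<rho> z \<in> carrier R" "\<And>z. z \<in> I \<Longrightarrow> z \<ominus> \<rho> z \<otimes> y \<in> J" by metis
  interpret J: ideal J R by (rule J(1))
  have Is: "submod R I (self_module R)" and Js: "submod R J (self_module R)" using I J(1) ideal_iff_submod by auto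
  have yR: "y \<in> carrier R" using J(2) I.Icarr by auto
  interpret S: Module.module R "self_module R" by (rule self_module)
  interpret IM: Module.module R "ideal_module R I" by (rule ideal_module[OF I])
  define F where "F = finsupp_module R I"
  interpret F: Module.module R F unfolding F_def by (rule finsupp_module)
  define p where "p = ev R (ideal_module R I) (\<lambda>z. z)"
  have p: "p \<in> module_hom R F (ideal_module R I)" "p ` carrier F = I"
    using IM.finsupp_cover by (simp_all add: p_def F_def)
  have pS: "p \<in> module_hom R F (self_module R)"
    using p(1) I.Icarr by (auto simp: LinearCombinations.module_hom_def Pi_iff)
  have u: "unit_fun R z \<in> carrier F" if "z \<in> I" for z using that unit_fun_closed by (simp add: F_def)
  have pu: "p (unit_fun R z) = z" if "z \<in> I" for z
    using IM.ev_unit_fun[of z I "\<lambda>z. z"] that by (simp add: p_def)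
  \<comment> \<open>\<open>\<rho> z\<close> is the coefficient of \<open>y\<close> in \<open>z\<close> modulo \<open>J\<close>, and \<open>\<kappa>\<close> extends this to \<open>F\<close>.\<close>
  define \<kappa> where "\<kappa> = ev R (self_module R) \<rho>"
  have \<rho>': "\<rho> \<in> I \<rightarrow> carrier (self_module R)" using \<rho>(1) by simp
  have \<kappa>: "\<kappa> \<in> module_hom R F (self_module R)" using S.ev_hom[OF \<rho>'] by (simp add: \<kappa>_def F_def)
  have \<kappa>u: "\<kappa> (unit_fun R z) = \<rho> z" if "z \<in> I" for z using S.ev_unit_fun[OF that \<rho>'] by (simp add: \<kappa>_def)
  have \<kappa>c: "\<kappa> f \<in> carrier R" if "f \<in> carrier F" for f using hom_closed[OF \<kappa> that] by simp
  have \<kappa>y: "(\<lambda>f. \<kappa> f \<otimes> y) \<in> module_hom R F (self_module R)"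
    using module_hom_comp[OF \<kappa> mult_hom[OF self_module]] yR by simp
  have \<kappa>x: "(\<lambda>f. \<kappa> f \<otimes> x) \<in> module_hom R F (self_module R)"
    using module_hom_comp[OF \<kappa> mult_hom[OF self_module]] x(1) by simp
  note \<theta> = hom_minus_hom[OF self_module pS \<kappa>y]
  have "{f \<in> carrier F. p f \<ominus>\<^bsub>self_module R\<^esub> \<kappa> f \<otimes> y \<in> J} = carrier F"
    unfolding F_def
    using hom_vimage_submod[OF F.module_axioms \<theta> Js] \<rho>(2) u pu \<kappa>u I.Icarr yR \<rho>(1)
    by (intro finsupp_generated) (auto simp: F_def self_module_minus)
  then have \<theta>J: "p f \<ominus>\<^bsub>self_module R\<^esub> \<kappa> f \<otimes> y \<in> J" if "f \<in> carrier F" for f using that by blast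
  define K where "K = F\<lparr>carrier := {f \<in> carrier F. p f = \<zero>}\<rparr>"
  have s: "short_exact R K (\<lambda>f. f) F p (ideal_module R I)"
    using short_exact_kernel[OF F.module_axioms IM.module_axioms p(1)] p(2) by (simp add: K_def)
  have "\<kappa> f \<otimes> x \<in> I" if f: "f \<in> carrier K" for f
  proof -
    have fF: "f \<in> carrier F" and pf: "p f = \<zero>" using f by (auto simp: K_def)
    have "\<zero> \<ominus> \<kappa> f \<otimes> y \<in> J" using \<theta>J[OF fF] pf \<kappa>c[OF fF] yR by (simp add: self_module_minus)
    then have "\<ominus> (\<zero> \<ominus> \<kappa> f \<otimes> y) \<in> J" by (rule J.a_inv_closed)
    then have "\<kappa> f \<otimes> y \<in> J" using \<kappa>c[OF fF] yR by (simp add: minus_eq)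
    then have "\<kappa> f \<notin> Units R" using unit_cancel_mem[OF Js, of "\<kappa> f" y] yR J(3) by auto
    then show ?thesis using x(3) \<kappa>c[OF fF] by (simp add: nonunits_def)
  qed
  then have "(\<lambda>f. \<kappa> f \<otimes> x) \<in> module_hom R K (ideal_module R I)"
    using \<kappa>x by (auto simp: LinearCombinations.module_hom_def K_def)
  note \<kappa>K = this
  have "projective_module R F" unfolding F_def by (rule finsupp_projective)
  then have "extends_along R K (\<lambda>f. f) F (ideal_module R I)"
    using ext ext1_zero_iff[OF s _ IM.module_axioms] by blast
  from extends_alongD[OF this \<kappa>K] obtain \<mu> where \<mu>: "\<mu> \<in> module_hom R F (ideal_module R I)"
    "\<And>f. f \<in> carrier K \<Longrightarrow> \<mu> f = \<kappa> f \<otimes> x" by blast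
  have \<mu>S: "\<mu> \<in> module_hom R F (self_module R)"
    using \<mu>(1) I.Icarr by (auto simp: LinearCombinations.module_hom_def Pi_iff)
  have \<mu>I: "\<mu> f \<in> I" if "f \<in> carrier F" for f using hom_closed[OF \<mu>(1) that] by simp
  obtain \<psi> where \<psi>: "\<psi> \<in> module_hom R (ideal_module R I) (self_module R)"
    "\<And>f. f \<in> carrier F \<Longrightarrow> \<psi> (p f) = \<kappa> f \<otimes> x \<ominus>\<^bsub>self_module R\<^esub> \<mu> f"
  proof -
    have "\<kappa> f \<otimes> x \<ominus>\<^bsub>self_module R\<^esub> \<mu> f = \<zero>\<^bsub>self_module R\<^esub>" if "f \<in> carrier K" for f
      using \<mu>(2)[OF that] that \<kappa>c x(1) by (simp add: K_def self_module_minus minus_eq r_neg)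
    then show ?thesis using short_exact_descend[OF s self_module hom_minus_hom[OF self_module \<kappa>x \<mu>S]] that by auto
  qed
  have "(\<lambda>z. z) \<in> module_hom R (ideal_module R I) (self_module R)"
    using I.Icarr by (auto simp: LinearCombinations.module_hom_def)
  from injective_extends_along[OF self_injective self_module_fg IM.module_axioms this]
  have "extends_along R (ideal_module R I) (\<lambda>z. z) (self_module R) (self_module R)" by simp
  from extends_alongD[OF this \<psi>(1)] obtain \<Psi> where \<Psi>: "\<Psi> \<in> module_hom R (self_module R) (self_module R)" "\<And>z. z \<in> I \<Longrightarrow> \<Psi> z = \<psi> z" by auto
  \<comment> \<open>Self-injectivity enters here: \<open>\<psi>\<close> is the restriction of an endomorphism of \<open>R\<close>.\<close>
  have "\<psi> y = y \<otimes> \<Psi> \<one>" using \<Psi>(2)[OF J(2)] hom_self_eq[OF \<Psi>(1) yR] by simp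
  then have "\<psi> y \<in> I" using I.I_r_closed[OF J(2)] hom_closed[OF \<Psi>(1), of \<one>] by simp
  moreover have "\<psi> y = \<rho> y \<otimes> x \<ominus>\<^bsub>self_module R\<^esub> \<mu> (unit_fun R y)"
    using \<psi>(2)[OF u[OF J(2)]] pu[OF J(2)] \<kappa>u[OF J(2)] by simp
  ultimately have "(\<rho> y \<otimes> x \<ominus>\<^bsub>self_module R\<^esub> \<mu> (unit_fun R y)) \<oplus> \<mu> (unit_fun R y) \<in> I"
    using \<mu>I[OF u[OF J(2)]] I.a_closed by simp
  then have "\<rho> y \<otimes> x \<in> I"
    using S.sub_add_cancel[of "\<rho> y \<otimes> x" "\<mu> (unit_fun R y)"] \<mu>I[OF u[OF J(2)]] I.Icarr \<rho>(1)[OF J(2)] x(1) by simp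
  moreover have "\<rho> y \<in> Units R"
  proof (rule ccontr)
    assume "\<rho> y \<notin> Units R"
    then have n: "\<rho> y \<in> nonunits" using \<rho>(1)[OF J(2)] by (simp add: nonunits_def)
    have "y \<ominus>\<^bsub>self_module R\<^esub> \<rho> y \<odot>\<^bsub>self_module R\<^esub> y \<in> J"
      using \<rho>(2)[OF J(2)] yR \<rho>(1)[OF J(2)] by (simp add: self_module_minus)
    then show False using nakayama_element[OF Js n] yR J(3) by simp
  qed
  ultimately have "x \<in> I" using unit_cancel_mem[OF Is, of "\<rho> y" x] x(1) by simp
  with x(2) show False by simp
qed

end

section \<open>Injectivity of free modules and embeddings into them\<close>

lemma fg_projective_retract:
  fixes P :: "('a, 'p) module"
  assumes "projective_module R P" "fg_module R P"
  obtains X :: "'p set" and s r where "finite X" "s \<in> module_hom R P (finsupp_module R X)"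
    "r \<in> module_hom R (finsupp_module R X) P" "\<And>x. x \<in> carrier P \<Longrightarrow> r (s x) = x"
proof -
  interpret P: Module.module R P using assms(2) by (rule fg_moduleD)
  obtain X where X: "finite X" "ev R P (\<lambda>x. x) \<in> module_hom R (finsupp_module R X) P"
    "ev R P (\<lambda>x. x) ` carrier (finsupp_module R X) = carrier P"
    using fg_module_cover[OF assms(2)] by blast
  obtain s where "s \<in> module_hom R P (finsupp_module R X)" "\<And>x. x \<in> carrier P \<Longrightarrow> ev R P (\<lambda>x. x) (s x) = x"
    using projective_lift[OF assms(1) P.R.finsupp_module P.module_axioms X(2,3) hom_id] by blast
  then show ?thesis using that[OF X(1) _ X(2)] by blast
qed

lemma extends_along_retract:
  assumes ext: "extends_along R K i P N'" and s: "s \<in> module_hom R N N'" and r: "r \<in> module_hom R N' N"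
    and rs: "\<And>x. x \<in> carrier N \<Longrightarrow> r (s x) = x"
  shows "extends_along R K i P N"
  unfolding extends_along_def
proof
  fix h assume h: "h \<in> module_hom R K N"
  obtain k where k: "k \<in> module_hom R P N'" "\<forall>x\<in>carrier K. k (i x) = s (h x)"
    using extends_alongD[OF ext module_hom_comp[OF h s]] by blast
  have "r (k (i x)) = h x" if "x \<in> carrier K" for x
    using k(2) that rs hom_closed[OF h] by simp
  then show "\<exists>k\<in>module_hom R P N. \<forall>x\<in>carrier K. k (i x) = h x"
    by (intro bexI[OF _ module_hom_comp[OF k(1) r]] ballI)
qed

context local_artinian_gorenstein_ring
begin

lemma hom_into_finsupp:
  assumes X: "finite X" and k: "\<And>x. x \<in> X \<Longrightarrow> k x \<in> module_hom R M (self_module R)"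
  shows "(\<lambda>m x. if x \<in> X then k x m else \<zero>) \<in> module_hom R M (finsupp_module R X)"
proof -
  have fin: "finite {x. (if x \<in> X then k x m else \<zero>) \<noteq> \<zero>}" for m
    by (rule finite_subset[OF _ X]) (auto split: if_splits)
  have cl: "k x m \<in> carrier R" if "x \<in> X" "m \<in> carrier M" for x m
    using hom_closed[OF k[OF that(1)] that(2)] by simp
  show ?thesis
    unfolding LinearCombinations.module_hom_def finsupp_module_def
    using LinearCombinations.module_hom_add[OF k] LinearCombinations.module_hom_smult[OF k] fin cl
    by (auto simp: fun_eq_iff split: if_splits)
qed

lemma finsupp_extends_along:
  assumes Q: "fg_module R Q" and A: "module R A" and g: "g \<in> module_hom R A Q" "inj_on g (carrier A)"
    and X: "finite X"
  shows "extends_along R A g Q (finsupp_module R X)"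
  unfolding extends_along_def
proof
  fix h assume h: "h \<in> module_hom R A (finsupp_module R X)"
  have hx: "(\<lambda>a. h a x) \<in> module_hom R A (self_module R)" for x
    using h by (auto simp: LinearCombinations.module_hom_def finsupp_module_def Pi_iff)
  have "\<exists>k. k \<in> module_hom R Q (self_module R) \<and> (\<forall>a\<in>carrier A. k (g a) = h a x)" for x
    using extends_alongD[OF injective_extends_along[OF self_injective Q A g] hx[of x]] by blast
  then obtain k where k: "\<And>x. k x \<in> module_hom R Q (self_module R)"
    "\<And>x a. a \<in> carrier A \<Longrightarrow> k x (g a) = h a x" by metis
  let ?k = "\<lambda>q x. if x \<in> X then k x q else \<zero>"
  have hom: "?k \<in> module_hom R Q (finsupp_module R X)"
    by (rule hom_into_finsupp[OF X k(1)])
  have "?k (g a) = h a" if "a \<in> carrier A" for a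
    using k(2)[OF that] hom_closed[OF h that] by (force simp: finsupp_module_def fun_eq_iff)
  then show "\<exists>k\<in>module_hom R Q (finsupp_module R X). \<forall>x\<in>carrier A. k (g x) = h x"
    by (intro bexI[OF _ hom] ballI)
qed

lemma fg_projective_extends_along:
  assumes Q: "fg_module R Q" and A: "module R A" and g: "g \<in> module_hom R A Q" "inj_on g (carrier A)"
    and P: "projective_module R P" "fg_module R P"
  shows "extends_along R A g Q P"
proof -
  show ?thesis
  proof (rule fg_projective_retract[OF P])
    fix X s r assume X: "finite X" and sr: "s \<in> module_hom R P (finsupp_module R X)"
      "r \<in> module_hom R (finsupp_module R X) P" "\<And>x. x \<in> carrier P \<Longrightarrow> r (s x) = x"
    show "extends_along R A g Q P" 
      using extends_along_retract[OF finsupp_extends_along[OF Q A g X] sr(1,2)] sr(3) by blast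
  qed
qed

text \<open>
  The annihilator of \<open>x\<close> consists of nonunits, so it kills a socle element \<open>s\<close> of \<open>R\<close>. Hence
  \<open>r x \<mapsto> r s\<close> is a well-defined functional on the submodule spanned by \<open>x\<close>, and it extends to \<open>L\<close>.
\<close>
lemma functional_nonzero:
  assumes L: "fg_module R L" and x: "x \<in> carrier L" "x \<noteq> \<zero>\<^bsub>L\<^esub>"
  shows "\<exists>\<phi>\<in>module_hom R L (self_module R). \<phi> x \<noteq> \<zero>"
proof -
  interpret L: Module.module R L using L by (rule fg_moduleD)
  have "\<one> \<noteq> \<zero>"
    using one_notin_nonunits additive_subgroup.zero_closed[OF ideal.axioms(1)[OF nonunits_ideal]] by metis
  then have "{\<zero>} \<noteq> carrier R" using one_closed by blast
  then obtain s where s: "s \<in> carrier R" "s \<noteq> \<zero>" "\<And>r. r \<in> nonunits \<Longrightarrow> r \<otimes> s = \<zero>"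
    using socle_element[OF zeroideal] by auto
  have zs: "submod R {\<zero>\<^bsub>L\<^esub>} L" by (rule submodI[OF L.module_axioms]) auto
  note p = mult_hom[OF L.module_axioms x(1)]
  have sub: "submod R ((\<lambda>r. r \<odot>\<^bsub>L\<^esub> x) ` carrier R) L"
    using hom_image_submod[OF L.module_axioms p module.carrier_submod[OF self_module]] by simp
  define A where "A = L\<lparr>carrier := (\<lambda>r. r \<odot>\<^bsub>L\<^esub> x) ` carrier R\<rparr>"
  interpret A: Module.module R A unfolding A_def by (rule submod_module[OF sub])
  have pA: "(\<lambda>r. r \<odot>\<^bsub>L\<^esub> x) \<in> module_hom R (self_module R) A"
    using p by (auto simp: LinearCombinations.module_hom_def A_def)
  have "r \<otimes> s = \<zero>" if "r \<in> carrier R" "r \<odot>\<^bsub>L\<^esub> x = \<zero>\<^bsub>L\<^esub>" for r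
  proof -
    have "r \<notin> Units R" using unit_cancel_mem[OF zs, of r x] that x by auto
    then show ?thesis using s(3) that(1) by (simp add: nonunits_def)
  qed
  then have "\<exists>v\<in>module_hom R A (self_module R). \<forall>r\<in>carrier (self_module R). v (r \<odot>\<^bsub>L\<^esub> x) = r \<otimes> s"
    using mult_hom[OF self_module, of s] s(1)
    by (intro hom_through_surjective[OF self_module A.module_axioms self_module pA]) (auto simp: A_def)
  then obtain v where v: "v \<in> module_hom R A (self_module R)" "\<And>r. r \<in> carrier R \<Longrightarrow> v (r \<odot>\<^bsub>L\<^esub> x) = r \<otimes> s"
    by auto
  have i: "(\<lambda>a. a) \<in> module_hom R A L" "inj_on (\<lambda>a. a) (carrier A)"
    using x(1) by (auto simp: LinearCombinations.module_hom_def A_def)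
  obtain \<phi> where \<phi>: "\<phi> \<in> module_hom R L (self_module R)" "\<And>a. a \<in> carrier A \<Longrightarrow> \<phi> a = v a"
    using extends_alongD[OF injective_extends_along[OF self_injective L A.module_axioms i] v(1)] by blast
  have "x \<in> carrier A" using x(1) unfolding A_def by (simp add: image_iff) (metis L.smult_one one_closed)
  then have "\<phi> x = s" using \<phi>(2) v(2)[OF one_closed] x(1) s(1) by simp
  with \<phi>(1) s(2) show ?thesis by blast
qed

text \<open>
  A functional on \<open>L\<close> is determined by its values on a finite generating set \<open>B\<close>, so the dual of \<open>L\<close>
  embeds into a free module of finite rank and is finitely generated. Every nonzero element of \<open>L\<close> is
  detected by some functional, hence by one of finitely many generators of the dual, and these
  generators are the coordinates of the embedding.
\<close>
lemma fg_embeds_in_free: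
  fixes L :: "('a, 'l) module"
  assumes L: "fg_module R L"
  shows "\<exists>(X :: ('l \<Rightarrow> 'a) set) j. finite X \<and> j \<in> module_hom R L (finsupp_module R X) \<and> inj_on j (carrier L)"
proof -
  interpret L: Module.module R L using L by (rule fg_moduleD)
  obtain B where B: "B \<subseteq> carrier L" "finite B" "\<And>N. submod R N L \<Longrightarrow> B \<subseteq> N \<Longrightarrow> N = carrier L"
    using fg_module_generators[OF L] by blast
  define dual where "dual = module_hom R L (self_module R)"
  define vec where "vec \<phi> = (\<lambda>b. if b \<in> B then \<phi> b else \<zero>)" for \<phi> :: "'l \<Rightarrow> 'a"
  define F where "F = finsupp_module R B"
  have FG: "fg_module R F" unfolding F_def by (rule fg_finsupp_module[OF B(2)])
  interpret F: Module.module R F using FG by (rule fg_moduleD)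
  have dc: "\<phi> x \<in> carrier R" if "\<phi> \<in> dual" "x \<in> carrier L" for \<phi> x
    using hom_closed[of \<phi> R L "self_module R" x] that by (simp add: dual_def)
  have vec: "vec \<phi> \<in> carrier F" if "\<phi> \<in> dual" for \<phi>
  proof -
    have "{b. vec \<phi> b \<noteq> \<zero>} \<subseteq> B" by (auto simp: vec_def)
    then show ?thesis using dc[OF that] B(1,2) finite_subset
      by (auto simp: F_def finsupp_module_def vec_def)
  qed
  have add: "(\<lambda>x. \<phi> x \<oplus> \<psi> x) \<in> dual" "vec (\<lambda>x. \<phi> x \<oplus> \<psi> x) = vec \<phi> \<oplus>\<^bsub>F\<^esub> vec \<psi>" if "\<phi> \<in> dual" "\<psi> \<in> dual" for \<phi> \<psi>
    using hom_plus_hom[OF self_module] that by (auto simp: dual_def F_def finsupp_module_def vec_def)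
  have scl: "(\<lambda>x. c \<otimes> \<phi> x) \<in> dual" "vec (\<lambda>x. c \<otimes> \<phi> x) = c \<odot>\<^bsub>F\<^esub> vec \<phi>" if "\<phi> \<in> dual" "c \<in> carrier R" for c \<phi>
  proof -
    show "(\<lambda>x. c \<otimes> \<phi> x) \<in> dual"
      using that(1) that(2) unfolding dual_def LinearCombinations.module_hom_def
      by (auto simp: r_distr m_lcomm Pi_iff)
    show "vec (\<lambda>x. c \<otimes> \<phi> x) = c \<odot>\<^bsub>F\<^esub> vec \<phi>"
      using that(2) by (auto simp: F_def finsupp_module_def vec_def)
  qed
  have zero: "(\<lambda>x. \<zero>) \<in> dual" "vec (\<lambda>x. \<zero>) = \<zero>\<^bsub>F\<^esub>"
    using hom_const_zero[OF self_module] by (auto simp: dual_def F_def finsupp_module_def vec_def)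
  have sub: "submod R {vec \<phi> |\<phi>. \<phi> \<in> dual \<and> P \<phi>} F"
    if "P (\<lambda>x. \<zero>)" "\<And>\<phi> \<psi>. \<phi> \<in> dual \<Longrightarrow> \<psi> \<in> dual \<Longrightarrow> P \<phi> \<Longrightarrow> P \<psi> \<Longrightarrow> P (\<lambda>x. \<phi> x \<oplus> \<psi> x)"
      "\<And>c \<phi>. c \<in> carrier R \<Longrightarrow> \<phi> \<in> dual \<Longrightarrow> P \<phi> \<Longrightarrow> P (\<lambda>x. c \<otimes> \<phi> x)" for P
  proof (rule submodI[OF F.module_axioms])
    show "{vec \<phi> |\<phi>. \<phi> \<in> dual \<and> P \<phi>} \<subseteq> carrier F" using vec by auto
    show "\<zero>\<^bsub>F\<^esub> \<in> {vec \<phi> |\<phi>. \<phi> \<in> dual \<and> P \<phi>}" using zero that(1) by force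
  next
    fix v w assume "v \<in> {vec \<phi> |\<phi>. \<phi> \<in> dual \<and> P \<phi>}" "w \<in> {vec \<phi> |\<phi>. \<phi> \<in> dual \<and> P \<phi>}"
    then obtain \<phi> \<psi> where "\<phi> \<in> dual" "P \<phi>" "v = vec \<phi>" "\<psi> \<in> dual" "P \<psi>" "w = vec \<psi>" by blast
    then show "v \<oplus>\<^bsub>F\<^esub> w \<in> {vec \<phi> |\<phi>. \<phi> \<in> dual \<and> P \<phi>}"
      using that(2)[of \<phi> \<psi>] add[of \<phi> \<psi>] by (intro CollectI exI[of _ "\<lambda>x. \<phi> x \<oplus> \<psi> x"]) simp
  next
    fix c v assume "c \<in> carrier R" "v \<in> {vec \<phi> |\<phi>. \<phi> \<in> dual \<and> P \<phi>}"
    then obtain \<phi> where "c \<in> carrier R" "\<phi> \<in> dual" "P \<phi>" "v = vec \<phi>" by blast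
    then show "c \<odot>\<^bsub>F\<^esub> v \<in> {vec \<phi> |\<phi>. \<phi> \<in> dual \<and> P \<phi>}"
      using that(3)[of c \<phi>] scl[of \<phi> c] by (intro CollectI exI[of _ "\<lambda>x. c \<otimes> \<phi> x"]) simp
  qed
  define D where "D = vec ` dual"
  have D: "submod R D F" using sub[of "\<lambda>_. True"] by (simp add: D_def Setcompr_eq_image)
  obtain X where X: "X \<subseteq> D" "finite X" "\<And>N. submod R N (F\<lparr>carrier := D\<rparr>) \<Longrightarrow> X \<subseteq> N \<Longrightarrow> N = D"
    using fg_module_generators[OF submod_fg[OF noetherian_ring_axioms FG D]] by auto
  have "\<forall>d\<in>X. \<exists>\<phi>. \<phi> \<in> dual \<and> vec \<phi> = d" using X(1) by (auto simp: D_def)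
  then obtain \<phi> where \<phi>: "\<And>d. d \<in> X \<Longrightarrow> \<phi> d \<in> dual \<and> vec (\<phi> d) = d" by metis
  define j where "j x = (\<lambda>d. if d \<in> X then \<phi> d x else \<zero>)" for x
  have "j \<in> module_hom R L (finsupp_module R X)"
    unfolding j_def[abs_def] by (rule hom_into_finsupp[OF X(2)]) (use \<phi> in \<open>simp add: dual_def\<close>)
  moreover have zero_iff: "x = \<zero>\<^bsub>L\<^esub>" if x: "x \<in> carrier L" and j: "\<And>d. d \<in> X \<Longrightarrow> \<phi> d x = \<zero>" for x
  proof (rule ccontr)
    assume "x \<noteq> \<zero>\<^bsub>L\<^esub>"
    then obtain \<eta> where \<eta>: "\<eta> \<in> dual" "\<eta> x \<noteq> \<zero>" using functional_nonzero[OF L x] by (auto simp: dual_def)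
    \<comment> \<open>The functionals that vanish at \<open>x\<close> contain the generators of the dual, so they are everything.\<close>
    have "submod R {vec \<phi> |\<phi>. \<phi> \<in> dual \<and> \<phi> x = \<zero>} F" by (rule sub) auto
    then have "submod R {vec \<phi> |\<phi>. \<phi> \<in> dual \<and> \<phi> x = \<zero>} (F\<lparr>carrier := D\<rparr>)"
      using submod_module[OF D] by (auto simp: LinearCombinations.submodule_def D_def)
    moreover have "X \<subseteq> {vec \<phi> |\<phi>. \<phi> \<in> dual \<and> \<phi> x = \<zero>}"
    proof
      fix d assume "d \<in> X"
      then show "d \<in> {vec \<phi> |\<phi>. \<phi> \<in> dual \<and> \<phi> x = \<zero>}"
        using \<phi>[of d] j[of d] by (intro CollectI exI[of _ "\<phi> d"]) simp
    qed
    ultimately have "{vec \<phi> |\<phi>. \<phi> \<in> dual \<and> \<phi> x = \<zero>} = D" by (rule X(3))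
    then have "vec \<eta> \<in> {vec \<phi> |\<phi>. \<phi> \<in> dual \<and> \<phi> x = \<zero>}" using \<eta>(1) by (simp add: D_def)
    then obtain \<zeta> where \<zeta>: "\<zeta> \<in> dual" "\<zeta> x = \<zero>" "vec \<eta> = vec \<zeta>" by blast
    note diff = hom_minus_hom[OF self_module \<eta>(1)[unfolded dual_def] \<zeta>(1)[unfolded dual_def]]
    have "{y \<in> carrier L. \<eta> y \<ominus>\<^bsub>self_module R\<^esub> \<zeta> y = \<zero>\<^bsub>self_module R\<^esub>} = carrier L"
    proof (rule B(3)[OF hom_kernel_submod[OF L.module_axioms self_module diff]], rule subsetI)
      fix b assume b: "b \<in> B"
      then have "\<eta> b = \<zeta> b" using fun_cong[OF \<zeta>(3), of b] by (simp add: vec_def)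
      then show "b \<in> {y \<in> carrier L. \<eta> y \<ominus>\<^bsub>self_module R\<^esub> \<zeta> y = \<zero>\<^bsub>self_module R\<^esub>}"
        using b B(1) dc[OF \<zeta>(1)] by (auto simp: self_module_minus minus_eq r_neg)
    qed
    then have "\<eta> x \<ominus>\<^bsub>self_module R\<^esub> \<zeta> x = \<zero>" using x by auto
    then show False
      using \<zeta>(2) \<eta>(2) dc[OF \<eta>(1) x] by (simp add: self_module_minus minus_eq)
  qed
  moreover have "inj_on j (carrier L)"
  proof (rule inj_onI)
    fix x y assume xy: "x \<in> carrier L" "y \<in> carrier L" "j x = j y"
    have "\<phi> d (x \<ominus>\<^bsub>L\<^esub> y) = \<zero>" if d: "d \<in> X" for d
    proof -
      have h: "\<phi> d \<in> module_hom R L (self_module R)" using \<phi>[OF d] by (simp add: dual_def)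
      have "\<phi> d x = \<phi> d y" using fun_cong[OF xy(3), of d] d by (simp add: j_def)
      then show ?thesis
        using hom_minus[OF L.module_axioms self_module h xy(1,2)] dc[of "\<phi> d"] \<phi>[OF d] xy
        by (simp add: self_module_minus minus_eq r_neg)
    qed
    then have "x \<ominus>\<^bsub>L\<^esub> y = \<zero>\<^bsub>L\<^esub>" using xy by (intro zero_iff) auto
    then show "x = y" using xy by (simp add: L.minus_zero_iff)
  qed
  ultimately show ?thesis using X(2) by blast
qed

section \<open>Injective hulls of finitely generated modules\<close>

text \<open>
  Let \<open>j : L \<rightarrow> G\<close> be an embedding into a free module of finite rank. Consider the finitely generated
  submodules \<open>W\<close> of \<open>E\<close> containing the image of \<open>L\<close>, with extensions \<open>s : W \<rightarrow> G\<close> of \<open>j\<close>. Such an \<open>s\<close>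
  is injective because \<open>L\<close> is essential in \<open>E\<close>. If \<open>W \<noteq> E\<close>, one more element can be added to \<open>W\<close>, and
  the image of \<open>s\<close> grows strictly; so a pair with maximal image has \<open>W = E\<close>. Then \<open>E\<close> is finitely
  generated, and injectivity of \<open>E\<close> makes it a retract of \<open>G\<close>.
\<close>
lemma injective_hull_fg_projective:
  fixes L :: "('a, 'l) module" and E :: "('a, 'e) module"
  assumes L: "fg_module R L" and hull: "injective_hull R L f E"
  shows "fg_module R E \<and> projective_module R E"
proof -
  have E: "injective_module R E" and f: "f \<in> module_hom R L E" "inj_on f (carrier L)"
    and essential: "\<And>N. submod R N E \<Longrightarrow> N \<inter> f ` carrier L = {\<zero>\<^bsub>E\<^esub>} \<Longrightarrow> N = {\<zero>\<^bsub>E\<^esub>}"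
    using hull by (auto simp: injective_hull_def)
  interpret L: Module.module R L using L by (rule fg_moduleD)
  interpret E: Module.module R E using E by (simp add: injective_module_def)
  obtain X :: "('l \<Rightarrow> 'a) set" and j where X: "finite X"
    and j: "j \<in> module_hom R L (finsupp_module R X)" "inj_on j (carrier L)"
    using fg_embeds_in_free[OF L] by blast
  define G where "G = finsupp_module R X"
  have G: "fg_module R G" unfolding G_def by (rule fg_finsupp_module[OF X])
  interpret G: Module.module R G using G by (rule fg_moduleD)
  note jG = j(1)[folded G_def]
  define ok where "ok W s \<longleftrightarrow> submod R W E \<and> f ` carrier L \<subseteq> W \<and> fg_module R (E\<lparr>carrier := W\<rparr>) \<and>
    s \<in> module_hom R (E\<lparr>carrier := W\<rparr>) G \<and> (\<forall>x\<in>carrier L. s (f x) = j x)" for W s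
  have inj: "inj_on s W" if ok: "ok W s" for W s
  proof (rule inj_onI)
    have W: "submod R W E" and s: "s \<in> module_hom R (E\<lparr>carrier := W\<rparr>) G"
      "\<And>x. x \<in> carrier L \<Longrightarrow> s (f x) = j x" using ok by (auto simp: ok_def)
    interpret W: Module.module R "E\<lparr>carrier := W\<rparr>" by (rule submod_module[OF W])
    have WE: "w \<in> carrier E" if "w \<in> W" for w using submodD(2)[OF W] that by blast
    let ?N = "{w \<in> W. s w = \<zero>\<^bsub>G\<^esub>}"
    have "submod R ?N (E\<lparr>carrier := W\<rparr>)"
      using hom_kernel_submod[OF W.module_axioms G.module_axioms s(1)] by simp
    then have N: "submod R ?N E"
      using submodD(2)[OF W] by (auto simp: LinearCombinations.submodule_def E.module_axioms)
    have "?N \<inter> f ` carrier L = {\<zero>\<^bsub>E\<^esub>}"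
    proof
      show "?N \<inter> f ` carrier L \<subseteq> {\<zero>\<^bsub>E\<^esub>}"
      proof
        fix w assume "w \<in> ?N \<inter> f ` carrier L"
        then obtain x where x: "x \<in> carrier L" "w = f x" "j x = \<zero>\<^bsub>G\<^esub>" using s(2) by force
        then have "x = \<zero>\<^bsub>L\<^esub>"
          using inj_onD[OF j(2), of x "\<zero>\<^bsub>L\<^esub>"] hom_zero[OF L.module_axioms G.module_axioms jG] by simp
        then show "w \<in> {\<zero>\<^bsub>E\<^esub>}" using x(2) hom_zero[OF L.module_axioms E.module_axioms f(1)] by simp
      qed
      show "{\<zero>\<^bsub>E\<^esub>} \<subseteq> ?N \<inter> f ` carrier L"
        using submodD(3)[OF N] hom_zero[OF L.module_axioms E.module_axioms f(1)] by force
    qed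
    then have N0: "?N = {\<zero>\<^bsub>E\<^esub>}" by (rule essential[OF N])
    fix a b assume ab: "a \<in> W" "b \<in> W" "s a = s b"
    have "a \<ominus>\<^bsub>E\<^esub> b \<in> W" using submod_minus[OF W ab(1,2)] .
    have c: "s a \<in> carrier G" "s b \<in> carrier G" using hom_closed[OF s(1)] ab by auto
    have "s ((a \<ominus>\<^bsub>E\<^esub> b) \<oplus>\<^bsub>E\<^esub> b) = s (a \<ominus>\<^bsub>E\<^esub> b) \<oplus>\<^bsub>G\<^esub> s b"
      using LinearCombinations.module_hom_add[OF s(1)] \<open>a \<ominus>\<^bsub>E\<^esub> b \<in> W\<close> ab(2) by simp
    then have "s b = s (a \<ominus>\<^bsub>E\<^esub> b) \<oplus>\<^bsub>G\<^esub> s b" using ab WE E.sub_add_cancel by simp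
    moreover have "s (a \<ominus>\<^bsub>E\<^esub> b) \<in> carrier G" using hom_closed[OF s(1)] \<open>a \<ominus>\<^bsub>E\<^esub> b \<in> W\<close> by simp
    ultimately have "s (a \<ominus>\<^bsub>E\<^esub> b) = \<zero>\<^bsub>G\<^esub>" using c G.M.add.r_cancel_one' by simp
    then have "a \<ominus>\<^bsub>E\<^esub> b \<in> ?N" using \<open>a \<ominus>\<^bsub>E\<^esub> b \<in> W\<close> by simp
    then show "a = b" using N0 WE ab E.minus_zero_iff by auto
  qed
  have start: "\<exists>s. ok (f ` carrier L) s"
  proof -
    have W: "submod R (f ` carrier L) E" by (rule hom_image_submod[OF E.module_axioms f(1) L.carrier_submod])
    have fW: "f \<in> module_hom R L (E\<lparr>carrier := f ` carrier L\<rparr>)"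
      using f(1) by (auto simp: LinearCombinations.module_hom_def)
    have "\<exists>s\<in>module_hom R (E\<lparr>carrier := f ` carrier L\<rparr>) G. \<forall>x\<in>carrier L. s (f x) = j x"
    proof (rule hom_through_surjective[OF L.module_axioms submod_module[OF W] G.module_axioms fW _ jG])
      fix x assume x: "x \<in> carrier L" "f x = \<zero>\<^bsub>E\<lparr>carrier := f ` carrier L\<rparr>\<^esub>"
      then have "x = \<zero>\<^bsub>L\<^esub>"
        using inj_onD[OF f(2), of x "\<zero>\<^bsub>L\<^esub>"] hom_zero[OF L.module_axioms E.module_axioms f(1)] by simp
      then show "j x = \<zero>\<^bsub>G\<^esub>" using hom_zero[OF L.module_axioms G.module_axioms jG] by simp
    qed simp
    then show ?thesis
      using W fg_module_image[OF L submod_module[OF W] fW] by (auto simp: ok_def)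
  qed
  define S where "S = {s ` W |W s. ok W s}"
  have S0: "S \<noteq> {}" using start by (auto simp: S_def)
  have S: "submod R A G" if "A \<in> S" for A
  proof -
    obtain W s where W: "ok W s" "A = s ` W" using \<open>A \<in> S\<close> by (auto simp: S_def)
    then have "submod R W E" "s \<in> module_hom R (E\<lparr>carrier := W\<rparr>) G" by (auto simp: ok_def)
    then show ?thesis
      using hom_image_submod[OF G.module_axioms _ module.carrier_submod[OF submod_module]] W(2) by fastforce
  qed
  have "\<exists>A\<in>S. \<forall>B\<in>S. A \<subseteq> B \<longrightarrow> B = A"
    by (rule fg_maximal_submodule[OF noetherian_ring_axioms G S0]) (rule S)
  then obtain A where "A \<in> S" and "\<forall>B\<in>S. A \<subseteq> B \<longrightarrow> B = A" by (elim bexE)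
  note maxA = this(2)[rule_format]
  from \<open>A \<in> S\<close> obtain W s where W: "ok W s" "A = s ` W" by (auto simp: S_def)
  have subW: "submod R W E" and fW: "f ` carrier L \<subseteq> W" and fgW: "fg_module R (E\<lparr>carrier := W\<rparr>)"
    and s: "s \<in> module_hom R (E\<lparr>carrier := W\<rparr>) G" "\<And>x. x \<in> carrier L \<Longrightarrow> s (f x) = j x"
    using W(1) by (auto simp: ok_def)
  have WE: "W \<subseteq> carrier E" by (rule submodD(2)[OF subW])
  have "carrier E \<subseteq> W"
  proof
    fix e assume e: "e \<in> carrier E"
    show "e \<in> W"
    proof (rule ccontr)
      assume "e \<notin> W"
      define W' where "W' = E.span (insert e W)"
      have eW: "insert e W \<subseteq> carrier E" using e WE by simp
      have subW': "submod R W' E" unfolding W'_def by (rule E.span_is_submodule[OF eW])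
      have W'sup: "insert e W \<subseteq> W'" unfolding W'_def by (rule E.in_own_span[OF eW])
      interpret W': Module.module R "E\<lparr>carrier := W'\<rparr>" by (rule submod_module[OF subW'])
      obtain B where B: "B \<subseteq> W" "finite B" "\<And>N. submod R N (E\<lparr>carrier := W\<rparr>) \<Longrightarrow> B \<subseteq> N \<Longrightarrow> N = W"
        using fg_module_generators[OF fgW] by auto
      have fgW': "fg_module R (E\<lparr>carrier := W'\<rparr>)"
      proof (rule W'.fg_moduleI)
        show "finite (insert e B)" "insert e B \<subseteq> carrier (E\<lparr>carrier := W'\<rparr>)" using B W'sup by auto
        fix N assume N: "submod R N (E\<lparr>carrier := W'\<rparr>)" "insert e B \<subseteq> N"
        have NE: "submod R N E"
          using N(1) submodD(2)[OF subW'] by (auto simp: LinearCombinations.submodule_def E.module_axioms)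
        have "submod R (N \<inter> W) (E\<lparr>carrier := W\<rparr>)"
          using submod_Int[OF NE subW] submod_module[OF subW] by (auto simp: LinearCombinations.submodule_def)
        then have "N \<inter> W = W" using B N(2) by blast
        then have "insert e W \<subseteq> N" using N(2) by blast
        then show "carrier (E\<lparr>carrier := W'\<rparr>) \<subseteq> N" using E.span_is_subset[OF _ NE] by (simp add: W'_def)
      qed
      have incl: "(\<lambda>w. w) \<in> module_hom R (E\<lparr>carrier := W\<rparr>) (E\<lparr>carrier := W'\<rparr>)"
        using W'sup by (auto simp: LinearCombinations.module_hom_def)
      have "extends_along R (E\<lparr>carrier := W\<rparr>) (\<lambda>w. w) (E\<lparr>carrier := W'\<rparr>) G"
        unfolding G_def by (rule finsupp_extends_along[OF fgW' submod_module[OF subW] incl _ X]) simp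
      from extends_alongD[OF this s(1)] obtain s' where s': "s' \<in> module_hom R (E\<lparr>carrier := W'\<rparr>) G"
        "\<And>w. w \<in> W \<Longrightarrow> s' w = s w" by auto
      have ok': "ok W' s'"
        using subW' fW W'sup fgW' s'(1) s'(2) s(2) by (auto simp: ok_def)
      then have "s' ` W' \<in> S" by (auto simp: S_def)
      moreover have "A \<subseteq> s' ` W'"
      proof
        fix y assume "y \<in> A"
        then obtain w where "w \<in> W" "y = s' w" using W(2) s'(2) by auto
        then show "y \<in> s' ` W'" using W'sup by blast
      qed
      ultimately have "s' ` W' = A" by (rule maxA)
      then have "s' e \<in> s ` W" using W(2) W'sup by blast
      then obtain w where w: "w \<in> W" "s' e = s' w" using s'(2) by auto
      then have "e = w" using inj_onD[OF inj[OF ok']] W'sup by blast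
      with w(1) \<open>e \<notin> W\<close> show False by simp
    qed
  qed
  with WE have EW: "E\<lparr>carrier := W\<rparr> = E" by simp
  have fgE: "fg_module R E" using fgW EW by simp
  have sE: "s \<in> module_hom R E G" using s(1) EW by simp
  have "inj_on s (carrier E)" using inj[OF W(1)] \<open>carrier E \<subseteq> W\<close> inj_on_subset by blast
  from injective_extends_along[OF E G E.module_axioms sE this]
  obtain r where r: "r \<in> module_hom R G E" "\<And>x. x \<in> carrier E \<Longrightarrow> r (s x) = x"
    using extends_alongD[OF _ hom_id] by blast
  have "projective_module R E"
    by (rule retract_of_finsupp_projective[OF E.module_axioms sE[unfolded G_def] r(1)[unfolded G_def]])
      (rule r(2))
  with fgE show ?thesis by blast
qed

end

section \<open>Invariance under isomorphism and direct summands\<close>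

lemma ext1_zero_retract_right:
  assumes "ext1_zero R M N'" "s \<in> module_hom R N N'" "r \<in> module_hom R N' N"
    and rs: "\<And>x. x \<in> carrier N \<Longrightarrow> r (s x) = x"
  shows "ext1_zero R M N"
  using extends_along_retract[OF assms(1)[unfolded ext1_zero_def] assms(2,3)] rs
  unfolding ext1_zero_def by blast

lemma modules_isomorphic_inverse:
  assumes "modules_isomorphic R M N"
  obtains f g where "f \<in> module_hom R M N" "g \<in> module_hom R N M"
    "\<And>x. x \<in> carrier M \<Longrightarrow> g (f x) = x" "\<And>y. y \<in> carrier N \<Longrightarrow> f (g y) = y"
proof -
  have M: "module R M" and N: "module R N" using assms by (auto simp: modules_isomorphic_def)
  obtain f where f: "f \<in> module_hom R M N" "inj_on f (carrier M)" "f ` carrier M = carrier N"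
    using assms by (auto simp: modules_isomorphic_def bij_betw_def)
  obtain g where g: "g \<in> module_hom R N M" "\<And>y. y \<in> carrier N \<Longrightarrow> f (g y) = y"
    using hom_through_injective[OF M N f(1,2) hom_id] f(3) by auto
  have "g (f x) = x" if "x \<in> carrier M" for x
    by (rule inj_onD[OF f(2)]) (use that g(2) hom_closed[OF f(1)] hom_closed[OF g(1)] in auto)
  then show ?thesis using that[OF f(1) g(1)] g(2) by blast
qed

lemma modules_isomorphicI:
  assumes "module R M" "module R N" "f \<in> module_hom R M N" "g \<in> module_hom R N M"
    "\<And>x. x \<in> carrier M \<Longrightarrow> g (f x) = x" "\<And>y. y \<in> carrier N \<Longrightarrow> f (g y) = y"
  shows "modules_isomorphic R M N"
proof -
  have "bij_betw f (carrier M) (carrier N)"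
    by (rule bij_betw_byWitness[of _ g]) (use assms hom_closed[OF assms(3)] hom_closed[OF assms(4)] in auto)
  with assms(1-3) show ?thesis by (auto simp: modules_isomorphic_def)
qed

lemma modules_isomorphic_sym: "modules_isomorphic R M N \<Longrightarrow> modules_isomorphic R N M"
  by (rule modules_isomorphic_inverse, assumption)
    (rule modules_isomorphicI, auto simp: modules_isomorphic_def)

lemma modules_isomorphic_trans:
  assumes "modules_isomorphic R L M" "modules_isomorphic R M N"
  shows "modules_isomorphic R L N"
proof -
  obtain f g where "f \<in> module_hom R L M" "bij_betw f (carrier L) (carrier M)"
    "g \<in> module_hom R M N" "bij_betw g (carrier M) (carrier N)"
    using assms by (auto simp: modules_isomorphic_def)
  then show ?thesis
    using assms module_hom_comp[of f R L M g N] bij_betw_trans[of f _ _ g]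
    by (auto simp: modules_isomorphic_def comp_def)
qed

lemma ext1_zero_isomorphic:
  assumes iso: "modules_isomorphic R M M'" and ext: "ext1_zero R M M"
  shows "ext1_zero R M' M'"
proof (rule modules_isomorphic_inverse[OF iso])
  fix f g assume f: "f \<in> module_hom R M M'" and g: "g \<in> module_hom R M' M"
    and gf: "\<And>x. x \<in> carrier M \<Longrightarrow> g (f x) = x" and fg: "\<And>y. y \<in> carrier M' \<Longrightarrow> f (g y) = y"
  interpret M: Module.module R M using iso by (simp add: modules_isomorphic_def)
  interpret M': Module.module R M' using iso by (simp add: modules_isomorphic_def)
  define F where "F = finsupp_module R (carrier M)"
  have F: "projective_module R F" unfolding F_def by (rule M.R.finsupp_projective)
  interpret F: Module.module R F using F by (rule projectiveD_module)
  define p where "p = ev R M (\<lambda>x. x)"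
  have p: "p \<in> module_hom R F M" "p ` carrier F = carrier M"
    using M.finsupp_cover by (simp_all add: p_def F_def)
  note s = short_exact_kernel[OF F.module_axioms M.module_axioms p]
  have fp: "(\<lambda>x. f (p x)) \<in> module_hom R F M'" by (rule module_hom_comp[OF p(1) f])
  have "f ` carrier M = carrier M'"
    using hom_closed[OF f] hom_closed[OF g] fg by (metis image_eqI image_subsetI subsetI subset_antisym)
  then have surj: "(\<lambda>x. f (p x)) ` carrier F = carrier M'" using p(2) by (metis image_image)
  \<comment> \<open>The same free module presents \<open>M'\<close>, with the same kernel.\<close>
  note s' = short_exact_kernel[OF F.module_axioms M'.module_axioms fp surj]
  have "f (p x) = \<zero>\<^bsub>M'\<^esub> \<longleftrightarrow> p x = \<zero>\<^bsub>M\<^esub>" if "x \<in> carrier F" for x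
    using gf[OF hom_closed[OF p(1) that]] hom_zero[OF M.module_axioms M'.module_axioms f]
      hom_zero[OF M'.module_axioms M.module_axioms g] by metis
  then have ker: "{x \<in> carrier F. f (p x) = \<zero>\<^bsub>M'\<^esub>} = {x \<in> carrier F. p x = \<zero>\<^bsub>M\<^esub>}" by blast
  have "extends_along R (F\<lparr>carrier := {x \<in> carrier F. p x = \<zero>\<^bsub>M\<^esub>}\<rparr>) (\<lambda>x. x) F M"
    using ext ext1_zero_iff[OF s F M.module_axioms] by blast
  then have "extends_along R (F\<lparr>carrier := {x \<in> carrier F. p x = \<zero>\<^bsub>M\<^esub>}\<rparr>) (\<lambda>x. x) F M'"
    by (rule extends_along_retract[OF _ g f fg])
  then show "ext1_zero R M' M'"
    using ext1_zero_iff[OF s'[unfolded ker] F M'.module_axioms] by blast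
qed

lemma projective_retract:
  assumes P: "projective_module R P" and M: "module R M" and i: "i \<in> module_hom R M P"
    and r: "r \<in> module_hom R P M" and ri: "\<And>x. x \<in> carrier M \<Longrightarrow> r (i x) = x"
  shows "projective_module R M"
proof -
  interpret P: Module.module R P using P by (rule projectiveD_module)
  obtain s where s: "s \<in> module_hom R P (finsupp_module R (carrier P))"
    "\<And>x. x \<in> carrier P \<Longrightarrow> ev R P (\<lambda>x. x) (s x) = x"
    using projective_summand_of_finsupp[OF P] by blast
  show ?thesis
    by (rule P.R.retract_of_finsupp_projective[OF M module_hom_comp[OF i s(1)]
          module_hom_comp[OF P.finsupp_cover(1) r]])
      (use s(2) ri hom_closed[OF i] in simp)
qed

lemma projective_isomorphic:
  assumes "modules_isomorphic R M N" "projective_module R M"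
  shows "projective_module R N"
proof (rule modules_isomorphic_inverse[OF assms(1)])
  fix f g assume "f \<in> module_hom R M N" "g \<in> module_hom R N M" "\<And>y. y \<in> carrier N \<Longrightarrow> f (g y) = y"
  then show ?thesis using projective_retract[OF assms(2), of N g f] assms(1) by (auto simp: modules_isomorphic_def)
qed

lemma fg_isomorphic:
  assumes "modules_isomorphic R M N" "fg_module R M"
  shows "fg_module R N"
  using assms fg_module_image[OF assms(2)] by (auto simp: modules_isomorphic_def bij_betw_def)

lemma zero_module_isomorphic:
  assumes "modules_isomorphic R M N" "carrier N = {\<zero>\<^bsub>N\<^esub>}"
  shows "carrier M = {\<zero>\<^bsub>M\<^esub>}"
proof -
  obtain f where f: "f \<in> module_hom R M N" "inj_on f (carrier M)" and M: "module R M"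
    using assms(1) by (auto simp: modules_isomorphic_def bij_betw_def)
  interpret Module.module R M by (rule M)
  have "x = \<zero>\<^bsub>M\<^esub>" if "x \<in> carrier M" for x
    using inj_onD[OF f(2) _ that M.zero_closed] hom_closed[OF f(1)] that assms(2) by auto
  then show ?thesis by blast
qed

lemma zero_module_projective:
  assumes "module R M" "carrier M = {\<zero>\<^bsub>M\<^esub>}"
  shows "projective_module R M"
proof -
  interpret Module.module R M by fact
  show ?thesis
    using assms(2) R.retract_of_finsupp_projective[OF assms(1) hom_const_zero[OF R.finsupp_module] hom_const_zero[OF assms(1)]]
    by auto
qed

lemma zero_module_free:
  assumes "module R M" "carrier M = {\<zero>\<^bsub>M\<^esub>}"
  shows "free_module R M"
proof -
  interpret Module.module R M by fact
  have "span {} = carrier M"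
    using span_is_subset2[of "{}"] submodD(3)[OF span_is_submodule[of "{}"]] assms(2) by auto
  moreover have "lin_indpt {}" by (simp add: lin_dep_def)
  ultimately show ?thesis using assms(1) by (auto simp: free_module_def)
qed

lemma (in cring) isomorphic_self_module_free:
  assumes "modules_isomorphic R M (self_module R)"
  shows "free_module R M"
proof (rule modules_isomorphic_inverse[OF assms])
  interpret M: Module.module R M using assms by (simp add: modules_isomorphic_def)
  fix g f assume g: "g \<in> module_hom R M (self_module R)" and f: "f \<in> module_hom R (self_module R) M"
    and fg: "\<And>x. x \<in> carrier M \<Longrightarrow> f (g x) = x" and gf: "\<And>y. y \<in> carrier (self_module R) \<Longrightarrow> g (f y) = y"
  define u where "u = f \<one>"
  have u: "u \<in> carrier M" using hom_closed[OF f, of \<one>] by (simp add: u_def)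
  have "carrier M \<subseteq> M.span {u}"
  proof
    fix x assume x: "x \<in> carrier M"
    have c: "g x \<in> carrier R" using hom_closed[OF g x] by simp
    have "x = g x \<odot>\<^bsub>M\<^esub> u" using fg[OF x] hom_self_eq[OF f c] by (simp add: u_def)
    moreover have "u \<in> M.span {u}" using M.in_own_span[of "{u}"] u by simp
    ultimately show "x \<in> M.span {u}"
      using submodD(5)[OF M.span_is_submodule[of "{u}"] c, of u] u by simp
  qed
  then have "M.span {u} = carrier M" using M.span_is_subset2[of "{u}"] u by auto
  moreover have "M.lin_indpt {u}"
  proof (rule M.finite_lin_indpt2)
    fix a assume a: "a \<in> {u} \<rightarrow> carrier R" "M.lincomb a {u} = \<zero>\<^bsub>M\<^esub>"
    then have au: "a u \<in> carrier R" "a u \<odot>\<^bsub>M\<^esub> u = \<zero>\<^bsub>M\<^esub>" using u by (auto simp: M.lincomb_def)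
    then have "f (a u) = \<zero>\<^bsub>M\<^esub>" using hom_self_eq[OF f au(1)] by (simp add: u_def)
    then have "a u = \<zero>" using gf[of "a u"] hom_zero[OF M.module_axioms self_module g] au(1) by simp
    then show "\<forall>v\<in>{u}. a v = \<zero>" by simp
  qed (use u in auto)
  ultimately show ?thesis using u M.module_axioms by (auto simp: free_module_def intro!: exI[of _ "{u}"])
qed

section \<open>Shifting along syzygies and cosyzygies\<close>

lemma first_syzygy_short_exact:
  fixes M :: "('a, 'm) module"
  assumes "first_syzygy R M K"
  obtains P :: "('a, ('a, 'm) univ) module" and f g
  where "projective_cover R P f M" "short_exact R K g P f M"
proof -
  obtain P :: "('a, ('a, 'm) univ) module" and f g where P: "projective_cover R P f M"
    and g: "g \<in> module_hom R K P" "inj_on g (carrier K)" "g ` carrier K = mod_hom.ker P M f"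
    using assms by (auto simp: first_syzygy_def)
  have "short_exact R K g P f M"
    using assms P g hom_kernel[of R P M f]
    by (auto simp: projective_cover_def first_syzygy_def short_exact_def projective_module_def)
  with P that show ?thesis by blast
qed

lemma first_cosyzygy_short_exact:
  fixes M :: "('a, 'm) module"
  assumes "first_cosyzygy R M C"
  obtains E :: "('a, ('a, 'm) univ) module" and f g
  where "injective_hull R M f E" "short_exact R M f E g C"
proof -
  obtain E :: "('a, ('a, 'm) univ) module" and f g where E: "injective_hull R M f E"
    and g: "g \<in> module_hom R E C" "g ` carrier E = carrier C" "mod_hom.ker E C g = f ` carrier M"
    using assms by (auto simp: first_cosyzygy_def)
  have "short_exact R M f E g C"
    using assms E g hom_kernel[of R E C g]
    by (auto simp: injective_hull_def first_cosyzygy_def short_exact_def injective_module_def)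
  with E that show ?thesis by blast
qed

text \<open>
  A submodule that maps onto \<open>M\<close> spans \<open>P\<close> together with the kernel, and the kernel is superfluous.
\<close>
lemma projective_cover_minimal:
  assumes cov: "projective_cover R P f M" and L: "submod R L P" and surj: "f ` L = carrier M"
  shows "L = carrier P"
proof -
  have P: "module R P" and M: "module R M" and f: "f \<in> module_hom R P M"
    using cov by (auto simp: projective_cover_def projective_module_def)
  interpret P: Module.module R P by (rule P)
  interpret M: Module.module R M by (rule M)
  note ker = hom_kernel_submod[OF P M f]
  have LP: "l \<in> L \<Longrightarrow> l \<in> carrier P" for l using submodD(2)[OF L] by blast
  have "P.submodule_sum {x \<in> carrier P. f x = \<zero>\<^bsub>M\<^esub>} L = carrier P"
  proof
    show "P.submodule_sum {x \<in> carrier P. f x = \<zero>\<^bsub>M\<^esub>} L \<subseteq> carrier P"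
      using LP by (auto simp: P.submodule_sum_def)
    show "carrier P \<subseteq> P.submodule_sum {x \<in> carrier P. f x = \<zero>\<^bsub>M\<^esub>} L"
    proof
      fix x assume x: "x \<in> carrier P"
      have "f x \<in> f ` L" using hom_closed[OF f x] surj by simp
      then obtain l where l: "l \<in> L" "f x = f l" by blast
      have "f (x \<ominus>\<^bsub>P\<^esub> l) = \<zero>\<^bsub>M\<^esub>"
        using x l LP[OF l(1)] hom_closed[OF f] by (simp add: hom_minus[OF P M f] M.minus_zero_iff)
      moreover have "x = (x \<ominus>\<^bsub>P\<^esub> l) \<oplus>\<^bsub>P\<^esub> l" using x LP[OF l(1)] by (simp add: P.sub_add_cancel)
      ultimately show "x \<in> P.submodule_sum {x \<in> carrier P. f x = \<zero>\<^bsub>M\<^esub>} L"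
        using x l(1) LP[OF l(1)] unfolding P.submodule_sum_def
        by (intro image_eqI[of _ _ "(x \<ominus>\<^bsub>P\<^esub> l, l)"]) auto
    qed
  qed
  then show ?thesis
    using cov L hom_kernel[OF P M f] by (simp add: projective_cover_def)
qed

text \<open>
  Lifts of finitely many generators of \<open>M\<close> span a submodule of \<open>P\<close> that maps onto \<open>M\<close>.
\<close>
lemma projective_cover_fg:
  assumes cov: "projective_cover R P f M" and fg: "fg_module R M"
  shows "fg_module R P"
proof -
  have P: "module R P" and M: "module R M" and f: "f \<in> module_hom R P M" "f ` carrier P = carrier M"
    using cov by (auto simp: projective_cover_def projective_module_def)
  interpret P: Module.module R P by (rule P)
  obtain B where B: "B \<subseteq> carrier M" "finite B" "\<And>N. submod R N M \<Longrightarrow> B \<subseteq> N \<Longrightarrow> N = carrier M"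
    using fg_module_generators[OF fg] by blast
  obtain C where C: "C \<subseteq> carrier P" "finite C" "f ` C = B"
    using finite_subset_image[OF B(2), of f "carrier P"] B(1) f(2) by metis
  show ?thesis
  proof (rule P.fg_moduleI[OF C(2,1)])
    fix N assume N: "submod R N P" "C \<subseteq> N"
    have "f ` N = carrier M" by (rule B(3)[OF hom_image_submod[OF M f(1) N(1)]]) (use C(3) N(2) in blast)
    from projective_cover_minimal[OF cov N(1) this] show "carrier P \<subseteq> N" by simp
  qed
qed

text \<open>
  The image of a section of the cover is all of \<open>P\<close> by minimality, so the cover is an isomorphism.
\<close>
lemma first_syzygy_of_projective:
  fixes M :: "('a, 'm) module"
  assumes syz: "first_syzygy R M K" and M: "projective_module R M"
  shows "carrier K = {\<zero>\<^bsub>K\<^esub>}"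
proof (rule first_syzygy_short_exact[OF syz])
  fix P :: "('a, ('a, 'm) univ) module" and f g
  assume cov: "projective_cover R P f M" and s: "short_exact R K g P f M"
  note S = short_exactD[OF s]
  interpret K: Module.module R K by (rule S(1))
  interpret M: Module.module R M by (rule S(3))
  obtain t where t: "t \<in> module_hom R M P" "\<And>x. x \<in> carrier M \<Longrightarrow> f (t x) = x"
    using projective_lift[OF M S(2,3,6,7) hom_id] by blast
  have "submod R (t ` carrier M) P" by (rule hom_image_submod[OF S(2) t(1) M.carrier_submod])
  moreover have "f ` t ` carrier M = carrier M" using t(2) by (force simp: image_iff)
  ultimately have tP: "t ` carrier M = carrier P" by (rule projective_cover_minimal[OF cov])
  have "x = \<zero>\<^bsub>K\<^esub>" if x: "x \<in> carrier K" for x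
  proof -
    have "g x \<in> carrier P" using hom_closed[OF S(4) x] .
    then obtain y where y: "y \<in> carrier M" "g x = t y" using tP by blast
    then have "y = \<zero>\<^bsub>M\<^esub>" using t(2)[OF y(1)] S(9)[OF x] by simp
    then have "g x = g \<zero>\<^bsub>K\<^esub>" using y(2) hom_zero[OF S(3,2) t(1)] hom_zero[OF S(1,2,4)] by simp
    then show ?thesis using inj_onD[OF S(5)] x by simp
  qed
  then show "carrier K = {\<zero>\<^bsub>K\<^esub>}" by blast
qed

lemma nth_syzygy_of_projective:
  assumes "nth_syzygy R n N K" "projective_module R N"
  shows "projective_module R K \<and> (n > 0 \<longrightarrow> carrier K = {\<zero>\<^bsub>K\<^esub>})"
  using assms(1)
proof (induction n arbitrary: K)
  case 0
  then show ?case using projective_isomorphic[OF _ assms(2)] by simp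
next
  case (Suc n)
  then obtain L where L: "nth_syzygy R n N L" "first_syzygy R L K" by auto
  then have K0: "carrier K = {\<zero>\<^bsub>K\<^esub>}" using first_syzygy_of_projective Suc.IH by blast
  moreover have "module R K" using L(2) by (simp add: first_syzygy_def)
  ultimately show ?case using zero_module_projective by blast
qed

context local_artinian_gorenstein_ring
begin

text \<open>
  Let \<open>h : K \<rightarrow> L\<close> and let \<open>q : Q \<rightarrow> K\<close> be a free cover with kernel \<open>K\<^sub>2\<close>. A lift \<open>\<eta> : Q \<rightarrow> P\<close> of
  \<open>h \<circ> q\<close> maps \<open>K\<^sub>2\<close> into \<open>K\<close>; as \<open>Ext\<^sup>1(K, K) = 0\<close>, it can be corrected by a map \<open>Q \<rightarrow> K\<close> so that it
  descends to \<open>v : K \<rightarrow> P\<close> with \<open>p \<circ> v = h\<close>. Since \<open>P\<close> is injective with respect to \<open>K \<rightarrow> P\<close>, \<open>v\<close>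
  extends to \<open>P \<rightarrow> P\<close>, and composing with \<open>p\<close> gives the extension of \<open>h\<close>.
\<close>
lemma ext1_zero_of_syzygy:
  assumes s: "short_exact R K i P p L" and P: "projective_module R P" "fg_module R P"
    and ext: "ext1_zero R K K"
  shows "ext1_zero R L L"
proof -
  note S = short_exactD[OF s]
  interpret K: Module.module R K by (rule S(1))
  interpret P: Module.module R P by (rule S(2))
  interpret L: Module.module R L by (rule S(3))
  define Q where "Q = finsupp_module R (carrier K)"
  have Q: "projective_module R Q" unfolding Q_def by (rule finsupp_projective)
  interpret Q: Module.module R Q using Q by (rule projectiveD_module)
  define q where "q = ev R K (\<lambda>x. x)"
  have q: "q \<in> module_hom R Q K" "q ` carrier Q = carrier K"
    using K.finsupp_cover by (simp_all add: q_def Q_def)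
  define K2 where "K2 = Q\<lparr>carrier := {x \<in> carrier Q. q x = \<zero>\<^bsub>K\<^esub>}\<rparr>"
  have s2: "short_exact R K2 (\<lambda>x. x) Q q K"
    unfolding K2_def by (rule short_exact_kernel[OF Q.module_axioms K.module_axioms q])
  note S2 = short_exactD[OF s2]
  have extK: "extends_along R K2 (\<lambda>x. x) Q K" using ext ext1_zero_iff[OF s2 Q K.module_axioms] by blast
  have "extends_along R K i P L"
    unfolding extends_along_def
  proof
    fix h assume h: "h \<in> module_hom R K L"
    obtain \<eta> where \<eta>: "\<eta> \<in> module_hom R Q P" "\<And>x. x \<in> carrier Q \<Longrightarrow> p (\<eta> x) = h (q x)"
      using projective_lift[OF Q S(2,3,6,7) module_hom_comp[OF q(1) h]] by blast
    have K2Q: "x \<in> carrier K2 \<Longrightarrow> x \<in> carrier Q" for x by (simp add: K2_def)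
    have "p (\<eta> x) = \<zero>\<^bsub>L\<^esub>" if x: "x \<in> carrier K2" for x
      using \<eta>(2)[OF K2Q[OF x]] S2(9)[OF x] hom_zero[OF S(1,3) h] by simp
    then obtain w where w: "w \<in> module_hom R K2 K" "\<And>x. x \<in> carrier K2 \<Longrightarrow> i (w x) = \<eta> x"
      using short_exact_lift[OF s S2(1) module_hom_comp[OF S2(4) \<eta>(1)]] by blast
    obtain u where u: "u \<in> module_hom R Q K" "\<And>x. x \<in> carrier K2 \<Longrightarrow> u x = w x"
      using extends_alongD[OF extK w(1)] by blast
    note iu = module_hom_comp[OF u(1) S(4)]
    have "\<eta> x \<ominus>\<^bsub>P\<^esub> i (u x) = \<zero>\<^bsub>P\<^esub>" if x: "x \<in> carrier K2" for x
      using w(2)[OF x] u(2)[OF x] hom_closed[OF \<eta>(1) K2Q[OF x]] by (simp add: P.minus_zero_iff)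
    then obtain v where v: "v \<in> module_hom R K P" "\<And>x. x \<in> carrier Q \<Longrightarrow> v (q x) = \<eta> x \<ominus>\<^bsub>P\<^esub> i (u x)"
      using short_exact_descend[OF s2 S(2) hom_minus_hom[OF S(2) \<eta>(1) iu]] by blast
    have pv: "p (v y) = h y" if y: "y \<in> carrier K" for y
    proof -
      obtain x where x: "x \<in> carrier Q" "y = q x" using y q(2) by blast
      have c: "\<eta> x \<in> carrier P" "i (u x) \<in> carrier P" "u x \<in> carrier K"
        using hom_closed[OF \<eta>(1)] hom_closed[OF iu] hom_closed[OF u(1)] x(1) by auto
      have "p (v y) = p (\<eta> x) \<ominus>\<^bsub>L\<^esub> p (i (u x))"
        using v(2)[OF x(1)] x(2) hom_minus[OF S(2,3,6) c(1,2)] by simp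
      also have "\<dots> = h y" using \<eta>(2)[OF x(1)] x(2) S(9)[OF c(3)] hom_closed[OF h y] by (simp add: L.M.minus_eq)
      finally show ?thesis .
    qed
    obtain w' where w': "w' \<in> module_hom R P P" "\<And>y. y \<in> carrier K \<Longrightarrow> w' (i y) = v y"
      using extends_alongD[OF fg_projective_extends_along[OF P(2) S(1,4,5) P] v(1)] by blast
    have "p (w' (i y)) = h y" if "y \<in> carrier K" for y using w'(2)[OF that] pv[OF that] by simp
    then show "\<exists>k\<in>module_hom R P L. \<forall>x\<in>carrier K. k (i x) = h x"
      by (intro bexI[OF _ module_hom_comp[OF w'(1) S(6)]] ballI)
  qed
  then show ?thesis using ext1_zero_iff[OF s P(1) L.module_axioms] by blast
qed

text \<open>
  Dual to the previous argument. Let \<open>h : K \<rightarrow> L\<close>, where \<open>K\<close> is the kernel of a presentation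
  \<open>p : P \<rightarrow> L\<close>. Since \<open>E\<close> is injective with respect to \<open>K \<rightarrow> P\<close>, \<open>f \<circ> h\<close> extends to \<open>a : P \<rightarrow> E\<close>, which
  induces \<open>\<theta> : L \<rightarrow> C\<close>. As \<open>Ext\<^sup>1(C, C) = 0\<close>, \<open>\<theta>\<close> extends to \<open>E \<rightarrow> C\<close>, and this lifts to \<open>w' : E \<rightarrow> E\<close>.
  Subtracting \<open>w' \<circ> f \<circ> p\<close> from \<open>a\<close> leaves a map into \<open>L\<close> that still extends \<open>h\<close>.
\<close>
lemma ext1_zero_of_cosyzygy:
  fixes L :: "('a, 'l) module"
  assumes s: "short_exact R L f E g C" and E: "projective_module R E" "fg_module R E"
    and L: "fg_module R L" and ext: "ext1_zero R C C"
  shows "ext1_zero R L L"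
proof (rule fg_module_presentation[OF L])
  note S = short_exactD[OF s]
  interpret L: Module.module R L by (rule S(1))
  interpret E: Module.module R E by (rule S(2))
  interpret C: Module.module R C by (rule S(3))
  have extC: "extends_along R L f E C" using ext ext1_zero_iff[OF s E(1) C.module_axioms] by blast
  fix K P :: "('a, 'l \<Rightarrow> 'a) module" and i p
  assume sP: "short_exact R K i P p L" and P: "projective_module R P" "fg_module R P"
  note SP = short_exactD[OF sP]
  have "extends_along R K i P L"
    unfolding extends_along_def
  proof
    fix h assume h: "h \<in> module_hom R K L"
    obtain a where a: "a \<in> module_hom R P E" "\<And>x. x \<in> carrier K \<Longrightarrow> a (i x) = f (h x)"
      using extends_alongD[OF fg_projective_extends_along[OF P(2) SP(1,4,5) E] module_hom_comp[OF h S(4)]] by blast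
    have "g (a (i x)) = \<zero>\<^bsub>C\<^esub>" if x: "x \<in> carrier K" for x
      using a(2)[OF x] S(9)[OF hom_closed[OF h x]] by simp
    then obtain \<theta> where \<theta>: "\<theta> \<in> module_hom R L C" "\<And>x. x \<in> carrier P \<Longrightarrow> \<theta> (p x) = g (a x)"
      using short_exact_descend[OF sP S(3) module_hom_comp[OF a(1) S(6)]] by blast
    obtain w where w: "w \<in> module_hom R E C" "\<And>x. x \<in> carrier L \<Longrightarrow> w (f x) = \<theta> x"
      using extends_alongD[OF extC \<theta>(1)] by blast
    obtain w' where w': "w' \<in> module_hom R E E" "\<And>x. x \<in> carrier E \<Longrightarrow> g (w' x) = w x"
      using projective_lift[OF E(1) S(2,3,6,7) w(1)] by blast
    have b: "(\<lambda>x. w' (f (p x))) \<in> module_hom R P E"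
      by (rule module_hom_comp[OF module_hom_comp[OF SP(6) S(4)] w'(1)])
    have "g (a x \<ominus>\<^bsub>E\<^esub> w' (f (p x))) = \<zero>\<^bsub>C\<^esub>" if x: "x \<in> carrier P" for x
    proof -
      have px: "p x \<in> carrier L" "f (p x) \<in> carrier E" using hom_closed[OF SP(6) x] hom_closed[OF S(4)] by auto
      have "g (a x \<ominus>\<^bsub>E\<^esub> w' (f (p x))) = g (a x) \<ominus>\<^bsub>C\<^esub> g (w' (f (p x)))"
        by (rule hom_minus[OF S(2,3,6) hom_closed[OF a(1) x] hom_closed[OF b x]])
      also have "g (w' (f (p x))) = g (a x)" using w'(2)[OF px(2)] w(2)[OF px(1)] \<theta>(2)[OF x] by simp
      finally show ?thesis
        using hom_closed[OF S(6) hom_closed[OF a(1) x]] by (simp add: C.minus_zero_iff)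
    qed
    then obtain k where k: "k \<in> module_hom R P L" "\<And>x. x \<in> carrier P \<Longrightarrow> f (k x) = a x \<ominus>\<^bsub>E\<^esub> w' (f (p x))"
      using short_exact_lift[OF s SP(2) hom_minus_hom[OF S(2) a(1) b]] by blast
    have "k (i x) = h x" if x: "x \<in> carrier K" for x
    proof (rule inj_onD[OF S(5)])
      have ix: "i x \<in> carrier P" using hom_closed[OF SP(4) x] .
      have "w' (f (p (i x))) = \<zero>\<^bsub>E\<^esub>"
        using SP(9)[OF x] hom_zero[OF S(1,2,4)] hom_zero[OF S(2,2) w'(1)] by simp
      then show "f (k (i x)) = f (h x)"
        using k(2)[OF ix] a(2)[OF x] hom_closed[OF S(4) hom_closed[OF h x]] by (simp add: E.M.minus_eq)
      show "k (i x) \<in> carrier L" "h x \<in> carrier L" using hom_closed[OF k(1) ix] hom_closed[OF h x] by auto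
    qed
    then show "\<exists>k\<in>module_hom R P L. \<forall>x\<in>carrier K. k (i x) = h x" by (intro bexI[OF _ k(1)] ballI)
  qed
  then show "ext1_zero R L L" using ext1_zero_iff[OF sP P(1) L.module_axioms] by blast
qed

lemma nth_syzygy_ext1_zero:
  fixes N :: "('a, 'm) module"
  assumes "nth_syzygy R n N K" "fg_module R N"
  shows "fg_module R K \<and> (ext1_zero R K K \<longrightarrow> ext1_zero R N N)"
  using assms(1)
proof (induction n arbitrary: K)
  case 0
  then show ?case using fg_isomorphic[OF _ assms(2)] ext1_zero_isomorphic[OF modules_isomorphic_sym] by auto
next
  case (Suc n)
  then obtain L where L: "nth_syzygy R n N L" and K: "first_syzygy R L K" by auto
  note IH = Suc.IH[OF L]
  show ?case
  proof (rule first_syzygy_short_exact[OF K])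
    fix P :: "('a, ('a, 'm) univ) module" and f g
    assume cov: "projective_cover R P f L" and s: "short_exact R K g P f L"
    have P: "projective_module R P" "fg_module R P"
      using cov projective_cover_fg[OF cov] IH by (auto simp: projective_cover_def)
    show ?thesis using short_exact_fg_left[OF noetherian_ring_axioms s P(2)] ext1_zero_of_syzygy[OF s P] IH by blast
  qed
qed

lemma nth_cosyzygy_ext1_zero:
  fixes N :: "('a, 'm) module"
  assumes "nth_cosyzygy R n N C" "fg_module R N"
  shows "fg_module R C \<and> (ext1_zero R C C \<longrightarrow> ext1_zero R N N)"
  using assms(1)
proof (induction n arbitrary: C)
  case 0
  then show ?case using fg_isomorphic[OF _ assms(2)] ext1_zero_isomorphic[OF modules_isomorphic_sym] by auto
next
  case (Suc n)
  then obtain L where L: "nth_cosyzygy R n N L" and C: "first_cosyzygy R L C" by auto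
  note IH = Suc.IH[OF L]
  show ?case
  proof (rule first_cosyzygy_short_exact[OF C])
    fix E :: "('a, ('a, 'm) univ) module" and f g
    assume hull: "injective_hull R L f E" and s: "short_exact R L f E g C"
    have E: "projective_module R E" "fg_module R E" using injective_hull_fg_projective[OF _ hull] IH by auto
    show ?thesis
      using fg_module_image[OF E(2) short_exactD(3,6,7)[OF s]] ext1_zero_of_cosyzygy[OF s E] IH by blast
  qed
qed

text \<open>
  The identity of \<open>M\<close> extends to a retraction \<open>r\<close> of the hull. Its kernel meets \<open>M\<close> trivially and so
  vanishes by essentiality; hence the hull is an isomorphism.
\<close>
lemma first_cosyzygy_of_projective:
  fixes M :: "('a, 'm) module"
  assumes cosyz: "first_cosyzygy R M C" and M: "projective_module R M" "fg_module R M"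
  shows "carrier C = {\<zero>\<^bsub>C\<^esub>}"
proof (rule first_cosyzygy_short_exact[OF cosyz])
  fix E :: "('a, ('a, 'm) univ) module" and f g
  assume hull: "injective_hull R M f E" and s: "short_exact R M f E g C"
  note S = short_exactD[OF s]
  interpret M: Module.module R M by (rule S(1))
  interpret E: Module.module R E by (rule S(2))
  interpret C: Module.module R C by (rule S(3))
  have E: "fg_module R E" using injective_hull_fg_projective[OF M(2) hull] by blast
  obtain r where r: "r \<in> module_hom R E M" "\<And>x. x \<in> carrier M \<Longrightarrow> r (f x) = x"
    using extends_alongD[OF fg_projective_extends_along[OF E S(1,4,5) M] hom_id] by blast
  let ?N = "{x \<in> carrier E. r x = \<zero>\<^bsub>M\<^esub>}"
  have "?N \<inter> f ` carrier M = {\<zero>\<^bsub>E\<^esub>}"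
    using r(2) hom_zero[OF S(1,2,4)] hom_zero[OF S(2,1) r(1)] by (auto simp: image_iff) (metis M.M.zero_closed)
  then have N: "?N = {\<zero>\<^bsub>E\<^esub>}"
    using hull hom_kernel_submod[OF S(2,1) r(1)] by (simp add: injective_hull_def)
  have "g x = \<zero>\<^bsub>C\<^esub>" if x: "x \<in> carrier E" for x
  proof -
    have rx: "r x \<in> carrier M" "f (r x) \<in> carrier E" using hom_closed[OF r(1) x] hom_closed[OF S(4)] by auto
    have "r (x \<ominus>\<^bsub>E\<^esub> f (r x)) = \<zero>\<^bsub>M\<^esub>"
      using x rx by (simp add: hom_minus[OF S(2,1) r(1)] r(2) M.minus_zero_iff)
    then have "x \<ominus>\<^bsub>E\<^esub> f (r x) \<in> ?N" using x rx by simp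
    then have "x = f (r x)" using N x rx E.minus_zero_iff by auto
    then show ?thesis using S(9)[OF rx(1)] by simp
  qed
  then have "g ` carrier E \<subseteq> {\<zero>\<^bsub>C\<^esub>}" by blast
  then have "carrier C \<subseteq> {\<zero>\<^bsub>C\<^esub>}" by (simp only: S(7))
  then show "carrier C = {\<zero>\<^bsub>C\<^esub>}" using C.M.zero_closed by blast
qed

lemma nth_cosyzygy_of_projective:
  assumes "nth_cosyzygy R n N C" "projective_module R N" "fg_module R N"
  shows "projective_module R C \<and> (n > 0 \<longrightarrow> carrier C = {\<zero>\<^bsub>C\<^esub>})"
  using assms(1)
proof (induction n arbitrary: C)
  case 0
  then show ?case using projective_isomorphic[OF _ assms(2)] by simp
next
  case (Suc n)
  then obtain L where L: "nth_cosyzygy R n N L" "first_cosyzygy R L C" by auto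
  then have "carrier C = {\<zero>\<^bsub>C\<^esub>}"
    using first_cosyzygy_of_projective Suc.IH nth_cosyzygy_ext1_zero[OF L(1) assms(3)] by blast
  moreover have "module R C" using L(2) by (simp add: first_cosyzygy_def)
  ultimately show ?case using zero_module_projective by blast
qed

section \<open>Rigid syzygies of ideals\<close>

lemma ideal_module_fg: "ideal I R \<Longrightarrow> fg_module R (ideal_module R I)"
  using submod_fg[OF noetherian_ring_axioms self_module_fg] ideal_iff_submod ideal_module_eq by metis

lemma rigid_ideal_projective:
  assumes "ideal I R" "ext1_zero R (ideal_module R I) (ideal_module R I)"
  shows "projective_module R (ideal_module R I)"
  using rigid_ideal_trivial[OF assms]
proof
  assume "I = {\<zero>}"
  then show ?thesis using zero_module_projective[OF ideal_module[OF assms(1)]] by simp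
next
  assume "I = carrier R"
  then show ?thesis using self_module_projective by (simp add: self_module_def)
qed

lemma rigid_syzygy_free:
  fixes M :: "('a, 'm) module"
  assumes M: "module R M" "rigid R M" and I: "ideal I R" and syz: "is_syzygy R n (ideal_module R I) M"
  shows "free_module R M"
proof -
  obtain N' M' :: "('a, ('a, 'a) univ) module" where N': "modules_isomorphic R (ideal_module R I) N'"
    and M': "modules_isomorphic R M M'"
    and nth: "if n \<ge> 0 then nth_syzygy R (nat n) N' M' else nth_cosyzygy R (nat (- n)) N' M'"
    using syz by (auto simp: is_syzygy_def)
  have "ext1_zero R M M" using Ext_trivial_imp_ext1_zero[OF M(1,1)] M(2) by (simp add: rigid_def)
  then have "ext1_zero R M' M'" by (rule ext1_zero_isomorphic[OF M'])
  moreover have fgN': "fg_module R N'" by (rule fg_isomorphic[OF N' ideal_module_fg[OF I]])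
  ultimately have "ext1_zero R N' N'"
    using nth nth_syzygy_ext1_zero[of "nat n" N' M'] nth_cosyzygy_ext1_zero[of "nat (- n)" N' M']
    by (cases "n \<ge> 0") simp_all
  then have ext: "ext1_zero R (ideal_module R I) (ideal_module R I)"
    by (rule ext1_zero_isomorphic[OF modules_isomorphic_sym[OF N']])
  have pN': "projective_module R N'" by (rule projective_isomorphic[OF N' rigid_ideal_projective[OF I ext]])
  show ?thesis
  proof (cases "n = 0")
    case False
    then have "carrier M' = {\<zero>\<^bsub>M'\<^esub>}"
      using nth nth_syzygy_of_projective[OF _ pN'] nth_cosyzygy_of_projective[OF _ pN' fgN']
      by (cases "n \<ge> 0") auto
    then show ?thesis using zero_module_free[OF M(1)] zero_module_isomorphic[OF M'] by blast
  next
    case True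
    then have "modules_isomorphic R N' M'" using nth by simp
    then have iso: "modules_isomorphic R M (ideal_module R I)"
      using M' N' modules_isomorphic_sym modules_isomorphic_trans by metis
    from rigid_ideal_trivial[OF I ext] show ?thesis
    proof
      assume "I = {\<zero>}"
      then show ?thesis using zero_module_free[OF M(1)] zero_module_isomorphic[OF iso] by simp
    next
      assume "I = carrier R"
      then show ?thesis using isomorphic_self_module_free iso by (simp add: self_module_def)
    qed
  qed
qed

lemma auslander_reiten_ideal:
  assumes I: "ideal I R"
    and triv: "trivial_group (Ext R 1 (ideal_module R I) (direct_sum (ideal_module R I) (self_module R)))"
  shows "projective_module R (ideal_module R I)"
proof -
  let ?I = "ideal_module R I"
  let ?D = "direct_sum ?I (self_module R)"
  have IM: "module R ?I" by (rule ideal_module[OF I])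
  have "ext1_zero R ?I ?D"
    by (rule Ext_trivial_imp_ext1_zero[OF IM direct_sum_is_module[OF IM self_module] triv])
  moreover have "(\<lambda>x. (x, \<zero>)) \<in> module_hom R ?I ?D"
    by (auto simp: LinearCombinations.module_hom_def direct_sum_def)
  moreover have "fst \<in> module_hom R ?D ?I"
    by (auto simp: LinearCombinations.module_hom_def direct_sum_def)
  ultimately have "ext1_zero R ?I ?I" by (rule ext1_zero_retract_right) simp
  then show ?thesis by (rule rigid_ideal_projective[OF I])
qed

end

theorem corollary3p10:
  fixes R :: "('a, 'r) ring_scheme"
  assumes "local_ring R" and "artinian_gorenstein_ring R"
  shows "(\<forall>(M :: ('a, 'm) module) I n.
            module R M \<and> rigid R M \<and> ideal I R \<and> is_syzygy R n (ideal_module R I) M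
            \<longrightarrow> free_module R M) \<and>
         (\<forall>I. ideal I R \<and>
            (\<forall>i>0. trivial_group
               (Ext R i (ideal_module R I) (direct_sum (ideal_module R I) (self_module R))))
            \<longrightarrow> projective_module R (ideal_module R I))"
proof -
  interpret local_artinian_gorenstein_ring R
    using assms by (rule local_artinian_gorenstein_ring.intro)
  show ?thesis
  proof (intro conjI allI impI)
    fix M :: "('a, 'm) module" and I n
    assume "module R M \<and> rigid R M \<and> ideal I R \<and> is_syzygy R n (ideal_module R I) M"
    then show "free_module R M" by (elim conjE) (rule rigid_syzygy_free)
  next
    fix I
    assume "ideal I R \<and> (\<forall>i>0. trivial_group
      (Ext R i (ideal_module R I) (direct_sum (ideal_module R I) (self_module R))))"
    then show "projective_module R (ideal_module R I)" by (intro auslander_reiten_ideal) simp_all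
  qed
qed

end
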